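(* Let $$ \gamma_0:=\limsup_{n\to\infty}\ \sup_{\substack{R\in\mathcal{RU}_n,\\ \|R\|_{\infty,\mathbb{T}}\leq 1}}\frac{\log \ell(R)}{\log n}, \qquad \ell(R):=\int_{\mathbb{T}}|R'(z)|\,dm(z), $$ and let $B_b(1)$ be the value at $t=1$ of the integral means spectrum for bounded univalent functions in the unit disk. Then $$ B_b(1)\leq\gamma_0\leq\frac12 . $$
   Context: $\mathbb{D}=\{z\in\mathbb{C}:|z|<1\}$ and $\mathbb{T}=\{z\in\mathbb{C}:|z|=1\}$; $m$ is the normalized Lebesgue measure on $\mathbb{T}$, $dm(z)=|dz|/(2\pi)$. For $Y\subset\mathbb{C}$, $\|f\|_{\infty,Y}=\sup\{|f(z)|: z\in Y\}$. For a positive integer $n$, $\mathcal{R}_n$ is the set of all rational functions $P/Q$, where $P$ and $Q$ are polynomials in the complex variable $z$ with $\deg P\leq n$ and $\deg Q\leq n$. $\mathcal{RU}_n$ is the set of all functions in $\mathcal{R}_n$ which have no poles in the closed disk $\overline{\mathbb{D}}$ and are univalent (i.e. holomorphic and injective) in $\mathbb{D}$. Integral means spectrum: for a function $f$ holomorphic in $\mathbb{D}$, $t\in\mathbb{R}$ and $0<r<1$ put $$ M_t[f'](r)=\frac1{2\pi}\int_0^{2\pi}|f'(re^{i\theta})|^t\,d\theta,\qquad \beta_f(t)=\limsup_{r\to1-}\frac{\log M_t[f'](r)}{|\log(1-r)|}, $$ and $B_b(t)=\sup_f\beta_f(t)$, where the supremum is taken over all functions $f$ that are bounded and univalent in $\mathbb{D}$.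 *)

theory Defs
  imports "HOL-Complex_Analysis.Complex_Analysis"
begin

definition circle_measure :: "complex measure" where
  "circle_measure =
     distr (uniform_measure lborel {0..2*pi}) (restrict_space borel (sphere 0 1)) cis"

definition sup_norm :: "complex set \<Rightarrow> (complex \<Rightarrow> complex) \<Rightarrow> ereal" where
  "sup_norm Y f = (SUP z\<in>Y. ereal (cmod (f z)))"

definition univalent_on :: "(complex \<Rightarrow> complex) \<Rightarrow> complex set \<Rightarrow> bool" where
  "univalent_on f S \<longleftrightarrow> f holomorphic_on S \<and> inj_on f S"

text \<open>Functions are total, with value \<open>0\<close> at the zeros of the denominator. Requiring lowest
  terms loses no rational function and ensures that this convention only affects genuine poles,
  never removable singularities.\<close>

definition rational_funs :: "nat \<Rightarrow> (complex \<Rightarrow> complex) set" where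
  "rational_funs n =
     {\<lambda>z. poly P z / poly Q z |P Q.
        Q \<noteq> 0 \<and> coprime P Q \<and> degree P \<le> n \<and> degree Q \<le> n}"

definition univalent_rational_funs :: "nat \<Rightarrow> (complex \<Rightarrow> complex) set" where
  "univalent_rational_funs n =
     {R \<in> rational_funs n. (\<forall>z\<in>cball 0 1. \<not> is_pole R z) \<and> univalent_on R (ball 0 1)}"

definition boundary_length :: "(complex \<Rightarrow> complex) \<Rightarrow> real" where
  "boundary_length R = (\<integral>z. cmod (deriv R z) \<partial>circle_measure)"

text \<open>For \<open>n \<ge> 1\<close> the identity belongs to the index set of the supremum; the terms
  \<open>n \<le> 1\<close>, where the denominator \<open>ln n\<close> is \<open>0\<close>, do not influence the limit superior.\<close>

definition gamma0 :: ereal where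
  "gamma0 = limsup (\<lambda>n.
     SUP R\<in>{R \<in> univalent_rational_funs n. sup_norm (sphere 0 1) R \<le> 1}.
       ereal (ln (boundary_length R) / ln (real n)))"

definition integral_mean :: "real \<Rightarrow> (complex \<Rightarrow> complex) \<Rightarrow> real \<Rightarrow> real" where
  "integral_mean t g r =
     1 / (2*pi) * integral {0..2*pi} (\<lambda>\<theta>. cmod (g (of_real r * cis \<theta>)) powr t)"

definition beta_spectrum :: "(complex \<Rightarrow> complex) \<Rightarrow> real \<Rightarrow> ereal" where
  "beta_spectrum f t =
     Limsup (at_left 1) (\<lambda>r. ereal (ln (integral_mean t (deriv f) r) / \<bar>ln (1 - r)\<bar>))"

definition B_b :: "real \<Rightarrow> ereal" where
  "B_b t = (SUP f\<in>{f. univalent_on f (ball 0 1) \<and> bounded (f ` ball 0 1)}. beta_spectrum f t)"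

end

theory Submission imports Defs "HOL-Real_Asymp.Real_Asymp" begin

text \<open>Upper bound. Let \<open>R\<close> be univalent of degree \<open>n\<close> with \<open>|R| \<le> 1\<close>, and let \<open>B\<close> be the finite
  Blaschke product of degree \<open>n\<close> whose zeros are the reflections of the poles of \<open>R\<close>. With the kernel
  \<open>k\<^sub>z(w) = (1 - cnj (B z) * B w) / (1 - cnj z * w)\<close> one has the reproducing formula
  \<open>\<pi> R'(z) = \<integral> R' cnj (k\<^sub>z\<^sup>2) dA\<close> over the disc, while the mean of \<open>|k\<^sub>z(w)|\<^sup>2\<close> over the circle of
  all \<open>z\<close> is \<open>p(w) = (1 - |B w|\<^sup>2) / (1 - |w|\<^sup>2)\<close>. Hence the length of \<open>R\<close> is at most
  \<open>(1/\<pi>) \<integral> |R'| p dA\<close>. Here \<open>\<integral> |R'|\<^sup>2 dA\<close> is the area of the image, at most \<open>\<pi>\<close>, and \<open>\<integral> p\<^sup>2 dA\<close> is by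
  Hardy's inequality at most a constant times \<open>\<integral> |B'|\<^sup>2 dA = \<pi> n\<close>. So the length is \<open>O(sqrt n)\<close>.

  Lower bound. Let \<open>f\<close> be bounded and univalent. A weak form of Bieberbach's inequality for the second
  coefficient shows that \<open>|f(r z) - f(r w)|\<close> is at least \<open>|z - w|\<close> times a power of \<open>1 - r\<close>, so the
  Taylor sections of \<open>f(r z)\<close> of degree \<open>(1 - r) powr (-1-\<epsilon>)\<close>, whose error is smaller than any
  power of \<open>1 - r\<close>, are univalent; their lengths are comparable to the integral mean of \<open>f'\<close>.\<close>

section \<open>Circle means\<close>

text \<open>Only exponents of \<open>n\<close> survive in \<open>gamma0\<close>, so constants may be
  crude: a coefficient bound 24 instead of 4 and a power \<open>(1 - r) ^ 25\<close> suffice. The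
  exponent 1/2 is a Cauchy-Schwarz balance: the image has bounded area, while \<open>p^2\<close> has
  integral of order \<open>n\<close>, the degree of \<open>B\<close>. The kernel is squared because
  the disc pairing with \<open>R'\<close> is the circle pairing of \<open>R\<close> with \<zeta>
  k^2, and a square in the denominator reproduces a derivative; the terms containing
  \<open>B\<close> drop out because \<open>B\<close> clears the poles of the reflected
  \<open>R\<close>. The obstacle is the circle itself: \<open>1 - |w|^2\<close> vanishes there, and
  the quotient defining the kernel degenerates when both points reach it. Hence \<open>z\<close>
  stays on a circle of radius below 1, the kernel diagonal is integrated over smaller discs, and
  both limits come last. For the lower bound, uniform closeness does not preserve injectivity; the
  error must have a small Lipschitz constant, to be compared with a lower bound for the difference
  quotients of \<open>f\<close>. Areas use the variable \<open>s = |z|^2\<close>, in which dA /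
  \<pi> becomes ds times the circle mean at radius \<open>sqrt s\<close>.\<close>

definition circle_mean :: "real \<Rightarrow> (complex \<Rightarrow> 'a::banach) \<Rightarrow> 'a" where
  "circle_mean r F = (1 / (2 * pi)) *\<^sub>R integral {0..2*pi} (\<lambda>\<theta>. F (of_real r * cis \<theta>))"

lemma circle_integrable:
  fixes F :: "complex \<Rightarrow> 'a::banach"
  assumes "continuous_on (sphere 0 r) F" "0 \<le> r"
  shows "(\<lambda>\<theta>. F (of_real r * cis \<theta>)) integrable_on {0..2*pi}"
proof (rule integrable_continuous_interval)
  show "continuous_on {0..2*pi} (\<lambda>\<theta>. F (of_real r * cis \<theta>))"
    by (rule continuous_on_compose2[OF assms(1)])
       (use assms(2) in \<open>auto intro!: continuous_intros simp: norm_mult\<close>)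
qed

lemma circle_mean_cong:
  assumes "0 \<le> r" "\<And>z. norm z = r \<Longrightarrow> F z = G z"
  shows "circle_mean r F = circle_mean r G"
  unfolding circle_mean_def
  by (intro arg_cong[where f = "\<lambda>x. _ *\<^sub>R x"] integral_cong) (use assms in \<open>auto simp: norm_mult\<close>)

lemma circle_mean_add:
  assumes "continuous_on (sphere 0 r) F" "continuous_on (sphere 0 r) G" "0 \<le> r"
  shows "circle_mean r (\<lambda>z. F z + G z) = circle_mean r F + circle_mean r G"
  unfolding circle_mean_def
  by (subst integral_add) (use assms circle_integrable in \<open>auto simp: scaleR_add_right\<close>)

lemma circle_mean_diff:
  assumes "continuous_on (sphere 0 r) F" "continuous_on (sphere 0 r) G" "0 \<le> r"
  shows "circle_mean r (\<lambda>z. F z - G z) = circle_mean r F - circle_mean r G"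
  unfolding circle_mean_def
  by (subst integral_diff) (use assms circle_integrable in \<open>auto simp: scaleR_diff_right\<close>)

lemma circle_mean_cmult:
  fixes F :: "complex \<Rightarrow> 'a::{banach,real_normed_field}"
  shows "circle_mean r (\<lambda>z. c * F z) = c * circle_mean r F"
  unfolding circle_mean_def by simp

lemma circle_mean_const [simp]: "circle_mean r (\<lambda>z. c) = c"
  unfolding circle_mean_def by simp

text \<open>The radius 0 does occur: it is the left endpoint of the radial integrals over
  \<open>sqrt s\<close>.\<close>

lemma circle_mean_0 [simp]: "circle_mean 0 F = F 0"
  unfolding circle_mean_def by simp

lemma circle_mean_mono:
  fixes F G :: "complex \<Rightarrow> real"
  assumes "continuous_on (sphere 0 r) F" "continuous_on (sphere 0 r) G" "0 \<le> r"
    "\<And>z. norm z = r \<Longrightarrow> F z \<le> G z"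
  shows "circle_mean r F \<le> circle_mean r G"
  unfolding circle_mean_def real_scaleR_def
  by (intro mult_left_mono integral_le circle_integrable) (use assms in \<open>auto simp: norm_mult\<close>)

lemma circle_mean_nonneg:
  fixes F :: "complex \<Rightarrow> real"
  assumes "continuous_on (sphere 0 r) F" "0 \<le> r" "\<And>z. norm z = r \<Longrightarrow> 0 \<le> F z"
  shows "0 \<le> circle_mean r F"
  using circle_mean_mono[of r "\<lambda>_. 0" F] assms by auto

lemma norm_circle_mean_le:
  fixes F :: "complex \<Rightarrow> 'a::banach"
  assumes "continuous_on (sphere 0 r) F" "0 \<le> r"
  shows "norm (circle_mean r F) \<le> circle_mean r (\<lambda>z. norm (F z))"
  unfolding circle_mean_def norm_scaleR real_scaleR_def
  by (subst abs_of_nonneg, simp, intro mult_left_mono integral_norm_bound_integral circle_integrable)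
     (use assms in \<open>auto intro!: continuous_intros\<close>)

lemma circle_mean_bounded_linear:
  assumes "bounded_linear h" "continuous_on (sphere 0 r) F" "0 \<le> r"
  shows "circle_mean r (\<lambda>z. h (F z)) = h (circle_mean r F)"
  using integral_linear[OF circle_integrable[OF assms(2,3)] assms(1)]
  by (simp add: circle_mean_def o_def linear_simps(5)[OF assms(1)])

lemmas circle_mean_cnj = circle_mean_bounded_linear[OF bounded_linear_cnj]
lemmas circle_mean_of_real = circle_mean_bounded_linear[OF bounded_linear_of_real]
lemmas circle_mean_Re = circle_mean_bounded_linear[OF bounded_linear_Re]

section \<open>Cauchy's formulas as circle means\<close>

lemma circle_mean_eq_contour_integral:
  assumes "0 < r"
  shows "circle_mean r F = contour_integral (circlepath 0 r) (\<lambda>z. F z / z) / (2 * pi * \<i>)"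
proof -
  have "contour_integral (circlepath 0 r) (\<lambda>z. F z / z)
      = integral {0..2*pi} (\<lambda>t. F (0 + r * cis t) / (0 + r * cis t) * r * \<i> * cis t)"
    unfolding circlepath_def by (rule contour_integral_part_circlepath_eq) simp
  also have "\<dots> = integral {0..2*pi} (\<lambda>t. \<i> * F (r * cis t))"
    by (rule integral_cong) (use assms in \<open>auto simp: field_simps\<close>)
  also have "\<dots> = \<i> * integral {0..2*pi} (\<lambda>t. F (r * cis t))"
    by simp
  finally show ?thesis
    by (simp add: circle_mean_def scaleR_conv_of_real)
qed

lemma circle_mean_holomorphic_eq:
  assumes "F holomorphic_on cball 0 r" "0 < r"
  shows "circle_mean r F = F 0"
proof -
  have "((\<lambda>u. F u / (u - 0)) has_contour_integral 2 * of_real pi * \<i> * F 0) (circlepath 0 r)"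
    by (rule Cauchy_integral_circlepath_simple) (use assms in auto)
  then show ?thesis
    using assms(2) by (simp add: circle_mean_eq_contour_integral contour_integral_unique)
qed

text \<open>The additional factor \<zeta> in the numerator compensates the
  \<open>1 / \<zeta>\<close> in d\<theta> = d\<zeta> / (\<i> \<zeta>).\<close>

lemma circle_mean_Cauchy:
  assumes "F holomorphic_on cball 0 r" "norm w < r"
  shows "circle_mean r (\<lambda>\<zeta>. F \<zeta> * \<zeta> / (\<zeta> - w)) = F w"
proof -
  have r: "0 < r" using assms(2) norm_ge_zero[of w] by linarith
  have "((\<lambda>u. F u / (u - w)) has_contour_integral 2 * of_real pi * \<i> * F w) (circlepath 0 r)"
    by (rule Cauchy_integral_circlepath_simple) (use assms in auto)
  moreover have "((\<lambda>u. F u / (u - w)) has_contour_integral 2 * of_real pi * \<i> * F w) (circlepath 0 r) \<longleftrightarrow>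
     ((\<lambda>u. F u * u / (u - w) / u) has_contour_integral 2 * of_real pi * \<i> * F w) (circlepath 0 r)"
    by (rule has_contour_integral_cong) (use r in auto)
  ultimately show ?thesis
    using r by (simp add: circle_mean_eq_contour_integral contour_integral_unique)
qed

lemma circle_mean_higher_deriv:
  assumes "F holomorphic_on cball 0 r" "norm w < r"
  shows "circle_mean r (\<lambda>\<zeta>. F \<zeta> * \<zeta> / (\<zeta> - w) ^ Suc k) = (deriv ^^ k) F w / fact k"
proof -
  have r: "0 < r" using assms(2) norm_ge_zero[of w] by linarith
  have c: "continuous_on (cball 0 r) F" "F holomorphic_on ball 0 r"
    using assms holomorphic_on_imp_continuous_on holomorphic_on_subset ball_subset_cball by blast+
  have "((\<lambda>u. F u / (u - w) ^ Suc k) has_contour_integral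
          (2 * pi * \<i>) / fact k * (deriv ^^ k) F w) (circlepath 0 r)"
    by (rule Cauchy_has_contour_integral_higher_derivative_circlepath) (use assms c in auto)
  moreover have "((\<lambda>u. F u / (u - w) ^ Suc k) has_contour_integral x) (circlepath 0 r) \<longleftrightarrow>
     ((\<lambda>u. F u * u / (u - w) ^ Suc k / u) has_contour_integral x) (circlepath 0 r)" for x
    by (rule has_contour_integral_cong) (use r in auto)
  ultimately have "contour_integral (circlepath 0 r) (\<lambda>u. F u * u / (u - w) ^ Suc k / u)
     = (2 * pi * \<i>) / fact k * (deriv ^^ k) F w"
    by (meson contour_integral_unique)
  then show ?thesis
    using r by (simp add: circle_mean_eq_contour_integral)
qed

text \<open>Compactness leaves room outside the closed disc. With this room the Taylor series
  converges uniformly up to the circle of radius \<open>r\<close>, where the means are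
  taken.\<close>

lemma analytic_on_cball_imp_ball:
  fixes F :: "complex \<Rightarrow> complex"
  assumes "F analytic_on cball 0 r" "0 < r"
  obtains \<rho> where "r < \<rho>" "F holomorphic_on ball 0 \<rho>"
proof -
  obtain U where U: "open U" "cball 0 r \<subseteq> U" "F holomorphic_on U"
    using assms(1) analytic_on_holomorphic by auto
  obtain e where e: "e > 0" "(\<Union>x\<in>cball 0 r. ball x e) \<subseteq> U"
    using compact_subset_open_imp_ball_epsilon_subset[OF compact_cball U(1,2)] .
  have "ball 0 (r + e) \<subseteq> U"
  proof
    fix x :: complex assume x: "x \<in> ball 0 (r + e)"
    show "x \<in> U"
    proof (cases "norm x \<le> r")
      case True then show ?thesis using U by auto
    next
      case False
      \<comment> \<open>The radial projection of \<open>x\<close> to the circle of radius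
        \<open>r\<close>, at distance \<open>norm x - r < e\<close> from \<open>x\<close>.\<close>
      define y where "y = of_real (r / norm x) * x"
      have "y \<in> cball 0 r" using assms(2) False by (auto simp: y_def norm_mult norm_divide)
      moreover have "dist y x < e"
      proof -
        have "x - y = of_real (1 - r / norm x) * x" by (simp add: y_def algebra_simps)
        then have "dist y x = \<bar>1 - r / norm x\<bar> * norm x"
          by (metis dist_norm norm_mult norm_of_real dist_commute)
        also have "\<dots> = norm x - r" using False assms(2) by (auto simp: field_simps abs_if)
        finally show ?thesis using x by simp
      qed
      ultimately show ?thesis using e(2) by (meson UN_I mem_ball subsetD)
    qed
  qed
  then show ?thesis using that[of "r + e"] e U by (auto intro: holomorphic_on_subset)
qed

text \<open>On the circle of radius \<open>r\<close> one has \<open>cnj z ^ k = r ^ (2 * k) / z ^ k\<close>, so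
  integrating the power series of \<open>F\<close> termwise against \<open>cnj G\<close> picks out
  the Taylor coefficients of \<open>G\<close>.\<close>

lemma Parseval_circle_mean:
  assumes F: "F analytic_on cball 0 r" and G: "G analytic_on cball 0 r" and r: "0 < r"
  shows "(\<lambda>k. (deriv ^^ k) F 0 / fact k * cnj ((deriv ^^ k) G 0 / fact k) * of_real r ^ (2 * k))
           sums circle_mean r (\<lambda>z. F z * cnj (G z))"
proof -
  define a where "a k = (deriv ^^ k) F 0 / fact k" for k
  define b where "b k = (deriv ^^ k) G 0 / fact k" for k
  have Gh: "G holomorphic_on cball 0 r" using G analytic_imp_holomorphic by blast
  have Gc: "continuous_on (sphere 0 r) G"
    using Gh holomorphic_on_imp_continuous_on continuous_on_subset sphere_cball by blast
  obtain \<rho> where \<rho>: "r < \<rho>" "F holomorphic_on ball 0 \<rho>"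
    using analytic_on_cball_imp_ball[OF F] r by auto
  have FS: "(\<lambda>k. a k * z ^ k) sums F z" if "norm z < \<rho>" for z
    using holomorphic_power_series[of F 0 \<rho> z] that \<rho> by (auto simp: a_def)
  \<comment> \<open>Uniform convergence on the closed disc requires a strict inequality, so the
    series is tested at the midpoint of \<open>r\<close> and \<open>\<rho>\<close>.\<close>
  have cr: "ereal r < conv_radius a"
  proof -
    have "norm (of_real ((r + \<rho>) / 2) :: complex) < \<rho>"
      using r \<rho> by (simp only: norm_of_real) (auto simp: abs_if)
    from conv_radius_geI[OF sums_summable[OF FS[OF this]]]
    have "ereal ((r + \<rho>) / 2) \<le> conv_radius a" using r \<rho>
      by (simp only: norm_of_real) (simp add: abs_if)
    moreover have "ereal r < ereal ((r + \<rho>) / 2)" using \<rho> by simp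
    ultimately show ?thesis by (rule less_le_trans[rotated])
  qed
  have unif: "uniform_limit (cball 0 r) (\<lambda>n z. \<Sum>k<n. a k * z ^ k) F sequentially"
  proof -
    have "uniform_limit (cball 0 r) (\<lambda>n z. \<Sum>k<n. a k * z ^ k) (\<lambda>z. suminf (\<lambda>k. a k * z ^ k)) sequentially"
      using powser_uniform_limit[OF cr, of 0] by simp
    moreover have "suminf (\<lambda>k. a k * z ^ k) = F z" if "z \<in> cball 0 r" for z
      using FS[of z] that \<rho> by (auto simp: sums_iff)
    ultimately show ?thesis using uniform_limit_cong'[of "cball 0 r"] by (smt (verit, ccfv_SIG))
  qed
  have bd: "bounded (G ` sphere 0 r)"
    using compact_continuous_image[OF Gc] compact_imp_bounded by auto
  then obtain M where M: "\<And>z. z \<in> sphere 0 r \<Longrightarrow> norm (G z) \<le> M"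
    by (metis bounded_iff imageI)
  have unif2: "uniform_limit {0..2*pi} (\<lambda>n \<theta>. (\<Sum>k<n. a k * (of_real r * cis \<theta>) ^ k) * cnj (G (of_real r * cis \<theta>)))
      (\<lambda>\<theta>. F (of_real r * cis \<theta>) * cnj (G (of_real r * cis \<theta>))) sequentially"
  proof (rule uniform_lim_mult)
    show "uniform_limit {0..2*pi} (\<lambda>n \<theta>. \<Sum>k<n. a k * (of_real r * cis \<theta>) ^ k)
            (\<lambda>\<theta>. F (of_real r * cis \<theta>)) sequentially"
      by (rule uniform_limit_compose'[OF unif]) (use r in \<open>auto simp: norm_mult\<close>)
    show "uniform_limit {0..2*pi} (\<lambda>n \<theta>. cnj (G (of_real r * cis \<theta>)))
            (\<lambda>\<theta>. cnj (G (of_real r * cis \<theta>))) sequentially"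
      by (rule uniform_limit_const)
    have "bounded (F ` sphere 0 r)"
      by (intro compact_imp_bounded compact_continuous_image)
         (use \<rho> in \<open>auto intro!: holomorphic_on_imp_continuous_on intro: holomorphic_on_subset\<close>)
    then show "bounded ((\<lambda>\<theta>. F (of_real r * cis \<theta>)) ` {0..2*pi})"
      by (rule bounded_subset) (use r in \<open>auto simp: norm_mult\<close>)
    show "bounded ((\<lambda>\<theta>. cnj (G (of_real r * cis \<theta>))) ` {0..2*pi})"
      unfolding bounded_iff by (rule exI[of _ M]) (use r M in \<open>auto simp: norm_mult\<close>)
  qed
  have lim: "(\<lambda>n. circle_mean r (\<lambda>z. (\<Sum>k<n. a k * z ^ k) * cnj (G z)))
      \<longlonglongrightarrow> circle_mean r (\<lambda>z. F z * cnj (G z))"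
    unfolding circle_mean_def
  proof (intro tendsto_intros)
    have "continuous_on {0..2*pi} (\<lambda>\<theta>. (\<Sum>k<n. a k * (of_real r * cis \<theta>) ^ k) * cnj (G (of_real r * cis \<theta>)))" for n
      by (intro continuous_intros continuous_on_compose2[OF Gc]) (use r in \<open>auto simp: norm_mult\<close>)
    from uniform_limit_integral[OF unif2 this]
    obtain I J where I: "\<And>n. ((\<lambda>\<theta>. (\<Sum>k<n. a k * (of_real r * cis \<theta>) ^ k) * cnj (G (of_real r * cis \<theta>))) has_integral I n) {0..2*pi}"
      "((\<lambda>\<theta>. F (of_real r * cis \<theta>) * cnj (G (of_real r * cis \<theta>))) has_integral J) {0..2*pi}" "I \<longlonglongrightarrow> J"
      by auto
    then show "(\<lambda>n. integral {0..2*pi} (\<lambda>\<theta>. (\<Sum>k<n. a k * (of_real r * cis \<theta>) ^ k) * cnj (G (of_real r * cis \<theta>))))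
      \<longlonglongrightarrow> integral {0..2*pi} (\<lambda>\<theta>. F (of_real r * cis \<theta>) * cnj (G (of_real r * cis \<theta>)))"
      by (simp only: integral_unique[OF I(1)] integral_unique[OF I(2)])
  qed
  have coeff: "circle_mean r (\<lambda>z. z ^ k * cnj (G z)) = cnj (b k) * of_real r ^ (2 * k)" for k
  proof -
    have "circle_mean r (\<lambda>z. z ^ k * cnj (G z))
        = circle_mean r (\<lambda>z. of_real r ^ (2 * k) * cnj (G z * z / (z - 0) ^ Suc k))"
    proof (rule circle_mean_cong)
      fix z :: complex assume z: "norm z = r"
      then have "z * cnj z = of_real r ^ 2" by (simp add: complex_norm_square[symmetric])
      then have "of_real r ^ (2 * k) = z ^ k * cnj z ^ k" by (simp add: power_mult power_mult_distrib[symmetric])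
      moreover have "z \<noteq> 0" using z r by auto
      ultimately show "z ^ k * cnj (G z) = of_real r ^ (2 * k) * cnj (G z * z / (z - 0) ^ Suc k)"
        by (simp add: field_simps)
    qed (use r in auto)
    also have "\<dots> = of_real r ^ (2 * k) * cnj (circle_mean r (\<lambda>z. G z * z / (z - 0) ^ Suc k))"
      by (subst circle_mean_cmult, subst circle_mean_cnj, intro continuous_intros Gc) (use r in auto)
    also have "\<dots> = of_real r ^ (2 * k) * cnj (b k)"
      by (subst circle_mean_higher_deriv[OF Gh]) (use r in \<open>auto simp: b_def\<close>)
    finally show ?thesis by (simp add: mult.commute)
  qed
  have "circle_mean r (\<lambda>z. (\<Sum>k<n. a k * z ^ k) * cnj (G z))
      = (\<Sum>k<n. a k * cnj (b k) * of_real r ^ (2 * k))" for n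
  proof (induction n)
    case (Suc n)
    have "circle_mean r (\<lambda>z. (\<Sum>k<Suc n. a k * z ^ k) * cnj (G z))
       = circle_mean r (\<lambda>z. (\<Sum>k<n. a k * z ^ k) * cnj (G z) + a n * (z ^ n * cnj (G z)))"
      by (simp add: algebra_simps)
    also have "\<dots> = circle_mean r (\<lambda>z. (\<Sum>k<n. a k * z ^ k) * cnj (G z)) + a n * circle_mean r (\<lambda>z. z ^ n * cnj (G z))"
      by (subst circle_mean_add) (use r Gc in \<open>auto intro!: continuous_intros simp: circle_mean_cmult\<close>)
    finally show ?case by (simp add: Suc coeff)
  qed simp
  with lim show ?thesis by (simp add: sums_def a_def b_def)
qed

lemma analytic_imp_continuous_on_sphere:
  assumes "F analytic_on cball 0 r" shows "continuous_on (sphere 0 r) F"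
  using assms analytic_imp_holomorphic holomorphic_on_imp_continuous_on continuous_on_subset sphere_cball
  by metis

lemma analytic_on_cball_mono:
  fixes F :: "complex \<Rightarrow> complex"
  assumes "F analytic_on cball 0 r" "s \<le> r" shows "F analytic_on cball 0 s"
  using assms by (meson analytic_on_subset subset_cball)

lemma Parseval_circle_mean_norm:
  assumes "F analytic_on cball 0 r" "0 < r"
  shows "(\<lambda>k. (norm ((deriv ^^ k) F 0 / fact k))\<^sup>2 * r ^ (2 * k)) sums circle_mean r (\<lambda>z. (norm (F z))\<^sup>2)"
proof -
  have "of_real ((norm ((deriv ^^ k) F 0 / fact k))\<^sup>2 * r ^ (2 * k)) =
     (deriv ^^ k) F 0 / fact k * cnj ((deriv ^^ k) F 0 / fact k) * of_real r ^ (2 * k)" for k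
    by (simp only: of_real_mult complex_norm_square of_real_power[of r "2 * k"])
  moreover have "circle_mean r (\<lambda>z. F z * cnj (F z)) = of_real (circle_mean r (\<lambda>z. (norm (F z))\<^sup>2))"
    by (subst circle_mean_of_real[symmetric])
       (use assms analytic_imp_continuous_on_sphere[OF assms(1)] in
         \<open>auto intro!: continuous_intros simp: complex_norm_square simp del: of_real_power\<close>)
  ultimately have "(\<lambda>k. complex_of_real ((norm ((deriv ^^ k) F 0 / fact k))\<^sup>2 * r ^ (2 * k)))
      sums of_real (circle_mean r (\<lambda>z. (norm (F z))\<^sup>2))"
    using Parseval_circle_mean[OF assms(1,1,2)] by (simp only:)
  then show ?thesis by (simp only: sums_of_real_iff)
qed

text \<open>Every term of the Parseval series is nonnegative and grows with the radius. The centre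
  is treated apart, since Parseval is stated for positive radii; there only the term
  \<open>k = 0\<close> remains.\<close>

lemma circle_mean_norm_square_mono:
  assumes F: "F analytic_on cball 0 r" and s: "0 \<le> s" "s \<le> r"
  shows "circle_mean s (\<lambda>z. (norm (F z))\<^sup>2) \<le> circle_mean r (\<lambda>z. (norm (F z))\<^sup>2)"
proof (cases "r = 0")
  case False
  then have r: "0 < r" using s by auto
  note P = Parseval_circle_mean_norm[OF F r]
  show ?thesis
  proof (cases "s = 0")
    case True
    have "(\<Sum>k\<in>{0}. (norm ((deriv ^^ k) F 0 / fact k))\<^sup>2 * r ^ (2 * k)) \<le> circle_mean r (\<lambda>z. (norm (F z))\<^sup>2)"
      by (rule sum_le_suminf[OF sums_summable[OF P], of "{0}", unfolded sums_unique[OF P, symmetric]])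
         (auto intro!: mult_nonneg_nonneg simp: r less_imp_le)
    with True show ?thesis by simp
  next
    case False
    with s have "0 < s" by simp
    show ?thesis
      by (rule sums_le[OF _ Parseval_circle_mean_norm[OF analytic_on_cball_mono[OF F s(2)] \<open>0 < s\<close>] P])
         (use s in \<open>auto intro!: mult_left_mono power_mono\<close>)
  qed
qed (use s in auto)

text \<open>Dilating one factor by \<open>s\<close> multiplies the k-th Parseval term by
  \<open>s ^ k\<close>, and so does shrinking the circle for both factors to radius
  \<open>sqrt s\<close>. This trades a mean over a varying circle for one over the unit
  circle.\<close>

lemma circle_mean_dilate:
  assumes F: "F analytic_on cball 0 1" and G: "G analytic_on cball 0 1" and s: "0 \<le> s" "s \<le> 1"
  shows "circle_mean 1 (\<lambda>z. F (of_real s * z) * cnj (G z)) = circle_mean (sqrt s) (\<lambda>z. F z * cnj (G z))"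
proof (cases "s = 0")
  case True
  have "circle_mean 1 (\<lambda>z. cnj (G z)) = cnj (G 0)"
    by (subst circle_mean_cnj) (use G analytic_imp_continuous_on_sphere analytic_imp_holomorphic circle_mean_holomorphic_eq in auto)
  then show ?thesis using True by (simp add: circle_mean_cmult)
next
  case False
  then have s0: "0 < s" using s by simp
  have ss: "of_real s * z \<in> cball 0 1" if "z \<in> cball 0 1" for z :: complex
    using that s by (auto simp: norm_mult intro: mult_le_one)
  have Fs: "(\<lambda>z. F (of_real s * z)) analytic_on cball 0 1"
    by (rule analytic_on_compose_gen[unfolded o_def, OF _ F]) (use ss in \<open>auto intro!: analytic_intros\<close>)
  have d: "(deriv ^^ k) (\<lambda>z. F (of_real s * z)) 0 = of_real s ^ k * (deriv ^^ k) F 0" for k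
  proof -
    obtain U where U: "open U" "cball 0 1 \<subseteq> U" "F holomorphic_on U"
      using F analytic_on_holomorphic by auto
    have "(deriv ^^ k) (\<lambda>w. F (of_real s * w)) 0 = of_real s ^ k * (deriv ^^ k) F (of_real s * 0)"
      by (rule higher_deriv_compose_linear[of F U "ball 0 1"])
         (use U ss in \<open>auto intro!: subsetD[OF U(2)] simp: less_imp_le\<close>)
    then show ?thesis by simp
  qed
  have sq: "0 < sqrt s" "sqrt s \<le> 1" using s s0 by auto
  note P1 = Parseval_circle_mean[OF Fs G zero_less_one]
  note P2 = Parseval_circle_mean[OF analytic_on_cball_mono[OF F sq(2)] analytic_on_cball_mono[OF G sq(2)] sq(1)]
  have "(of_real (sqrt s) :: complex) ^ (2 * k) = of_real s ^ k" for k
    using s by (simp add: power_mult of_real_power[symmetric] del: of_real_power)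
  then have "(deriv ^^ k) (\<lambda>z. F (of_real s * z)) 0 / fact k * cnj ((deriv ^^ k) G 0 / fact k) * of_real 1 ^ (2 * k)
      = (deriv ^^ k) F 0 / fact k * cnj ((deriv ^^ k) G 0 / fact k) * of_real (sqrt s) ^ (2 * k)" for k
    by (simp only: d) simp
  with P1 P2 show ?thesis by (simp only: sums_unique2)
qed

text \<open>Termwise, this is the identity between the Bergman and the Hardy pairing
  \<open>\<langle>F', G\<rangle> = \<Sum>k. F\<^sub>k\<^sub>+\<^sub>1 * cnj G\<^sub>k = \<langle>F, z G\<rangle>\<close>, in the area variable \<open>s = |z|\<^sup>2\<close>.\<close>

lemma circle_mean_eq_area_pairing:
  assumes F: "F analytic_on cball 0 1" and G: "G analytic_on cball 0 1"
  shows "circle_mean 1 (\<lambda>z. F z * cnj (z * G z))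
    = integral {0..1} (\<lambda>s. circle_mean (sqrt s) (\<lambda>z. deriv F z * cnj (G z)))"
proof -
  have F': "deriv F analytic_on cball 0 1" using F by (rule analytic_deriv)
  have Fc: "continuous_on (cball 0 1) (deriv F)" "continuous_on (cball 0 1) F"
    using F F' analytic_imp_holomorphic holomorphic_on_imp_continuous_on by blast+
  have Gc: "continuous_on (sphere 0 1) G" "continuous_on (sphere 0 1) F"
    using F G by (auto intro: analytic_imp_continuous_on_sphere)
  have mem: "of_real s * z \<in> cball 0 1" if "s \<in> {0..1}" "norm z = 1" for z :: complex and s :: real
    using that by (auto simp: norm_mult)
  \<comment> \<open>After the dilation only \<open>deriv F\<close> depends on \<open>s\<close>, so
    once the integrals are exchanged the radial one is elementary.\<close>
  have "integral {0..1} (\<lambda>s. circle_mean (sqrt s) (\<lambda>z. deriv F z * cnj (G z)))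
     = integral {0..1} (\<lambda>s. circle_mean 1 (\<lambda>z. deriv F (of_real s * z) * cnj (G z)))"
    by (intro integral_cong circle_mean_dilate[symmetric] F' G) auto
  also have "\<dots> = (1 / (2 * pi)) *\<^sub>R integral {0..1} (\<lambda>s. integral {0..2*pi}
       (\<lambda>\<theta>. deriv F (of_real s * cis \<theta>) * cnj (G (cis \<theta>))))"
    by (simp add: circle_mean_def)
  also have "integral {0..1} (\<lambda>s. integral {0..2*pi}
       (\<lambda>\<theta>. deriv F (of_real s * cis \<theta>) * cnj (G (cis \<theta>))))
     = integral {0..2*pi} (\<lambda>\<theta>. integral {0..1} (\<lambda>s. deriv F (of_real s * cis \<theta>) * cnj (G (cis \<theta>))))"
  proof -
    have "continuous_on (cbox (0, 0) (1, 2 * pi)) (\<lambda>(s, \<theta>). deriv F (of_real s * cis \<theta>) * cnj (G (cis \<theta>)))"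
      unfolding case_prod_beta
      by (intro continuous_intros continuous_on_compose2[OF Fc(1)] continuous_on_compose2[OF Gc(1)])
         (auto simp: norm_mult cbox_Pair_eq)
    from integral_swap_continuous[OF this] show ?thesis by (simp only: cbox_interval)
  qed
  also have "\<dots> = integral {0..2*pi} (\<lambda>\<theta>. (F (cis \<theta>) - F 0) * cnj (cis \<theta> * G (cis \<theta>)))"
  proof (rule integral_cong)
    fix \<theta> :: real
    have "((\<lambda>s. deriv F (of_real s * cis \<theta>) * cis \<theta>) has_integral F (of_real 1 * cis \<theta>) - F (of_real 0 * cis \<theta>)) {0..1}"
    proof (rule fundamental_theorem_of_calculus)
      fix s :: real assume s: "s \<in> {0..1}"
      have "F field_differentiable at (of_real s * cis \<theta>)"
        using F mem[OF s, of "cis \<theta>"] by (auto intro: analytic_on_imp_differentiable_at)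
      then have "(F has_field_derivative deriv F (of_real s * cis \<theta>)) (at (of_real s * cis \<theta>))"
        by (rule field_differentiable_derivI)
      then have "((\<lambda>s. F (of_real s * cis \<theta>)) has_vector_derivative (cis \<theta> * deriv F (of_real s * cis \<theta>))) (at s within {0..1})"
        by (rule field_vector_diff_chain_within[unfolded o_def, rotated, OF DERIV_subset])
           (auto intro!: derivative_eq_intros has_vector_derivative_real_field)
      then show "((\<lambda>s. F (of_real s * cis \<theta>)) has_vector_derivative (deriv F (of_real s * cis \<theta>) * cis \<theta>)) (at s within {0..1})"
        by (simp add: mult.commute)
    qed simp
    then have "((\<lambda>s. deriv F (of_real s * cis \<theta>) * cis \<theta> * cnj (cis \<theta> * G (cis \<theta>))) has_integral
       (F (cis \<theta>) - F 0) * cnj (cis \<theta> * G (cis \<theta>))) {0..1}"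
      by (intro has_integral_mult_left) simp
    moreover have "x * cis \<theta> * cnj (cis \<theta> * y) = x * cnj y" for x y
      by (simp add: cis_cnj cis_mult mult.assoc[symmetric])
    ultimately show "integral {0..1} (\<lambda>s. deriv F (of_real s * cis \<theta>) * cnj (G (cis \<theta>)))
       = (F (cis \<theta>) - F 0) * cnj (cis \<theta> * G (cis \<theta>))"
      by (simp only: integral_unique)
  qed
  also have "(1 / (2 * pi)) *\<^sub>R \<dots> = circle_mean 1 (\<lambda>z. (F z - F 0) * cnj (z * G z))"
    by (simp add: circle_mean_def)
  also have "\<dots> = circle_mean 1 (\<lambda>z. F z * cnj (z * G z) - F 0 * cnj (z * G z))"
    by (simp add: algebra_simps)
  \<comment> \<open>The constant \<open>F 0\<close> left by the radial integration pairs to zero,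
    because \<open>z * G z\<close> vanishes at the origin.\<close>
  also have "\<dots> = circle_mean 1 (\<lambda>z. F z * cnj (z * G z)) - F 0 * circle_mean 1 (\<lambda>z. cnj (z * G z))"
    by (subst circle_mean_diff) (auto intro!: continuous_intros Gc simp: circle_mean_cmult simp del: complex_cnj_mult)
  also have "circle_mean 1 (\<lambda>z. cnj (z * G z)) = cnj (circle_mean 1 (\<lambda>z. z * G z))"
    by (rule circle_mean_cnj) (auto intro!: continuous_intros Gc)
  also have "circle_mean 1 (\<lambda>z. z * G z) = 0 * G 0"
    by (rule circle_mean_holomorphic_eq) (use G analytic_imp_holomorphic in \<open>auto intro!: holomorphic_intros\<close>)
  finally show ?thesis by simp
qed

section \<open>Area of univalent images\<close>

text \<open>The change of variables formula used below speaks of \<open>real^2\<close>, iterated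
  integration of \<open>real \<times> real\<close>. The coordinate bijection between them preserves
  the content of boxes, which carries the integral over.\<close>

lemma integral_cbox_vec2:
  fixes h :: "real \<times> real \<Rightarrow> real"
  assumes "continuous_on (cbox (a, c) (b, d)) h"
  shows "((\<lambda>x::real^2. h (x $ 1, x $ 2)) has_integral integral (cbox a b) (\<lambda>x. integral (cbox c d) (\<lambda>y. h (x, y))))
     (cbox (vector [a, c]) (vector [b, d]))"
proof -
  let ?g = "\<lambda>x::real^2. (x $ 1, x $ 2)" and ?h = "\<lambda>p. vector [fst p, snd p] :: real^2"
  have gh: "?g (?h p) = p" and hg: "?h (?g x) = x" for p x
    by (auto simp: vec_eq_iff forall_2)
  have gb: "?g ` cbox u v = cbox (?g u) (?g v)" for u v
  proof (intro equalityI subsetI)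
    fix p assume "p \<in> cbox (?g u) (?g v)"
    then have "?h p \<in> cbox u v" by (cases p) (auto simp: mem_box_cart forall_2 cbox_Pair_eq)
    then show "p \<in> ?g ` cbox u v" using gh[of p] by (metis (no_types, lifting) image_eqI)
  qed (auto simp: mem_box_cart forall_2 cbox_Pair_eq)
  have hb: "?h ` cbox u v = cbox (?h u) (?h v)" for u v
    using gb[of "?h u" "?h v"] unfolding gh
    by (metis (no_types, lifting) hg image_cong image_ident image_image)
  have ex2: "(\<exists>i::2. P i) \<longleftrightarrow> P 1 \<or> P 2" for P
    using forall_2[of "\<lambda>i. \<not> P i"] by auto
  have ct: "measure lborel (?g ` cbox u v) = 1 * measure lborel (cbox u v)" for u v
  proof (cases "u $ 1 \<le> v $ 1 \<and> u $ 2 \<le> v $ 2")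
    case True
    then have "cbox u v \<noteq> {}" by (auto simp: interval_ne_empty_cart forall_2)
    with True show ?thesis
      unfolding gb by (simp add: content_Pair content_cbox_cart UNIV_2)
  next
    case False
    then have "cbox u v = {}" by (auto simp: interval_eq_empty_cart ex2 not_le)
    then show ?thesis by simp
  qed
  have "(h has_integral integral (cbox (a, c) (b, d)) h) (cbox (a, c) (b, d))"
    using integrable_continuous[OF assms] by (simp add: has_integral_integral)
  have "((\<lambda>x. h (?g x)) has_integral (1 / 1) *\<^sub>R integral (cbox (a, c) (b, d)) h) (?h ` cbox (a, c) (b, d))"
  proof (rule has_integral_twiddle[of 1 ?h ?g, OF _ hg gh _ _ _ ct])
    show "continuous (at x) ?g" for x :: "real^2"
      by (intro continuous_intros)
    show "\<exists>w z. ?g ` cbox u v = cbox w z" for u v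
      using gb by blast
    show "\<exists>w z. ?h ` cbox u v = cbox w z" for u v
      using hb by blast
  qed (use \<open>(h has_integral _) _\<close> in auto)
  then show ?thesis
    unfolding hb using integral_prod_continuous[OF assms] by simp
qed

text \<open>With the squared radius as first coordinate, the Jacobian of polar coordinates is the
  constant 1/2.\<close>

lemma has_derivative_polar_sqrt:
  fixes x :: "real^2"
  assumes "0 < x $ 1"
  shows "((\<lambda>x::real^2. complex_of_real (sqrt (x $ 1)) * cis (x $ 2)) has_derivative
      (\<lambda>h. of_real (h $ 1 / (2 * sqrt (x $ 1))) * cis (x $ 2) + of_real (sqrt (x $ 1)) * (\<i> * of_real (h $ 2) * cis (x $ 2))))
      (at x within S)"
proof -
  have 1: "((\<lambda>x::real^2. x $ i) has_derivative (\<lambda>h. h $ i)) (at x within S)" for i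
    by (rule bounded_linear_imp_has_derivative) (rule bounded_linear_vec_nth)
  have 2: "((\<lambda>x::real^2. sqrt (x $ 1)) has_derivative (\<lambda>h. h $ 1 / (2 * sqrt (x $ 1)))) (at x within S)"
    using has_derivative_real_sqrt[OF assms 1] by (simp add: field_simps)
  have 3: "((\<lambda>x::real^2. cis (x $ 2)) has_derivative (\<lambda>h. \<i> * of_real (h $ 2) * cis (x $ 2))) (at x within S)"
    using has_derivative_cis[OF 1[of 2]] by (simp add: scaleR_conv_of_real algebra_simps)
  show ?thesis
    using has_derivative_mult[OF has_derivative_of_real[OF 2] 3] by (simp add: algebra_simps)
qed


text \<open>By injectivity the integral is the area of the image divided by \<pi>, and the image
  lies in a disc of area \<pi> M^2. The parameter box is open: it misses the boundary circles and a
  radial slit, a null set whose removal makes polar coordinates injective.\<close>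

lemma area_annulus_le:
  assumes a: "0 \<le> a" "a < b" and U: "open U" "{z. a \<le> (norm z)\<^sup>2 \<and> (norm z)\<^sup>2 \<le> b} \<subseteq> U"
    and F: "F holomorphic_on U" and inj: "inj_on F {z. a < (norm z)\<^sup>2 \<and> (norm z)\<^sup>2 < b}"
    and im: "F ` {z. a < (norm z)\<^sup>2 \<and> (norm z)\<^sup>2 < b} \<subseteq> cball c M" and M: "0 \<le> M"
  shows "integral {a..b} (\<lambda>s. circle_mean (sqrt s) (\<lambda>z. (norm (deriv F z))\<^sup>2)) \<le> M\<^sup>2"
proof -
  define S where "S = box (vector [a, 0]) (vector [b, 2 * pi] :: real^2)"
  define w where "w = (\<lambda>x::real^2. complex_of_real (sqrt (x $ 1)) * cis (x $ 2))"
  define g where "g x = (vector [Re (F (w x)), Im (F (w x))] :: real^2)" for x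
  define w' where "w' x h = of_real (h $ 1 / (2 * sqrt (x $ 1))) * cis (x $ 2)
      + of_real (sqrt (x $ 1)) * (\<i> * of_real (h $ 2) * cis (x $ 2))" for x h :: "real^2"
  define g' where "g' x h = (vector [Re (deriv F (w x) * w' x h), Im (deriv F (w x) * w' x h)] :: real^2)" for x h
  define H where "H p = (norm (deriv F (of_real (sqrt (fst p)) * cis (snd p))))\<^sup>2 / 2" for p
  have S: "x \<in> S \<longleftrightarrow> a < x $ 1 \<and> x $ 1 < b \<and> 0 < x $ 2 \<and> x $ 2 < 2 * pi" for x
    by (auto simp: S_def mem_box_cart forall_2)
  have wS: "w x \<in> {z. a < (norm z)\<^sup>2 \<and> (norm z)\<^sup>2 < b}" if "x \<in> S" for x
    using that a by (auto simp: S w_def norm_mult)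
  have wU: "w x \<in> U" if "x \<in> S" for x
    using wS[OF that] U(2) by auto
  have der: "(g has_derivative g' x) (at x within S)" if x: "x \<in> S" for x
  proof -
    have "(F has_field_derivative deriv F (w x)) (at (w x))"
      using F U(1) wU[OF x] holomorphic_derivI by blast
    then have "((\<lambda>x. F (w x)) has_derivative (\<lambda>h. deriv F (w x) * w' x h)) (at x within S)"
      using has_derivative_polar_sqrt[of x S] x a
      unfolding w_def[symmetric] w'_def has_field_derivative_def
      by (intro has_derivative_compose[where f = w and g = F]) (auto simp: S)
    then have d: "((\<lambda>x. Re (F (w x))) has_derivative (\<lambda>h. Re (deriv F (w x) * w' x h))) (at x within S)"
      "((\<lambda>x. Im (F (w x))) has_derivative (\<lambda>h. Im (deriv F (w x) * w' x h))) (at x within S)"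
      by (rule has_derivative_Re, rule has_derivative_Im)
    show ?thesis
      unfolding has_derivative_componentwise_within[of g]
      by (auto simp: Basis_vec_def UNIV_2 g_def g'_def inner_axis d[simplified])
  qed
  \<comment> \<open>Multiplication by \<open>deriv F\<close> has determinant
    \<open>|deriv F|^2\<close>; polar coordinates contribute the factor 1/2. Both are read off from
    the imaginary part of \<open>cnj A * B\<close>, where \<open>A\<close> and \<open>B\<close> are
    the two columns.\<close>
  have det: "\<bar>det (matrix (g' x))\<bar> = H (x $ 1, x $ 2)" if "x \<in> S" for x
  proof -
    define D where "D = deriv F (w x)"
    define A where "A = D * (of_real (1 / (2 * sqrt (x $ 1))) * cis (x $ 2))"
    define B where "B = D * (of_real (sqrt (x $ 1)) * (\<i> * cis (x $ 2)))"
    have "det (matrix (g' x)) = Re A * Im B - Re B * Im A"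
      by (simp add: det_2 matrix_def g'_def w'_def A_def B_def D_def axis_def diff_divide_distrib add_divide_distrib left_diff_distrib distrib_right)
    also have "\<dots> = Im (cnj A * B)" by simp
    also have "cnj A * B = (D * cnj D) * (cnj (cis (x $ 2)) * cis (x $ 2)) * of_real (1 / (2 * sqrt (x $ 1)) * sqrt (x $ 1)) * \<i>"
      by (simp add: A_def B_def)
    also have "1 / (2 * sqrt (x $ 1)) * sqrt (x $ 1) = 1 / 2"
      using that a by (auto simp: S)
    also have "cnj (cis (x $ 2)) * cis (x $ 2) = 1" by (simp add: cis_cnj cis_mult)
    also have "D * cnj D = of_real ((norm D)\<^sup>2)" by (simp only: complex_norm_square)
    also have "Im (of_real ((norm D)\<^sup>2) * 1 * of_real (1/2) * \<i>) = (norm D)\<^sup>2 / 2"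
      by (simp del: of_real_power)
    finally have "det (matrix (g' x)) = H (x $ 1, x $ 2)" by (simp only: H_def D_def w_def fst_conv snd_conv)
    moreover have "0 \<le> H (x $ 1, x $ 2)" by (simp add: H_def)
    ultimately show ?thesis by simp
  qed
  have injg: "inj_on g S"
  proof (rule inj_onI)
    fix x y assume x: "x \<in> S" and y: "y \<in> S" and e: "g x = g y"
    have "F (w x) = F (w y)" using e by (auto simp: g_def vec_eq_iff forall_2 complex_eq_iff)
    then have wxy: "w x = w y" using inj wS[OF x] wS[OF y] by (auto dest: inj_onD)
    then have "norm (w x) = norm (w y)" by simp
    then have 1: "x $ 1 = y $ 1" using x y a by (simp add: w_def norm_mult S)
    with wxy have "cis (x $ 2) = cis (y $ 2)" using x a by (simp add: w_def S)
    then have "cos (x $ 2 - y $ 2) = 1"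
      by (metis cis.sel(1) cis_divide cis_neq_zero divide_self one_complex.sel(1))
    then obtain n :: int where n: "x $ 2 - y $ 2 = of_int n * 2 * pi"
      by (auto simp: cos_one_2pi_int)
    have "\<bar>x $ 2 - y $ 2\<bar> < 2 * pi" using x y S[of x] S[of y] by linarith
    then have "\<bar>real_of_int n\<bar> * (2 * pi) < 1 * (2 * pi)" unfolding n by (simp add: abs_mult)
    then have "\<bar>real_of_int n\<bar> < 1" by (simp only: mult_less_cancel_right) auto
    then have "n = 0" by linarith
    with n have "x $ 2 = y $ 2" by simp
    with 1 show "x = y" by (auto simp: vec_eq_iff forall_2)
  qed
  have cF: "continuous_on U (deriv F)"
    using F U(1) by (intro holomorphic_on_imp_continuous_on holomorphic_deriv)
  have cH: "continuous_on (cbox (a, 0) (b, 2 * pi)) H"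
    unfolding H_def
    by (intro continuous_intros continuous_on_compose2[OF cF] subsetI)
       (use a U(2) in \<open>auto simp: cbox_Pair_eq norm_mult\<close>)
  define I where "I = integral (cbox a b) (\<lambda>x. integral (cbox 0 (2 * pi)) (\<lambda>y. H (x, y)))"
  have "((\<lambda>x. H (x $ 1, x $ 2)) has_integral I) S"
    using integral_cbox_vec2[OF cH] by (simp add: S_def has_integral_open_interval I_def)
  then have "((\<lambda>x. \<bar>det (matrix (g' x))\<bar>) has_integral I) S"
    by (subst has_integral_cong[OF det])
  moreover have "S \<in> sets lebesgue" by (simp add: S_def)
  ultimately have gS: "g ` S \<in> lmeasurable" "measure lebesgue (g ` S) = I"
    using has_measure_differentiable_image[OF _ der injg] by blast+
  have "g ` S \<subseteq> cball (vector [Re c, Im c]) M"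
  proof clarify
    fix x assume "x \<in> S"
    from subsetD[OF im imageI[OF wS[OF this]]] have "norm (c - F (w x)) \<le> M" by (simp add: dist_norm)
    then show "g x \<in> cball (vector [Re c, Im c]) M"
      by (simp add: dist_norm norm_vec_def L2_set_def UNIV_2 g_def cmod_def)
  qed
  then have "measure lebesgue (g ` S) \<le> measure lebesgue (cball (vector [Re c, Im c] :: real^2) M)"
    by (rule measure_mono_fmeasurable) (use gS in auto)
  also have "\<dots> = pi * M\<^sup>2"
    using M by (simp add: content_cball unit_ball_vol_2)
  finally have "I \<le> pi * M\<^sup>2" using gS by simp
  \<comment> \<open>The 1/2 in \<open>H\<close> against the 1/(2 \<pi>) in
    \<open>circle_mean\<close> leaves the factor \<pi>.\<close>
  moreover have "I = integral {a..b} (\<lambda>s. pi * circle_mean (sqrt s) (\<lambda>z. (norm (deriv F z))\<^sup>2))"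
    by (simp add: I_def H_def circle_mean_def)
  ultimately show ?thesis by simp
qed

section \<open>Length of univalent rational functions\<close>

lemma cnj_eq_inverse_on_circle:
  assumes "norm z = 1" shows "cnj z = inverse z"
  using complex_norm_square[of z] assms by (simp add: inverse_unique)

lemma one_minus_cnj_mult_neq_0:
  assumes "norm z < 1" "norm w \<le> 1" shows "1 - cnj z * w \<noteq> 0"
proof
  assume "1 - cnj z * w = 0"
  then have "norm (cnj z * w) = 1" by simp
  moreover have "norm (cnj z * w) < 1"
    using assms by (simp add: norm_mult) (metis mult.right_neutral mult_left_le norm_ge_zero order_le_less_trans)
  ultimately show False by simp
qed

text \<open>On the circle \<open>cnj z = 1 / z\<close>, so
  \<open>|1 - cnj w * z|^2 = (1 - cnj w * z) * (z - w) / z\<close>, and Cauchy's formula applies to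
  \<open>F z / (1 - cnj w * z)\<close>, which is analytic in the closed disc.\<close>

lemma circle_mean_Poisson:
  assumes F: "F holomorphic_on cball 0 1" and w: "norm w < 1"
  shows "circle_mean 1 (\<lambda>z. F z / of_real ((norm (1 - cnj w * z))\<^sup>2)) = F w / of_real (1 - (norm w)\<^sup>2)"
proof -
  have nz: "1 - cnj w * z \<noteq> 0" if "norm z \<le> 1" for z
    using one_minus_cnj_mult_neq_0 w that by blast
  have "circle_mean 1 (\<lambda>z. F z / of_real ((norm (1 - cnj w * z))\<^sup>2))
      = circle_mean 1 (\<lambda>z. (F z / (1 - cnj w * z)) * z / (z - w))"
  proof (rule circle_mean_cong)
    fix z :: complex assume z: "norm z = 1"
    then have z0: "z \<noteq> 0" by auto
    have zw: "z - w \<noteq> 0" using z w by auto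
    have "of_real ((norm (1 - cnj w * z))\<^sup>2) = (1 - cnj w * z) * (1 - w * inverse z)"
      by (simp only: complex_norm_square) (simp add: cnj_eq_inverse_on_circle[OF z])
    also have "\<dots> = (1 - cnj w * z) * ((z - w) / z)" using z0 by (simp add: field_simps)
    finally have e: "of_real ((norm (1 - cnj w * z))\<^sup>2) = (1 - cnj w * z) * ((z - w) / z)" .
    show "F z / of_real ((norm (1 - cnj w * z))\<^sup>2) = (F z / (1 - cnj w * z)) * z / (z - w)"
      unfolding e by simp
  qed auto
  also have "\<dots> = F w / (1 - cnj w * w)"
    by (rule circle_mean_Cauchy) (use F w nz in \<open>auto intro!: holomorphic_intros\<close>)
  also have "1 - cnj w * w = of_real (1 - (norm w)\<^sup>2)"
    by (simp only: of_real_diff complex_norm_square) simp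
  finally show ?thesis .
qed

text \<open>The reproducing kernel of the model space \<open>H\<^sup>2 \<ominus> B H\<^sup>2\<close>.\<close>

definition model_kernel :: "(complex \<Rightarrow> complex) \<Rightarrow> complex \<Rightarrow> complex \<Rightarrow> complex" where
  "model_kernel B z w = (1 - cnj (B z) * B w) / (1 - cnj z * w)"

lemma norm_model_kernel_commute: "norm (model_kernel B z w) = norm (model_kernel B w z)"
proof -
  have "model_kernel B z w = cnj (model_kernel B w z)"
    by (simp add: model_kernel_def mult.commute)
  then show ?thesis by simp
qed

lemma model_kernel_analytic:
  assumes "B analytic_on cball 0 1" "norm z < 1"
  shows "model_kernel B z analytic_on cball 0 1"
  unfolding model_kernel_def
  using one_minus_cnj_mult_neq_0[OF assms(2)] assms(1) by (auto intro!: analytic_intros)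

lemma norm_le_1_in_disc:
  assumes B: "B analytic_on cball 0 1" "\<And>z. norm z = 1 \<Longrightarrow> norm (B z) \<le> 1" and z: "norm z \<le> 1"
  shows "norm (B z) \<le> 1"
  by (rule maximum_modulus_frontier[of B "cball 0 1"])
     (use B z in \<open>auto intro: holomorphic_on_imp_continuous_on analytic_imp_holomorphic
        holomorphic_on_subset[of B "cball 0 1"]\<close>)

text \<open>Since \<open>|B z| = 1\<close> on the circle, \<open>|1 - cnj (B w) * B z|^2\<close> is
  there the real part of a function analytic in \<open>z\<close>, and Poisson's formula evaluates
  the mean. This is the identity between the squared norm of a reproducing kernel and its diagonal
  value.\<close>

lemma circle_mean_model_kernel:
  assumes B: "B analytic_on cball 0 1" "\<And>z. norm z = 1 \<Longrightarrow> norm (B z) = 1" and w: "norm w < 1"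
  shows "circle_mean 1 (\<lambda>z. (norm (model_kernel B z w))\<^sup>2) = (1 - (norm (B w))\<^sup>2) / (1 - (norm w)\<^sup>2)"
proof -
  define F where "F z = of_real (1 + (norm (B w))\<^sup>2) - 2 * cnj (B w) * B z" for z
  have Bh: "B holomorphic_on cball 0 1" using B analytic_imp_holomorphic by blast
  have F: "F holomorphic_on cball 0 1" unfolding F_def by (intro holomorphic_intros Bh)
  have nz: "1 - cnj w * z \<noteq> 0" if "norm z \<le> 1" for z
    using one_minus_cnj_mult_neq_0 w that by blast
  have Fc: "continuous_on (sphere 0 1) F"
    using F holomorphic_on_imp_continuous_on continuous_on_subset sphere_cball by blast
  have "circle_mean 1 (\<lambda>z. (norm (model_kernel B z w))\<^sup>2)
      = circle_mean 1 (\<lambda>z. Re (F z / of_real ((norm (1 - cnj w * z))\<^sup>2)))"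
  proof (rule circle_mean_cong)
    fix z :: complex assume z: "norm z = 1"
    have "(norm (1 - cnj (B w) * B z))\<^sup>2 = Re (of_real ((norm (1 - cnj (B w) * B z))\<^sup>2))" by simp
    also have "\<dots> = Re ((1 - cnj (B w) * B z) * (1 - B w * cnj (B z)))"
      by (simp only: complex_norm_square) simp
    also have "(1 - cnj (B w) * B z) * (1 - B w * cnj (B z))
      = 1 - cnj (B w) * B z - cnj (cnj (B w) * B z) + (B w * cnj (B w)) * (B z * cnj (B z))"
      by (simp add: algebra_simps)
    also have "B z * cnj (B z) = 1" using B(2)[OF z] by (simp add: complex_norm_square[symmetric])
    also have "B w * cnj (B w) = of_real ((norm (B w))\<^sup>2)" by (simp only: complex_norm_square)
    also have "Re (1 - cnj (B w) * B z - cnj (cnj (B w) * B z) + of_real ((norm (B w))\<^sup>2) * 1) = Re (F z)"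
      by (simp add: F_def)
    finally have "(norm (1 - cnj (B w) * B z))\<^sup>2 = Re (F z)" .
    moreover have "norm (model_kernel B z w) = norm (1 - cnj (B w) * B z) / norm (1 - cnj w * z)"
      by (subst norm_model_kernel_commute) (simp add: model_kernel_def norm_divide)
    ultimately show "(norm (model_kernel B z w))\<^sup>2 = Re (F z / of_real ((norm (1 - cnj w * z))\<^sup>2))"
      by (simp add: power_divide del: of_real_power)
  qed auto
  also have "\<dots> = Re (circle_mean 1 (\<lambda>z. F z / of_real ((norm (1 - cnj w * z))\<^sup>2)))"
    by (rule circle_mean_Re) (use nz in \<open>auto intro!: continuous_intros Fc\<close>)
  also have "\<dots> = Re (F w / of_real (1 - (norm w)\<^sup>2))"
    by (simp only: circle_mean_Poisson[OF F w])
  also have "F w = of_real (1 - (norm (B w))\<^sup>2)"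
  proof -
    have "2 * cnj (B w) * B w = 2 * of_real ((norm (B w))\<^sup>2)" by (simp only: complex_norm_square) simp
    then show ?thesis by (simp add: F_def)
  qed
  finally show ?thesis by (simp only: of_real_divide[symmetric] Re_complex_of_real)
qed

text \<open>By Hermitian symmetry the modulus is that of a function analytic in \<open>z\<close>, so
  its square means are largest on the unit circle, where they are known exactly.\<close>

lemma circle_mean_model_kernel_le:
  assumes B: "B analytic_on cball 0 1" "\<And>z. norm z = 1 \<Longrightarrow> norm (B z) = 1" and w: "norm w < 1"
    and t: "0 \<le> t" "t \<le> 1"
  shows "circle_mean t (\<lambda>z. (norm (model_kernel B z w))\<^sup>2) \<le> (1 - (norm (B w))\<^sup>2) / (1 - (norm w)\<^sup>2)"
proof -
  have "circle_mean t (\<lambda>z. (norm (model_kernel B w z))\<^sup>2) \<le> circle_mean 1 (\<lambda>z. (norm (model_kernel B w z))\<^sup>2)"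
    by (rule circle_mean_norm_square_mono[OF model_kernel_analytic[OF B(1) w] t])
  then show ?thesis
    using circle_mean_model_kernel[OF B w] by (simp add: norm_model_kernel_commute[of B _ w])
qed

text \<open>Since \<open>cnj R * B\<close> has an analytic extension \<open>G\<close> into the disc, all terms
  of \<open>R * cnj (z * k\<^sup>2)\<close> that contain \<open>cnj B\<close> are conjugates of analytic functions vanishing at
  the origin; what remains is Cauchy's formula for \<open>R'\<close>.\<close>

lemma deriv_eq_circle_mean_model_kernel:
  assumes R: "R analytic_on cball 0 1" and B: "B analytic_on cball 0 1" and G: "G analytic_on cball 0 1"
    and GR: "\<And>\<zeta>. norm \<zeta> = 1 \<Longrightarrow> G \<zeta> = cnj (R \<zeta>) * B \<zeta>" and z: "norm z < 1"
  shows "circle_mean 1 (\<lambda>\<zeta>. R \<zeta> * cnj (\<zeta> * (model_kernel B z \<zeta>)\<^sup>2)) = deriv R z"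
proof -
  define b where "b = cnj (B z)"
  define H where "H \<zeta> = \<zeta> * G \<zeta> * (b\<^sup>2 * B \<zeta> - 2 * b) / (1 - cnj z * \<zeta>)\<^sup>2" for \<zeta>
  note nz = one_minus_cnj_mult_neq_0[OF z]
  have hol: "R holomorphic_on cball 0 1" "B holomorphic_on cball 0 1" "G holomorphic_on cball 0 1"
    using R B G analytic_imp_holomorphic by blast+
  have Hh: "H holomorphic_on cball 0 1"
    unfolding H_def by (intro holomorphic_intros hol) (use nz in auto)
  have Rc: "continuous_on (sphere 0 1) R"
    using R by (rule analytic_imp_continuous_on_sphere)
  have Hc: "continuous_on (sphere 0 1) H"
    using Hh holomorphic_on_imp_continuous_on continuous_on_subset sphere_cball by blast
  have "circle_mean 1 (\<lambda>\<zeta>. R \<zeta> * cnj (\<zeta> * (model_kernel B z \<zeta>)\<^sup>2))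
      = circle_mean 1 (\<lambda>\<zeta>. R \<zeta> * \<zeta> / (\<zeta> - z) ^ Suc 1 + cnj (H \<zeta>))"
  proof (rule circle_mean_cong)
    fix \<zeta> :: complex assume \<zeta>: "norm \<zeta> = 1"
    then have z0: "\<zeta> \<noteq> 0" by auto
    have zw: "\<zeta> - z \<noteq> 0" using \<zeta> z by auto
    \<comment> \<open>The expansion \<open>(1 - b B)^2 = 1 + B (b^2 B - 2 b)\<close> separates
      Cauchy's kernel for the derivative from the terms that contain \<open>B\<close>.\<close>
    have e: "\<zeta> * (model_kernel B z \<zeta>)\<^sup>2 = \<zeta> / (1 - cnj z * \<zeta>)\<^sup>2 + \<zeta> * B \<zeta> * (b\<^sup>2 * B \<zeta> - 2 * b) / (1 - cnj z * \<zeta>)\<^sup>2"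
      by (simp add: model_kernel_def b_def power_divide power2_eq_square add_divide_distrib[symmetric] algebra_simps)
    have "cnj (\<zeta> / (1 - cnj z * \<zeta>)\<^sup>2) = inverse \<zeta> / (1 - z * inverse \<zeta>)\<^sup>2"
      by (simp add: cnj_eq_inverse_on_circle[OF \<zeta>])
    also have "1 - z * inverse \<zeta> = (\<zeta> - z) / \<zeta>" using z0 by (simp add: field_simps)
    also have "inverse \<zeta> / ((\<zeta> - z) / \<zeta>)\<^sup>2 = \<zeta> / (\<zeta> - z)\<^sup>2"
      using z0 by (simp add: field_simps power2_eq_square)
    finally have "cnj (\<zeta> / (1 - cnj z * \<zeta>)\<^sup>2) = \<zeta> / (\<zeta> - z)\<^sup>2" .
    moreover have "R \<zeta> * cnj (\<zeta> * B \<zeta> * (b\<^sup>2 * B \<zeta> - 2 * b) / (1 - cnj z * \<zeta>)\<^sup>2) = cnj (H \<zeta>)"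
      by (simp add: H_def GR[OF \<zeta>] mult_ac)
    ultimately show "R \<zeta> * cnj (\<zeta> * (model_kernel B z \<zeta>)\<^sup>2) = R \<zeta> * \<zeta> / (\<zeta> - z) ^ Suc 1 + cnj (H \<zeta>)"
      unfolding e complex_cnj_add distrib_left by (simp add: power2_eq_square)
  qed auto
  also have "\<dots> = circle_mean 1 (\<lambda>\<zeta>. R \<zeta> * \<zeta> / (\<zeta> - z) ^ Suc 1) + circle_mean 1 (\<lambda>\<zeta>. cnj (H \<zeta>))"
    by (rule circle_mean_add) (use z in \<open>auto intro!: continuous_intros Rc Hc\<close>)
  also have "circle_mean 1 (\<lambda>\<zeta>. cnj (H \<zeta>)) = cnj (circle_mean 1 H)"
    by (rule circle_mean_cnj) (auto intro: Hc)
  also have "circle_mean 1 H = H 0" by (rule circle_mean_holomorphic_eq[OF Hh]) simp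
  also have "circle_mean 1 (\<lambda>\<zeta>. R \<zeta> * \<zeta> / (\<zeta> - z) ^ Suc 1) = (deriv ^^ 1) R z / fact 1"
    by (rule circle_mean_higher_deriv[OF hol(1) z])
  finally show ?thesis by (simp add: H_def)
qed

text \<open>Integration by parts through the primitive \<open>\<Phi> = A^2 / (1 - s)\<close>.
  Stopping at \<open>\<rho>\<close> avoids the singular endpoint; the boundary term is controlled by
  the bound \<open>K\<close> on \<open>g\<close> and disappears as \<open>\<rho>\<close> tends to 1,
  leaving Hardy's constant 4.\<close>

lemma Hardy_inequality_01:
  fixes g :: "real \<Rightarrow> real"
  assumes g: "continuous_on {0..1} g" "\<And>s. s \<in> {0..1} \<Longrightarrow> 0 \<le> g s \<and> g s \<le> K" and \<rho>: "0 \<le> \<rho>" "\<rho> < 1"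
  shows "integral {0..\<rho>} (\<lambda>s. (integral {s..1} g / (1 - s))\<^sup>2)
      \<le> 2 * K\<^sup>2 * (1 - \<rho>) + 4 * integral {0..1} (\<lambda>s. (g s)\<^sup>2)"
proof -
  define A where "A s = integral {s..1} g" for s
  define \<Phi> where "\<Phi> s = (A s)\<^sup>2 / (1 - s)" for s
  have int: "g integrable_on {a..b}" if "0 \<le> a" "b \<le> 1" for a b
    using that g(1) by (intro integrable_continuous_interval) (auto intro: continuous_on_subset)
  have A': "(A has_vector_derivative - g s) (at s within {0..\<rho>})" if s: "s \<in> {0..\<rho>}" for s
  proof -
    have "((\<lambda>u. integral {0..u} g) has_vector_derivative g s) (at s within {0..1})"
      by (rule integral_has_vector_derivative) (use g s \<rho> in auto)
    then have "((\<lambda>u. integral {0..1} g - integral {0..u} g) has_vector_derivative 0 - g s) (at s within {0..\<rho>})"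
      using \<rho> by (intro derivative_intros) (auto intro: has_vector_derivative_within_subset)
    moreover have "A u = integral {0..1} g - integral {0..u} g" if "u \<in> {0..\<rho>}" for u
      using Henstock_Kurzweil_Integration.integral_combine[of 0 u 1 g] int that \<rho> by (auto simp: A_def)
    ultimately show ?thesis
      using has_vector_derivative_transform[OF s, of A "\<lambda>u. integral {0..1} g - integral {0..u} g" "0 - g s"] by simp
  qed
  have Ac: "continuous_on {0..\<rho>} A"
    using A' has_vector_derivative_continuous continuous_on_eq_continuous_within by blast
  have gc: "continuous_on {0..\<rho>} g" using g(1) \<rho> by (auto intro: continuous_on_subset)
  have ftc: "((\<lambda>s. (A s / (1 - s))\<^sup>2 - 2 * A s * g s / (1 - s)) has_integral \<Phi> \<rho> - \<Phi> 0) {0..\<rho>}"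
  proof (rule fundamental_theorem_of_calculus)
    fix s assume s: "s \<in> {0..\<rho>}"
    have "(A has_real_derivative - g s) (at s within {0..\<rho>})"
      using A'[OF s] by (simp add: has_real_derivative_iff_has_vector_derivative)
    then have sq: "((\<lambda>s. (A s)\<^sup>2) has_real_derivative - (2 * A s * g s)) (at s within {0..\<rho>})"
      by (auto intro!: derivative_eq_intros)
    have d: "1 - s \<noteq> 0" using s \<rho> by auto
    have "(\<Phi> has_real_derivative (- (2 * A s * g s) * (1 - s) - (A s)\<^sup>2 * (-1)) / ((1 - s) * (1 - s))) (at s within {0..\<rho>})"
      unfolding \<Phi>_def by (rule DERIV_divide[OF sq]) (use d in \<open>auto intro!: derivative_eq_intros\<close>)
    also have "(- (2 * A s * g s) * (1 - s) - (A s)\<^sup>2 * (-1)) / ((1 - s) * (1 - s))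
        = (A s / (1 - s))\<^sup>2 - 2 * A s * g s / (1 - s)"
      using d by (simp add: power2_eq_square diff_divide_distrib add_divide_distrib)
    finally have "(\<Phi> has_real_derivative (A s / (1 - s))\<^sup>2 - 2 * A s * g s / (1 - s)) (at s within {0..\<rho>})" .
    then show "(\<Phi> has_vector_derivative (A s / (1 - s))\<^sup>2 - 2 * A s * g s / (1 - s)) (at s within {0..\<rho>})"
      by (simp add: has_real_derivative_iff_has_vector_derivative)
  qed (use \<rho> in auto)
  have i1: "(\<lambda>s. (A s / (1 - s))\<^sup>2) integrable_on {0..\<rho>}"
    by (intro integrable_continuous_interval continuous_intros Ac) (use \<rho> in auto)
  have i2: "(\<lambda>s. (g s)\<^sup>2) integrable_on {0..\<rho>}"
    by (intro integrable_continuous_interval continuous_intros gc)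
  have i3: "(\<lambda>s. (g s)\<^sup>2) integrable_on {0..1}"
    by (intro integrable_continuous_interval continuous_intros g)
  have tot: "((\<lambda>s. 2 * ((A s / (1 - s))\<^sup>2 - 2 * A s * g s / (1 - s)) + 4 * (g s)\<^sup>2) has_integral
      2 * (\<Phi> \<rho> - \<Phi> 0) + 4 * integral {0..\<rho>} (\<lambda>s. (g s)\<^sup>2)) {0..\<rho>}"
    by (intro has_integral_add has_integral_mult_right ftc integrable_integral i2)
  have "integral {0..\<rho>} (\<lambda>s. (A s / (1 - s))\<^sup>2)
     \<le> integral {0..\<rho>} (\<lambda>s. 2 * ((A s / (1 - s))\<^sup>2 - 2 * A s * g s / (1 - s)) + 4 * (g s)\<^sup>2)"
  proof (rule integral_le[OF i1])
    show "(\<lambda>s. 2 * ((A s / (1 - s))\<^sup>2 - 2 * A s * g s / (1 - s)) + 4 * (g s)\<^sup>2) integrable_on {0..\<rho>}"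
      using tot by (rule has_integral_integrable)
    fix s
    \<comment> \<open>With \<open>X = A / (1 - s)\<close>, nonnegativity of
      \<open>(X - 2 g)^2\<close> gives \<open>X^2 \<le> 2 (X^2 - 2 X g) + 4 g^2\<close>, and the
      bracket is the derivative of \<open>\<Phi>\<close>.\<close>
    have "0 \<le> (A s / (1 - s) - 2 * g s)\<^sup>2" by simp
    then show "(A s / (1 - s))\<^sup>2 \<le> 2 * ((A s / (1 - s))\<^sup>2 - 2 * A s * g s / (1 - s)) + 4 * (g s)\<^sup>2"
      by (simp add: power2_diff power_mult_distrib)
  qed
  also have "\<dots> = 2 * (\<Phi> \<rho> - \<Phi> 0) + 4 * integral {0..\<rho>} (\<lambda>s. (g s)\<^sup>2)"
    using tot by (rule integral_unique)
  also have "\<dots> \<le> 2 * (K\<^sup>2 * (1 - \<rho>)) + 4 * integral {0..1} (\<lambda>s. (g s)\<^sup>2)"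
  proof (intro add_mono mult_left_mono)
    have "A \<rho> \<le> integral {\<rho>..1} (\<lambda>_. K)"
      unfolding A_def by (rule integral_le) (use g(2) \<rho> int in auto)
    moreover have "0 \<le> A \<rho>"
      unfolding A_def by (rule integral_nonneg) (use g(2) \<rho> int in auto)
    ultimately have "(A \<rho>)\<^sup>2 \<le> (K * (1 - \<rho>))\<^sup>2" using \<rho> by (intro power_mono) (auto simp: mult.commute)
    then have "\<Phi> \<rho> \<le> K\<^sup>2 * (1 - \<rho>)" using \<rho> by (simp add: \<Phi>_def field_simps power2_eq_square)
    moreover have "0 \<le> \<Phi> 0" by (simp add: \<Phi>_def)
    ultimately show "\<Phi> \<rho> - \<Phi> 0 \<le> K\<^sup>2 * (1 - \<rho>)" by simp
    show "integral {0..\<rho>} (\<lambda>s. (g s)\<^sup>2) \<le> integral {0..1} (\<lambda>s. (g s)\<^sup>2)"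
      by (rule integral_subset_le) (use \<rho> i2 i3 in auto)
  qed auto
  finally show ?thesis by (simp add: A_def)
qed

section \<open>Continuity and interchange of circle means\<close>

lemma circle_mean_eq_unit: "circle_mean r F = circle_mean 1 (\<lambda>u. F (of_real r * u))"
  by (simp add: circle_mean_def)

text \<open>The radius may vary with the parameter, as in \<open>sqrt s\<close>, and continuity is
  asked only on the union of the circles, so that integrands defined on a disc or an annulus
  qualify.\<close>

lemma continuous_on_circle_mean:
  fixes f :: "'x::topological_space \<Rightarrow> complex \<Rightarrow> 'a::banach"
  assumes f: "continuous_on {(x, w). x \<in> U \<and> norm w = q x} (\<lambda>(x, w). f x w)"
    and q: "continuous_on U q" "\<And>x. x \<in> U \<Longrightarrow> 0 \<le> q x"
  shows "continuous_on U (\<lambda>x. circle_mean (q x) (f x))"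
proof -
  have "continuous_on (U \<times> cbox 0 (2 * pi)) (\<lambda>(x, \<theta>). f x (of_real (q x) * cis \<theta>))"
  proof -
    have "continuous_on (U \<times> cbox 0 (2 * pi)) (\<lambda>p. (\<lambda>(x, w). f x w) (fst p, of_real (q (fst p)) * cis (snd p)))"
      by (rule continuous_on_compose2[OF f])
         (use q(2) in \<open>auto intro!: continuous_intros continuous_on_compose2[OF q(1)] simp: norm_mult\<close>)
    then show ?thesis by (simp add: case_prod_beta)
  qed
  from integral_continuous_on_param[OF this] show ?thesis
    unfolding circle_mean_def by (auto intro!: continuous_intros)
qed

lemma circle_mean_integral_swap:
  fixes f :: "complex \<Rightarrow> real \<Rightarrow> 'a::banach"
  assumes "continuous_on (sphere 0 r \<times> {a..b}) (\<lambda>(z, s). f z s)" "0 \<le> r"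
  shows "circle_mean r (\<lambda>z. integral {a..b} (f z)) = integral {a..b} (\<lambda>s. circle_mean r (\<lambda>z. f z s))"
proof -
  have "continuous_on (cbox (0, a) (2 * pi, b)) (\<lambda>p. (\<lambda>(z, s). f z s) (of_real r * cis (fst p), snd p))"
    by (rule continuous_on_compose2[OF assms(1)])
       (use assms(2) in \<open>auto intro!: continuous_intros simp: norm_mult cbox_Pair_eq\<close>)
  then have "continuous_on (cbox (0, a) (2 * pi, b)) (\<lambda>(\<theta>, s). f (of_real r * cis \<theta>) s)"
    by (simp add: case_prod_beta)
  from integral_swap_continuous[OF this] show ?thesis
    by (simp add: circle_mean_def)
qed

lemma circle_mean_swap:
  fixes f :: "complex \<Rightarrow> complex \<Rightarrow> 'a::banach"
  assumes "continuous_on (sphere 0 r \<times> sphere 0 q) (\<lambda>(z, w). f z w)" "0 \<le> r" "0 \<le> q"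
  shows "circle_mean r (\<lambda>z. circle_mean q (f z)) = circle_mean q (\<lambda>w. circle_mean r (\<lambda>z. f z w))"
proof -
  have "continuous_on (sphere 0 r \<times> {0..2*pi}) (\<lambda>p. (\<lambda>(z, w). f z w) (fst p, of_real q * cis (snd p)))"
    by (rule continuous_on_compose2[OF assms(1)])
       (use assms(3) in \<open>auto intro!: continuous_intros simp: norm_mult\<close>)
  then have "continuous_on (sphere 0 r \<times> {0..2*pi}) (\<lambda>(z, \<theta>). f z (of_real q * cis \<theta>))"
    by (simp add: case_prod_beta)
  from circle_mean_integral_swap[OF this assms(2)]
  show ?thesis by (simp add: circle_mean_def[of q]) (simp add: circle_mean_def)
qed

text \<open>The first part expresses the Dirichlet integral of \<open>B\<close> by boundary values,
  where it counts the winding of a Blaschke product. The second compares it with radial integration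
  in dt instead of d(t^2), the form in which Hardy's inequality delivers it; it holds because
  \<open>s \<le> sqrt s\<close> and the means increase.\<close>

lemma circle_mean_deriv_square_le:
  assumes B: "B analytic_on cball 0 1"
  shows "of_real (integral {0..1} (\<lambda>s. circle_mean (sqrt s) (\<lambda>z. (norm (deriv B z))\<^sup>2)))
      = circle_mean 1 (\<lambda>z. B z * cnj (z * deriv B z))"
  and "integral {0..1} (\<lambda>s. circle_mean s (\<lambda>z. (norm (deriv B z))\<^sup>2))
      \<le> integral {0..1} (\<lambda>s. circle_mean (sqrt s) (\<lambda>z. (norm (deriv B z))\<^sup>2))"
proof -
  have B': "deriv B analytic_on cball 0 1" using B by (rule analytic_deriv)
  have c: "continuous_on (cball 0 1) (deriv B)"
    using B' analytic_imp_holomorphic holomorphic_on_imp_continuous_on by blast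
  have cq: "continuous_on {0..1} (\<lambda>s. circle_mean (q s) (\<lambda>z. (norm (deriv B z))\<^sup>2))"
    if "continuous_on {0..1} q" "\<And>s. s \<in> {0..1} \<Longrightarrow> 0 \<le> q s \<and> q s \<le> 1" for q
    by (rule continuous_on_circle_mean)
       (use that in \<open>auto intro!: continuous_intros continuous_on_compose2[OF c] simp: case_prod_beta\<close>)
  have sq: "continuous_on {0..1} (\<lambda>s. circle_mean (sqrt s) (\<lambda>z. (norm (deriv B z))\<^sup>2))"
    by (rule cq) (auto intro!: continuous_intros)
  have "circle_mean 1 (\<lambda>z. B z * cnj (z * deriv B z))
     = integral {0..1} (\<lambda>s. circle_mean (sqrt s) (\<lambda>z. deriv B z * cnj (deriv B z)))"
    by (rule circle_mean_eq_area_pairing[OF B B'])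
  also have "\<dots> = integral {0..1} (\<lambda>s. of_real (circle_mean (sqrt s) (\<lambda>z. (norm (deriv B z))\<^sup>2)))"
  proof (rule integral_cong)
    fix s :: real assume s: "s \<in> {0..1}"
    have "continuous_on (sphere 0 (sqrt s)) (deriv B)"
      using c by (rule continuous_on_subset) (use s in auto)
    then have "circle_mean (sqrt s) (\<lambda>z. complex_of_real ((norm (deriv B z))\<^sup>2)) = of_real (circle_mean (sqrt s) (\<lambda>z. (norm (deriv B z))\<^sup>2))"
      by (intro circle_mean_of_real) (use s in \<open>auto intro!: continuous_intros\<close>)
    then show "circle_mean (sqrt s) (\<lambda>z. deriv B z * cnj (deriv B z)) = of_real (circle_mean (sqrt s) (\<lambda>z. (norm (deriv B z))\<^sup>2))"
      by (simp only: complex_norm_square)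
  qed
  also have "\<dots> = of_real (integral {0..1} (\<lambda>s. circle_mean (sqrt s) (\<lambda>z. (norm (deriv B z))\<^sup>2)))"
    using integral_linear[OF integrable_continuous_interval[OF sq] bounded_linear_of_real] by (simp add: o_def)
  finally show "of_real (integral {0..1} (\<lambda>s. circle_mean (sqrt s) (\<lambda>z. (norm (deriv B z))\<^sup>2)))
      = circle_mean 1 (\<lambda>z. B z * cnj (z * deriv B z))" by simp
  show "integral {0..1} (\<lambda>s. circle_mean s (\<lambda>z. (norm (deriv B z))\<^sup>2))
      \<le> integral {0..1} (\<lambda>s. circle_mean (sqrt s) (\<lambda>z. (norm (deriv B z))\<^sup>2))"
  proof (rule integral_le)
    fix s :: real assume s: "s \<in> {0..1}"
    then have "s \<le> sqrt s" by (intro real_le_rsqrt) (auto simp: power2_eq_square mult_left_le_one_le)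
    with s show "circle_mean s (\<lambda>z. (norm (deriv B z))\<^sup>2) \<le> circle_mean (sqrt s) (\<lambda>z. (norm (deriv B z))\<^sup>2)"
      by (intro circle_mean_norm_square_mono analytic_on_cball_mono[OF B']) auto
  qed (intro integrable_continuous_interval sq cq; auto intro!: continuous_intros)+
qed

text \<open>Along each radius, \<open>1 - |B|\<close> is at most the integral of \<open>|B'|\<close> up to the circle, so Hardy's
  inequality bounds the kernel diagonal by the area of the image of \<open>B\<close>.\<close>

lemma integral_model_kernel_diagonal_le:
  assumes B: "B analytic_on cball 0 1" "\<And>z. norm z = 1 \<Longrightarrow> norm (B z) = 1"
    and K: "\<And>z. norm z \<le> 1 \<Longrightarrow> norm (deriv B z) \<le> K" and \<rho>: "0 \<le> \<rho>" "\<rho> < 1"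
  shows "integral {0..\<rho>} (\<lambda>s. circle_mean (sqrt s) (\<lambda>w. ((1 - (norm (B w))\<^sup>2) / (1 - (norm w)\<^sup>2))\<^sup>2))
     \<le> 8 * K\<^sup>2 * (1 - \<rho>) + 16 * integral {0..1} (\<lambda>s. circle_mean s (\<lambda>z. (norm (deriv B z))\<^sup>2))"
proof -
  define p where "p w = ((1 - (norm (B w))\<^sup>2) / (1 - (norm w)\<^sup>2))\<^sup>2" for w
  have B': "deriv B analytic_on cball 0 1" using B(1) by (rule analytic_deriv)
  have c: "continuous_on (cball 0 1) (deriv B)" "continuous_on (cball 0 1) B"
    using B B' analytic_imp_holomorphic holomorphic_on_imp_continuous_on by blast+
  have Ble: "norm (B z) \<le> 1" if "norm z \<le> 1" for z
    using norm_le_1_in_disc[OF B(1) _ that] B(2) by auto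
  have mem: "of_real s * u \<in> cball 0 1" if "norm u = 1" "0 \<le> s" "s \<le> 1" for s :: real and u :: complex
    using that by (simp add: norm_mult)
  have gc: "continuous_on {0..1} (\<lambda>t. norm (deriv B (of_real t * u)))" if "norm u = 1" for u
    by (intro continuous_intros continuous_on_compose2[OF c(1)]) (use mem that in auto)
  \<comment> \<open>A point with \<open>|w|^2 = s\<close> lies at radius
    \<open>sqrt s \<ge> s\<close>. Integrating from \<open>s\<close> instead only enlarges the bound
    and matches the denominator \<open>1 - s = 1 - |w|^2\<close> of Hardy's inequality.\<close>
  have rad: "1 - norm (B (of_real (sqrt s) * u)) \<le> integral {s..1} (\<lambda>t. norm (deriv B (of_real t * u)))"
    if u: "norm u = 1" and s: "0 \<le> s" "s \<le> 1" for s u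
  proof -
    have ss: "s \<le> sqrt s" "sqrt s \<le> 1" "0 \<le> sqrt s"
      using s by (auto intro!: real_le_rsqrt simp: power2_eq_square mult_left_le_one_le)
    have ftc: "((\<lambda>t. deriv B (of_real t * u) * u) has_integral B (of_real 1 * u) - B (of_real (sqrt s) * u)) {sqrt s..1}"
    proof (rule fundamental_theorem_of_calculus)
      fix t :: real assume t: "t \<in> {sqrt s..1}"
      have "B field_differentiable at (of_real t * u)"
        using B(1) mem[OF u, of t] t ss by (auto intro: analytic_on_imp_differentiable_at)
      then have "(B has_field_derivative deriv B (of_real t * u)) (at (of_real t * u))"
        by (rule field_differentiable_derivI)
      then have "((\<lambda>t. B (of_real t * u)) has_vector_derivative (u * deriv B (of_real t * u))) (at t within {sqrt s..1})"
        by (rule field_vector_diff_chain_within[unfolded o_def, rotated, OF DERIV_subset])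
           (auto intro!: derivative_eq_intros has_vector_derivative_real_field)
      then show "((\<lambda>t. B (of_real t * u)) has_vector_derivative (deriv B (of_real t * u) * u)) (at t within {sqrt s..1})"
        by (simp add: mult.commute)
    qed (use ss in auto)
    have int: "(\<lambda>t. norm (deriv B (of_real t * u))) integrable_on {a..1}" if "0 \<le> a" for a
      using gc[OF u] that by (intro integrable_continuous_interval) (auto intro: continuous_on_subset)
    have "1 - norm (B (of_real (sqrt s) * u)) \<le> norm (B (of_real 1 * u) - B (of_real (sqrt s) * u))"
      using norm_triangle_ineq2[of "B u" "B (of_real (sqrt s) * u)"] B(2)[OF u] by simp
    also have "\<dots> \<le> integral {sqrt s..1} (\<lambda>t. norm (deriv B (of_real t * u)))"
      unfolding integral_unique[OF ftc, symmetric]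
      by (rule integral_norm_bound_integral) (use ftc int[OF ss(3)] u in \<open>auto simp: norm_mult has_integral_integrable\<close>)
    also have "\<dots> \<le> integral {s..1} (\<lambda>t. norm (deriv B (of_real t * u)))"
      by (rule integral_subset_le) (use ss s int in auto)
    finally show ?thesis .
  qed
  have pc: "continuous_on (sphere 0 1 \<times> {0..\<rho>}) (\<lambda>(u, s). p (of_real (sqrt s) * u))"
    unfolding p_def case_prod_beta
    by (intro continuous_intros continuous_on_compose2[OF c(2)])
       (use \<rho> in \<open>auto simp: norm_mult power_mult_distrib\<close>)
  have p_le: "integral {0..\<rho>} (\<lambda>s. p (of_real (sqrt s) * u))
      \<le> 8 * K\<^sup>2 * (1 - \<rho>) + 16 * integral {0..1} (\<lambda>t. (norm (deriv B (of_real t * u)))\<^sup>2)"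
    if u: "norm u = 1" for u
  proof -
    define A where "A s = integral {s..1} (\<lambda>t. norm (deriv B (of_real t * u)))" for s
    have "continuous_on {0..1} A"
      unfolding A_def by (intro indefinite_integral_continuous_1' integrable_continuous_interval gc u)
    then have Ac: "continuous_on {0..\<rho>} A" using \<rho> by (auto intro: continuous_on_subset)
    have "integral {0..\<rho>} (\<lambda>s. p (of_real (sqrt s) * u)) \<le> integral {0..\<rho>} (\<lambda>s. 4 * (A s / (1 - s))\<^sup>2)"
    proof (rule integral_le)
      show "(\<lambda>s. p (of_real (sqrt s) * u)) integrable_on {0..\<rho>}"
        by (intro integrable_continuous_interval continuous_on_compose2[OF pc, of _ "\<lambda>s. (u, s)", unfolded case_prod_conv])
           (use u in \<open>auto intro!: continuous_intros\<close>)
      show "(\<lambda>s. 4 * (A s / (1 - s))\<^sup>2) integrable_on {0..\<rho>}"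
        by (intro integrable_continuous_interval continuous_intros Ac) (use \<rho> in auto)
      fix s assume s: "s \<in> {0..\<rho>}"
      define b where "b = norm (B (of_real (sqrt s) * u))"
      have b: "0 \<le> b" "b \<le> 1" "1 - b \<le> A s"
        using rad[OF u, of s] Ble[of "of_real (sqrt s) * u"] mem[OF u, of "sqrt s"] s \<rho> by (auto simp: b_def A_def)
      have "1 - b\<^sup>2 = (1 + b) * (1 - b)" by (simp add: power2_eq_square algebra_simps)
      \<comment> \<open>The factor \<open>1 + b \<le> 2\<close>, squared, turns Hardy's constants 2
        and 4 into the 8 and 16 of the conclusion.\<close>
      also have "\<dots> \<le> 2 * A s" using b by (intro mult_mono) auto
      finally have "((1 - b\<^sup>2) / (1 - s))\<^sup>2 \<le> (2 * A s / (1 - s))\<^sup>2"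
        using b s \<rho> by (intro power_mono divide_right_mono) (auto simp: power_le_one)
      moreover have "(norm (of_real (sqrt s) * u))\<^sup>2 = s" using s u by (simp add: norm_mult)
      ultimately show "p (of_real (sqrt s) * u) \<le> 4 * (A s / (1 - s))\<^sup>2"
        by (simp add: p_def b_def power_divide power_mult_distrib)
    qed
    also have "\<dots> = 4 * integral {0..\<rho>} (\<lambda>s. (A s / (1 - s))\<^sup>2)" by simp
    also have "\<dots> \<le> 4 * (2 * K\<^sup>2 * (1 - \<rho>) + 4 * integral {0..1} (\<lambda>t. (norm (deriv B (of_real t * u)))\<^sup>2))"
      unfolding A_def by (intro mult_left_mono Hardy_inequality_01 gc[OF u] \<rho>) (use K mem[OF u] in auto)
    finally show ?thesis by simp
  qed
  have B2c: "continuous_on (sphere 0 1 \<times> {0..1}) (\<lambda>(u, t). (norm (deriv B (of_real t * u)))\<^sup>2)"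
    unfolding case_prod_beta
    by (intro continuous_intros continuous_on_compose2[OF c(1)]) (use mem in auto)
  have "integral {0..\<rho>} (\<lambda>s. circle_mean (sqrt s) p) = integral {0..\<rho>} (\<lambda>s. circle_mean 1 (\<lambda>u. p (of_real (sqrt s) * u)))"
    by (subst circle_mean_eq_unit) simp
  also have "\<dots> = circle_mean 1 (\<lambda>u. integral {0..\<rho>} (\<lambda>s. p (of_real (sqrt s) * u)))"
    by (rule circle_mean_integral_swap[OF pc, symmetric]) simp
  also have "\<dots> \<le> circle_mean 1 (\<lambda>u. 8 * K\<^sup>2 * (1 - \<rho>) + 16 * integral {0..1} (\<lambda>t. (norm (deriv B (of_real t * u)))\<^sup>2))"
    using integral_continuous_on_param[of "sphere 0 1" 0 \<rho> "\<lambda>u s. p (of_real (sqrt s) * u)"] pc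
      integral_continuous_on_param[of "sphere 0 1" 0 1 "\<lambda>u t. (norm (deriv B (of_real t * u)))\<^sup>2"] B2c p_le
    by (intro circle_mean_mono) (auto intro!: continuous_intros)
  also have "\<dots> = 8 * K\<^sup>2 * (1 - \<rho>) + 16 * circle_mean 1 (\<lambda>u. integral {0..1} (\<lambda>t. (norm (deriv B (of_real t * u)))\<^sup>2))"
    using integral_continuous_on_param[of "sphere 0 1" 0 1 "\<lambda>u t. (norm (deriv B (of_real t * u)))\<^sup>2"] B2c
    by (subst circle_mean_add) (auto intro!: continuous_intros simp: circle_mean_cmult)
  also have "circle_mean 1 (\<lambda>u. integral {0..1} (\<lambda>t. (norm (deriv B (of_real t * u)))\<^sup>2))
      = integral {0..1} (\<lambda>t. circle_mean 1 (\<lambda>u. (norm (deriv B (of_real t * u)))\<^sup>2))"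
    by (rule circle_mean_integral_swap[OF B2c]) simp
  also have "\<dots> = integral {0..1} (\<lambda>t. circle_mean t (\<lambda>z. (norm (deriv B z))\<^sup>2))"
    by (subst (2) circle_mean_eq_unit) simp
  finally show ?thesis by (simp add: p_def)
qed

text \<open>\<open>N\<close> is the Dirichlet integral of \<open>B\<close> divided by \<pi>, in the
  application its degree. Weighted by \<open>sqrt N\<close>, the area contributes
  \<open>sqrt N / 2\<close> and the kernel diagonal \<open>16 N / (2 sqrt N) = 8 sqrt N\<close>;
  together they stay below \<open>9 sqrt N\<close>.\<close>

lemma circle_mean_deriv_le_sqrt:
  assumes R: "R analytic_on cball 0 1" and B: "B analytic_on cball 0 1" and G: "G analytic_on cball 0 1"
    and B1: "\<And>\<zeta>. norm \<zeta> = 1 \<Longrightarrow> norm (B \<zeta>) = 1"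
    and GR: "\<And>\<zeta>. norm \<zeta> = 1 \<Longrightarrow> G \<zeta> = cnj (R \<zeta>) * B \<zeta>"
    and N: "circle_mean 1 (\<lambda>z. B z * cnj (z * deriv B z)) = of_real N" "0 < N"
    and area: "integral {0..1} (\<lambda>s. circle_mean (sqrt s) (\<lambda>z. (norm (deriv R z))\<^sup>2)) \<le> 1"
  shows "circle_mean 1 (\<lambda>z. norm (deriv R z)) \<le> 9 * sqrt N"
proof -
  define k where "k = model_kernel B"
  define p where "p w = (1 - (norm (B w))\<^sup>2) / (1 - (norm w)\<^sup>2)" for w
  have R': "deriv R analytic_on cball 0 1" using R by (rule analytic_deriv)
  have B': "deriv B analytic_on cball 0 1" using B by (rule analytic_deriv)
  have c: "continuous_on (cball 0 1) (deriv R)" "continuous_on (cball 0 1) B" "continuous_on (cball 0 1) (deriv B)"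
    using B R' B' analytic_imp_holomorphic holomorphic_on_imp_continuous_on by blast+
  have "bounded (deriv B ` cball 0 1)"
    by (intro compact_imp_bounded compact_continuous_image c) simp
  then obtain K where K: "\<And>z. norm z \<le> 1 \<Longrightarrow> norm (deriv B z) \<le> K"
    unfolding bounded_iff by (metis image_eqI mem_cball_0)
  have Ble: "norm (B z) \<le> 1" if "norm z \<le> 1" for z
    using norm_le_1_in_disc[OF B _ that] B1 by auto
  have ac: "continuous_on {0..1} (\<lambda>s. circle_mean (sqrt s) (\<lambda>z. (norm (deriv R z))\<^sup>2))"
    by (rule continuous_on_circle_mean)
       (auto intro!: continuous_intros continuous_on_compose2[OF c(1)] simp: case_prod_beta)
  \<comment> \<open>For \<open>|z| = t < 1\<close> the denominator of the kernel has no zero with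
    \<open>w\<close> in the closed disc, so all exchanges of integrals concern continuous functions.
    The bound does not depend on \<open>t\<close>.\<close>
  have *: "circle_mean t (\<lambda>z. norm (deriv R z)) \<le> 9 * sqrt N" if t: "0 \<le> t" "t < 1" for t
  proof -
    define f where "f z w = norm (deriv R w) * (norm (k z w))\<^sup>2" for z w
    define J where "J s = circle_mean (sqrt s) (\<lambda>w. circle_mean t (\<lambda>z. f z w))" for s
    have fc: "continuous_on (cball 0 t \<times> cball 0 1) (\<lambda>p. f (fst p) (snd p))"
    proof -
      have "1 - cnj z * w \<noteq> 0" if "norm z \<le> t" "norm w \<le> 1" for z w
        using one_minus_cnj_mult_neq_0[of z w] that t by simp
      then show ?thesis unfolding f_def k_def model_kernel_def
        by (intro continuous_intros continuous_on_compose2[OF c(1)] continuous_on_compose2[OF c(2)]) (use t in auto)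
    qed
    have f_nonneg: "0 \<le> f z w" for z w by (simp add: f_def)
    have fc': "continuous_on S (\<lambda>x. f (a x) (b x))" if "continuous_on S a" "continuous_on S b"
      "\<And>x. x \<in> S \<Longrightarrow> norm (a x) \<le> t \<and> norm (b x) \<le> 1" for a b and S :: "'x::topological_space set"
      using continuous_on_compose2[OF fc, of S "\<lambda>x. (a x, b x)"] that by (force intro!: continuous_intros)
    have "norm (deriv R z) \<le> integral {0..1} (\<lambda>s. circle_mean (sqrt s) (f z))" if z: "norm z = t" for z
    proof -
      have z1: "norm z < 1" using z t by simp
      have ka: "(\<lambda>w. (k z w)\<^sup>2) analytic_on cball 0 1"
        unfolding k_def using model_kernel_analytic[OF B z1] by (intro analytic_intros)
      have kc: "continuous_on (cball 0 1) (k z)"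
        unfolding k_def using model_kernel_analytic[OF B z1] analytic_imp_holomorphic holomorphic_on_imp_continuous_on by blast
      have "deriv R z = circle_mean 1 (\<lambda>\<zeta>. R \<zeta> * cnj (\<zeta> * (k z \<zeta>)\<^sup>2))"
        unfolding k_def by (rule deriv_eq_circle_mean_model_kernel[OF R B G GR z1, symmetric])
      also have "\<dots> = integral {0..1} (\<lambda>s. circle_mean (sqrt s) (\<lambda>w. deriv R w * cnj ((k z w)\<^sup>2)))"
        by (rule circle_mean_eq_area_pairing[OF R ka])
      also have "norm \<dots> \<le> integral {0..1} (\<lambda>s. circle_mean (sqrt s) (f z))"
      proof (rule integral_norm_bound_integral)
        show "(\<lambda>s. circle_mean (sqrt s) (\<lambda>w. deriv R w * cnj ((k z w)\<^sup>2))) integrable_on {0..1}"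
          by (rule integrable_continuous_interval, rule continuous_on_circle_mean)
             (auto intro!: continuous_intros continuous_on_compose2[OF c(1)] continuous_on_compose2[OF kc]
               simp: case_prod_beta)
        show "(\<lambda>s. circle_mean (sqrt s) (f z)) integrable_on {0..1}"
          by (rule integrable_continuous_interval, rule continuous_on_circle_mean)
             (use z in \<open>auto intro!: continuous_intros fc' simp: case_prod_beta\<close>)
        fix s :: real assume s: "s \<in> {0..1}"
        have "norm (circle_mean (sqrt s) (\<lambda>w. deriv R w * cnj ((k z w)\<^sup>2)))
            \<le> circle_mean (sqrt s) (\<lambda>w. norm (deriv R w * cnj ((k z w)\<^sup>2)))"
          by (rule norm_circle_mean_le)
             (use s in \<open>auto intro!: continuous_intros continuous_on_compose2[OF c(1)] continuous_on_compose2[OF kc]\<close>)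
        also have "\<dots> = circle_mean (sqrt s) (f z)"
          by (simp add: f_def[abs_def] norm_mult norm_power)
        finally show "norm (circle_mean (sqrt s) (\<lambda>w. deriv R w * cnj ((k z w)\<^sup>2))) \<le> circle_mean (sqrt s) (f z)" .
      qed
      finally show ?thesis .
    qed
    moreover have Nc: "continuous_on (sphere 0 t \<times> {0..1}) (\<lambda>(z, s). circle_mean (sqrt s) (f z))"
      unfolding case_prod_beta
      by (rule continuous_on_circle_mean) (auto intro!: continuous_intros fc' simp: case_prod_beta)
    moreover have "continuous_on (sphere 0 t) (\<lambda>z. integral {0..1} (\<lambda>s. circle_mean (sqrt s) (f z)))"
      using integral_continuous_on_param[of "sphere 0 t" 0 1 "\<lambda>z s. circle_mean (sqrt s) (f z)"] Nc by simp
    ultimately have "circle_mean t (\<lambda>z. norm (deriv R z))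
        \<le> circle_mean t (\<lambda>z. integral {0..1} (\<lambda>s. circle_mean (sqrt s) (f z)))"
      by (intro circle_mean_mono) (use t in \<open>auto intro!: continuous_intros continuous_on_subset[OF c(1)]\<close>)
    also have "\<dots> = integral {0..1} (\<lambda>s. circle_mean t (\<lambda>z. circle_mean (sqrt s) (f z)))"
      by (rule circle_mean_integral_swap[OF Nc t(1)])
    also have "\<dots> = integral {0..1} J"
      unfolding J_def
      by (intro integral_cong circle_mean_swap) (use t in \<open>auto intro!: fc' continuous_intros simp: case_prod_beta\<close>)
    also have "integral {0..1} J \<le> 9 * sqrt N"
    proof -
      have inner: "continuous_on (cball 0 1) (\<lambda>w. circle_mean t (\<lambda>z. f z w))"
        by (rule continuous_on_circle_mean) (use t in \<open>auto intro!: continuous_intros fc' simp: case_prod_beta\<close>)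
      have Jc: "continuous_on {0..1} J"
        unfolding J_def by (rule continuous_on_circle_mean)
          (auto intro!: continuous_intros continuous_on_compose2[OF inner] simp: case_prod_beta)
      have pc: "continuous_on S (\<lambda>x. p (h x))" if "continuous_on S h" "\<And>x. x \<in> S \<Longrightarrow> norm (h x) < 1"
        for h and S :: "'x::topological_space set"
      proof -
        have "(norm (h x))\<^sup>2 < 1" if "x \<in> S" for x
          using \<open>\<And>x. x \<in> S \<Longrightarrow> norm (h x) < 1\<close>[OF that] by (simp add: abs_square_less_1)
        then show ?thesis
          unfolding p_def
          by (intro continuous_intros continuous_on_compose2[OF c(2)] that(1))
             (use that(2) in \<open>fastforce simp: less_imp_le\<close>)+
      qed
      \<comment> \<open>Averaging over \<open>z\<close> turns the squared kernel into at most its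
        diagonal \<open>p w\<close>; then
        \<open>x y \<le> sqrt N / 2 * x^2 + y^2 / (2 sqrt N)\<close>.\<close>
      have J_le: "J s \<le> sqrt N / 2 * circle_mean (sqrt s) (\<lambda>z. (norm (deriv R z))\<^sup>2)
           + 1 / (2 * sqrt N) * circle_mean (sqrt s) (\<lambda>w. (p w)\<^sup>2)" if s: "0 \<le> s" "s < 1" for s
      proof -
        have cont: "continuous_on (sphere 0 (sqrt s)) (\<lambda>w. (norm (deriv R w))\<^sup>2)" "continuous_on (sphere 0 (sqrt s)) (\<lambda>w. (p w)\<^sup>2)"
          using s by (auto intro!: continuous_intros pc continuous_on_subset[OF c(1)])
        have "J s \<le> circle_mean (sqrt s) (\<lambda>w. sqrt N / 2 * (norm (deriv R w))\<^sup>2 + 1 / (2 * sqrt N) * (p w)\<^sup>2)"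
          unfolding J_def
        proof (rule circle_mean_mono)
          show "continuous_on (sphere 0 (sqrt s)) (\<lambda>w. circle_mean t (\<lambda>z. f z w))"
            using s by (auto intro!: continuous_on_subset[OF inner])
          show "continuous_on (sphere 0 (sqrt s)) (\<lambda>w. sqrt N / 2 * (norm (deriv R w))\<^sup>2 + 1 / (2 * sqrt N) * (p w)\<^sup>2)"
            by (intro continuous_on_add continuous_on_mult continuous_on_const cont)
          fix w :: complex assume w: "norm w = sqrt s"
          then have w1: "norm w < 1" using s by auto
          have "circle_mean t (\<lambda>z. f z w) = norm (deriv R w) * circle_mean t (\<lambda>z. (norm (k z w))\<^sup>2)"
            unfolding f_def by (rule circle_mean_cmult)
          also have "\<dots> \<le> norm (deriv R w) * p w"
            unfolding k_def p_def
            by (intro mult_left_mono circle_mean_model_kernel_le[OF B B1 w1]) (use t in auto)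
          also have "\<dots> \<le> sqrt N / 2 * (norm (deriv R w))\<^sup>2 + 1 / (2 * sqrt N) * (p w)\<^sup>2"
          proof -
            have "0 \<le> (sqrt N * norm (deriv R w) - p w)\<^sup>2 / (2 * sqrt N)" using N(2) by simp
            also have "\<dots> = sqrt N / 2 * (norm (deriv R w))\<^sup>2 + 1 / (2 * sqrt N) * (p w)\<^sup>2 - norm (deriv R w) * p w"
              using N(2) by (simp add: field_simps power2_eq_square)
            finally show ?thesis by simp
          qed
          finally show "circle_mean t (\<lambda>z. f z w) \<le> sqrt N / 2 * (norm (deriv R w))\<^sup>2 + 1 / (2 * sqrt N) * (p w)\<^sup>2" .
        qed (use s in auto)
        also have "\<dots> = sqrt N / 2 * circle_mean (sqrt s) (\<lambda>z. (norm (deriv R z))\<^sup>2)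
           + 1 / (2 * sqrt N) * circle_mean (sqrt s) (\<lambda>w. (p w)\<^sup>2)"
          using s by (subst circle_mean_add)
            (auto intro!: continuous_on_mult continuous_on_const cont simp only: circle_mean_cmult real_sqrt_ge_zero)
        finally show ?thesis .
      qed
      \<comment> \<open>The denominator of \<open>p\<close> vanishes on the unit circle, whereas
        \<open>J\<close> is continuous up to \<open>s = 1\<close>. So the estimate is made up to
        \<open>\<rho>\<close> and then passes to the limit, where the term with \<open>K\<close>
        dies.\<close>
      have bound: "integral {0..\<rho>} J \<le> sqrt N / 2 + 1 / (2 * sqrt N) * (8 * K\<^sup>2 * (1 - \<rho>) + 16 * N)"
        if \<rho>: "0 \<le> \<rho>" "\<rho> < 1" for \<rho>
      proof -
        have qc: "continuous_on {0..\<rho>} (\<lambda>s. circle_mean (sqrt s) (\<lambda>w. (p w)\<^sup>2))"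
          by (rule continuous_on_circle_mean)
             (use \<rho> in \<open>auto intro!: continuous_intros pc simp: case_prod_beta\<close>)
        have a\<rho>: "continuous_on {0..\<rho>} (\<lambda>s. circle_mean (sqrt s) (\<lambda>z. (norm (deriv R z))\<^sup>2))"
          using ac \<rho> by (auto intro: continuous_on_subset)
        note i = integrable_continuous_interval[OF qc] integrable_continuous_interval[OF a\<rho>]
        have tot: "((\<lambda>s. sqrt N / 2 * circle_mean (sqrt s) (\<lambda>z. (norm (deriv R z))\<^sup>2)
           + 1 / (2 * sqrt N) * circle_mean (sqrt s) (\<lambda>w. (p w)\<^sup>2)) has_integral
            sqrt N / 2 * integral {0..\<rho>} (\<lambda>s. circle_mean (sqrt s) (\<lambda>z. (norm (deriv R z))\<^sup>2))
            + 1 / (2 * sqrt N) * integral {0..\<rho>} (\<lambda>s. circle_mean (sqrt s) (\<lambda>w. (p w)\<^sup>2))) {0..\<rho>}"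
          by (intro has_integral_add has_integral_mult_right integrable_integral i)
        have "integral {0..\<rho>} J \<le> integral {0..\<rho>} (\<lambda>s. sqrt N / 2 * circle_mean (sqrt s) (\<lambda>z. (norm (deriv R z))\<^sup>2)
           + 1 / (2 * sqrt N) * circle_mean (sqrt s) (\<lambda>w. (p w)\<^sup>2))"
          by (rule integral_le[OF integrable_continuous_interval has_integral_integrable[OF tot]])
             (use J_le Jc \<rho> in \<open>auto intro: continuous_on_subset\<close>)
        also have "\<dots> = sqrt N / 2 * integral {0..\<rho>} (\<lambda>s. circle_mean (sqrt s) (\<lambda>z. (norm (deriv R z))\<^sup>2))
            + 1 / (2 * sqrt N) * integral {0..\<rho>} (\<lambda>s. circle_mean (sqrt s) (\<lambda>w. (p w)\<^sup>2))"
          by (rule integral_unique[OF tot])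
        also have "\<dots> \<le> sqrt N / 2 * 1 + 1 / (2 * sqrt N) * (8 * K\<^sup>2 * (1 - \<rho>) + 16 * N)"
        proof (intro add_mono mult_left_mono)
          have "integral {0..\<rho>} (\<lambda>s. circle_mean (sqrt s) (\<lambda>z. (norm (deriv R z))\<^sup>2))
              \<le> integral {0..1} (\<lambda>s. circle_mean (sqrt s) (\<lambda>z. (norm (deriv R z))\<^sup>2))"
          proof (rule integral_subset_le[OF _ i(2) integrable_continuous_interval[OF ac]])
            show "\<forall>s\<in>{0..1}. 0 \<le> circle_mean (sqrt s) (\<lambda>z. (norm (deriv R z))\<^sup>2)"
              by (intro ballI circle_mean_nonneg) (auto intro!: continuous_intros continuous_on_subset[OF c(1)])
          qed (use \<rho> in auto)
          with area show "integral {0..\<rho>} (\<lambda>s. circle_mean (sqrt s) (\<lambda>z. (norm (deriv R z))\<^sup>2)) \<le> 1" by simp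
          have "integral {0..1} (\<lambda>s. circle_mean s (\<lambda>z. (norm (deriv B z))\<^sup>2)) \<le> N"
            using circle_mean_deriv_square_le[OF B] N(1) by (simp only: of_real_eq_iff)
          with integral_model_kernel_diagonal_le[OF B B1 K \<rho>]
          show "integral {0..\<rho>} (\<lambda>s. circle_mean (sqrt s) (\<lambda>w. (p w)\<^sup>2)) \<le> 8 * K\<^sup>2 * (1 - \<rho>) + 16 * N"
            by (simp add: p_def)
        qed (use N in auto)
        finally show ?thesis by simp
      qed
      have "((\<lambda>\<rho>. integral {0..\<rho>} J) \<longlongrightarrow> integral {0..1} J) (at_left 1)"
      proof -
        have "continuous_on {0..1} (\<lambda>\<rho>. integral {0..\<rho>} J)"
          by (rule indefinite_integral_continuous_1[OF integrable_continuous_interval[OF Jc]])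
        then have "((\<lambda>\<rho>. integral {0..\<rho>} J) \<longlongrightarrow> integral {0..1} J) (at 1 within {0..1})"
          by (auto simp: continuous_on_def)
        then show ?thesis by (simp add: at_within_Icc_at_left)
      qed
      moreover have "((\<lambda>\<rho>. sqrt N / 2 + 1 / (2 * sqrt N) * (8 * K\<^sup>2 * (1 - \<rho>) + 16 * N)) \<longlongrightarrow>
          sqrt N / 2 + 1 / (2 * sqrt N) * (8 * K\<^sup>2 * (1 - 1) + 16 * N)) (at_left 1)"
        by (intro tendsto_intros)
      moreover have "\<forall>\<^sub>F \<rho> in at_left (1::real). integral {0..\<rho>} J \<le> sqrt N / 2 + 1 / (2 * sqrt N) * (8 * K\<^sup>2 * (1 - \<rho>) + 16 * N)"
        using eventually_at_left_real[OF zero_less_one] by eventually_elim (use bound in auto)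
      ultimately have "integral {0..1} J \<le> sqrt N / 2 + 1 / (2 * sqrt N) * (8 * K\<^sup>2 * (1 - 1) + 16 * N)"
        by (intro tendsto_le[OF trivial_limit_at_left_real])
      also have "\<dots> = sqrt N / 2 + 8 * sqrt N" using N(2) by (simp add: field_simps)
      also have "\<dots> \<le> 9 * sqrt N" using N(2) by simp
      finally show ?thesis .
    qed
    finally show ?thesis .
  qed
  have "continuous_on {0..1} (\<lambda>t. circle_mean t (\<lambda>z. norm (deriv R z)))"
    by (rule continuous_on_circle_mean)
       (auto intro!: continuous_intros continuous_on_compose2[OF c(1)] simp: case_prod_beta)
  then have "((\<lambda>t. circle_mean t (\<lambda>z. norm (deriv R z))) \<longlongrightarrow> circle_mean 1 (\<lambda>z. norm (deriv R z))) (at 1 within {0..1})"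
    by (auto simp: continuous_on_def)
  then have "((\<lambda>t. circle_mean t (\<lambda>z. norm (deriv R z))) \<longlongrightarrow> circle_mean 1 (\<lambda>z. norm (deriv R z))) (at_left 1)"
    by (simp add: at_within_Icc_at_left)
  then show ?thesis
  proof (rule tendsto_upperbound)
    show "\<forall>\<^sub>F t in at_left (1::real). circle_mean t (\<lambda>z. norm (deriv R z)) \<le> 9 * sqrt N"
      using eventually_at_left_real[OF zero_less_one] by eventually_elim (use * in auto)
  qed auto
qed

section \<open>Boundary length and the Blaschke product of a rational function\<close>

lemma boundary_length_eq_circle_mean:
  assumes c: "continuous_on (sphere 0 1) (deriv R)"
  shows "boundary_length R = circle_mean 1 (\<lambda>z. norm (deriv R z))"
proof -
  define f where "f \<theta> = norm (deriv R (cis \<theta>))" for \<theta>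
  have fc: "continuous_on UNIV f"
    unfolding f_def by (intro continuous_intros continuous_on_compose2[OF c]) auto
  have cis: "cis \<in> measurable (uniform_measure lborel {0..2*pi}) (restrict_space borel (sphere 0 1))"
  proof (rule measurable_restrict_space2)
    have "cis \<in> borel_measurable lborel"
      by (simp add: borel_measurable_continuous_onI continuous_on_cis)
    then show "cis \<in> borel_measurable (uniform_measure lborel {0..2*pi})"
      by (subst measurable_cong_sets[OF sets_uniform_measure refl])
  qed auto
  have "boundary_length R = (\<integral>\<theta>. f \<theta> \<partial>uniform_measure lborel {0..2*pi})"
    unfolding boundary_length_def circle_measure_def f_def
    by (rule integral_distr[OF cis])
       (auto intro!: borel_measurable_continuous_on_restrict continuous_intros c)
  also have "uniform_measure lborel {0..2*pi} = density lborel (\<lambda>\<theta>. ennreal (indicator {0..2*pi} \<theta> / (2 * pi)))"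
  proof -
    have "indicator {0..2*pi} \<theta> / emeasure lborel {0..2*pi} = ennreal (indicator {0..2*pi} \<theta> / (2 * pi))" for \<theta> :: real
      by (auto simp: indicator_def divide_ennreal[symmetric] ennreal_1)
    then show ?thesis by (simp add: uniform_measure_def)
  qed
  also have "(\<integral>\<theta>. f \<theta> \<partial>density lborel (\<lambda>\<theta>. ennreal (indicator {0..2*pi} \<theta> / (2 * pi))))
      = (\<integral>\<theta>. (indicator {0..2*pi} \<theta> / (2 * pi)) *\<^sub>R f \<theta> \<partial>lborel)"
    by (rule integral_density) (use fc in \<open>auto intro: borel_measurable_continuous_onI\<close>)
  also have "\<dots> = (\<integral>\<theta>. 1 / (2 * pi) * (indicator {0..2*pi} \<theta> *\<^sub>R f \<theta>) \<partial>lborel)"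
    by (intro Bochner_Integration.integral_cong) auto
  also have "\<dots> = 1 / (2 * pi) * set_lebesgue_integral lborel {0..2*pi} f"
    unfolding set_lebesgue_integral_def by (rule integral_mult_right_zero)
  also have "set_lebesgue_integral lborel {0..2*pi} f = integral {0..2*pi} f"
    by (rule set_borel_integral_eq_integral(2)[OF borel_integrable_atLeastAtMost'])
       (use fc in \<open>auto intro: continuous_on_subset\<close>)
  finally show ?thesis by (simp add: circle_mean_def f_def[abs_def])
qed

text \<open>In lowest terms the numerator cannot vanish together with the denominator. Hence absence
  of poles in the closed disc means that the denominator has no zeros there.\<close>

lemma is_pole_poly_divide:
  fixes P Q :: "complex poly"
  assumes "coprime P Q" "Q \<noteq> 0" "poly Q z = 0"
  shows "is_pole (\<lambda>z. poly P z / poly Q z) z"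
proof (rule is_pole_divide)
  show "poly P z \<noteq> 0" using coprime_poly_0[OF assms(1), of z] assms(3) by auto
  show "filterlim (poly Q) (at 0) (at z)"
  proof (rule filterlim_atI)
    have "(poly Q \<longlongrightarrow> poly Q z) (at z)" by (intro tendsto_intros)
    then show "(poly Q \<longlongrightarrow> 0) (at z)" using assms by simp
    have "finite {x. poly Q x = 0}" using assms by (simp add: poly_roots_finite)
    then have "open (- ({x. poly Q x = 0} - {z}))" by (intro open_Compl finite_imp_closed finite_Diff)
    then show "\<forall>\<^sub>F x in at z. poly Q x \<noteq> 0"
      unfolding eventually_at_topological
      by (intro exI[of _ "- ({x. poly Q x = 0} - {z})"]) auto
  qed
qed auto

text \<open>The reversed conjugate \<open>z ^ n * cnj (poly P (1 / cnj z))\<close>.\<close>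

definition conj_reverse :: "nat \<Rightarrow> complex poly \<Rightarrow> complex \<Rightarrow> complex" where
  "conj_reverse n P z = (\<Sum>k\<le>n. cnj (coeff P k) * z ^ (n - k))"

lemma poly_eq_sum_atMost:
  fixes P :: "complex poly"
  assumes "degree P \<le> n" shows "poly P z = (\<Sum>k\<le>n. coeff P k * z ^ k)"
  unfolding poly_altdef
  by (rule sum.mono_neutral_left) (use assms in \<open>auto simp: coeff_eq_0\<close>)

lemma power_diff_on_circle:
  assumes "norm z = 1" "k \<le> n"
  shows "z ^ (n - k) = z ^ n * cnj z ^ k"
proof -
  have "z * cnj z = 1" using assms(1) by (simp add: complex_norm_square[symmetric])
  then have "z ^ k * cnj z ^ k = 1" by (simp add: power_mult_distrib[symmetric])
  moreover have "z ^ n = z ^ (n - k) * z ^ k" using assms(2) by (simp add: power_add[symmetric])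
  ultimately show ?thesis by simp
qed

lemma conj_reverse_on_circle:
  assumes "degree P \<le> n" "norm z = 1"
  shows "conj_reverse n P z = z ^ n * cnj (poly P z)"
proof -
  show ?thesis
    unfolding conj_reverse_def poly_eq_sum_atMost[OF assms(1)]
    by (simp add: sum_distrib_left mult_ac power_diff_on_circle[OF assms(2)])
qed

text \<open>The operator z d/dz multiplies \<open>z ^ (n - k)\<close> by \<open>n - k\<close>. The
  part with \<open>n\<close> returns the reversed polynomial, and on the circle the part with
  \<open>k\<close> is the reversal of \<open>z * poly (pderiv P) z\<close>.\<close>

lemma conj_reverse_deriv:
  assumes "degree P \<le> n"
  obtains D where "\<And>z. (conj_reverse n P has_field_derivative D z) (at z)"
    "\<And>z. norm z = 1 \<Longrightarrow> z * D z = of_nat n * conj_reverse n P z - z ^ n * cnj (z * poly (pderiv P) z)"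
proof
  define D where "D z = (\<Sum>k\<le>n. cnj (coeff P k) * (of_nat (n - k) * z ^ (n - k - 1)))" for z
  show "(conj_reverse n P has_field_derivative D z) (at z)" for z
    unfolding conj_reverse_def[abs_def] D_def by (auto intro!: derivative_eq_intros sum.cong)
  fix z :: complex assume z1: "norm z = 1"
  then have z: "z \<noteq> 0" by auto
  have "z * poly (pderiv P) z = (\<Sum>k\<le>n. of_nat k * coeff P k * z ^ k)"
  proof -
    have "((\<lambda>z. \<Sum>k\<le>n. coeff P k * z ^ k) has_field_derivative (\<Sum>k\<le>n. coeff P k * (of_nat k * z ^ (k - 1)))) (at z)"
      by (auto intro!: derivative_eq_intros sum.cong)
    then have "(poly P has_field_derivative (\<Sum>k\<le>n. coeff P k * (of_nat k * z ^ (k - 1)))) (at z)"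
      unfolding ext[of "poly P", OF poly_eq_sum_atMost[OF assms]] .
    then have "poly (pderiv P) z = (\<Sum>k\<le>n. coeff P k * (of_nat k * z ^ (k - 1)))"
      using DERIV_unique poly_DERIV by blast
    moreover have "z * (coeff P k * (of_nat k * z ^ (k - 1))) = of_nat k * coeff P k * z ^ k" for k
      by (cases k) auto
    ultimately show ?thesis by (simp only: sum_distrib_left)
  qed
  then have "z ^ n * cnj (z * poly (pderiv P) z) = (\<Sum>k\<le>n. of_nat k * cnj (coeff P k) * (z ^ n * cnj z ^ k))"
    by (simp add: sum_distrib_left mult_ac)
  also have "\<dots> = (\<Sum>k\<le>n. of_nat k * cnj (coeff P k) * z ^ (n - k))"
    by (intro sum.cong) (auto simp: power_diff_on_circle[OF z1])
  also have "of_nat n * conj_reverse n P z - \<dots> = (\<Sum>k\<le>n. of_nat (n - k) * cnj (coeff P k) * z ^ (n - k))"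
    unfolding conj_reverse_def sum_distrib_left sum_subtractf[symmetric]
    by (intro sum.cong) (auto simp: of_nat_diff algebra_simps)
  also have "\<dots> = z * D z"
  proof -
    have "z * (cnj (coeff P k) * (of_nat (n - k) * z ^ (n - k - 1))) = of_nat (n - k) * cnj (coeff P k) * z ^ (n - k)" for k
      by (cases "n - k") auto
    then show ?thesis by (simp only: D_def sum_distrib_left)
  qed
  finally show "z * D z = of_nat n * conj_reverse n P z - z ^ n * cnj (z * poly (pderiv P) z)" by simp
qed

text \<open>On the circle \<open>z B' / B = n - 2 Re h\<close> with \<open>h = z Q' / Q\<close>, and
  \<open>h\<close> is analytic in the closed disc with \<open>h 0 = 0\<close>, so its mean vanishes.
  Reversing with respect to \<open>n\<close>, not \<open>degree Q\<close>, puts any missing zeros of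
  \<open>B\<close> at the origin, and the winding is exactly \<open>n\<close>.\<close>

lemma circle_mean_rational_inner:
  fixes Q :: "complex poly"
  assumes Q: "\<And>z. norm z \<le> 1 \<Longrightarrow> poly Q z \<noteq> 0" "degree Q \<le> n"
  defines "B \<equiv> \<lambda>z. conj_reverse n Q z / poly Q z"
  shows "circle_mean 1 (\<lambda>z. B z * cnj (z * deriv B z)) = of_real (real n)"
proof -
  obtain D where D: "\<And>z. (conj_reverse n Q has_field_derivative D z) (at z)"
    "\<And>z. norm z = 1 \<Longrightarrow> z * D z = of_nat n * conj_reverse n Q z - z ^ n * cnj (z * poly (pderiv Q) z)"
    using conj_reverse_deriv[OF Q(2)] by blast
  define h where "h z = z * poly (pderiv Q) z / poly Q z" for z
  have hh: "h holomorphic_on cball 0 1"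
    unfolding h_def using Q(1) by (auto intro!: holomorphic_intros)
  have hc: "continuous_on (sphere 0 1) h"
    using hh holomorphic_on_imp_continuous_on continuous_on_subset sphere_cball by blast
  have h0: "circle_mean 1 h = 0" using circle_mean_holomorphic_eq[OF hh] by (simp add: h_def)
  have "circle_mean 1 (\<lambda>z. B z * cnj (z * deriv B z)) = circle_mean 1 (\<lambda>z. of_nat n - h z - cnj (h z))"
  proof (rule circle_mean_cong)
    fix z :: complex assume z: "norm z = 1"
    define q S q' where "q = poly Q z" and "S = conj_reverse n Q z" and "q' = poly (pderiv Q) z"
    have q: "q \<noteq> 0" using Q(1)[of z] z by (simp add: q_def)
    have z0: "z \<noteq> 0" using z by auto
    have S: "S = z ^ n * cnj q" using conj_reverse_on_circle[OF Q(2) z] by (simp add: S_def q_def)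
    have S0: "S \<noteq> 0" using S q z0 by simp
    have "(B has_field_derivative (D z * q - S * q') / (q * q)) (at z)"
      unfolding B_def q_def S_def q'_def
      by (rule DERIV_divide[OF D(1) poly_DERIV]) (use q q_def in simp)
    then have dB: "deriv B z = (D z * q - S * q') / (q * q)" by (rule DERIV_imp_deriv)
    have zD: "z * D z = of_nat n * S - z ^ n * cnj (z * q')" using D(2)[OF z] by (simp add: S_def q'_def)
    have "z * deriv B z = (S / q) * (z * D z / S - z * q' / q)"
      unfolding dB using q S0 by (simp add: field_simps)
    also have "z * D z / S = of_nat n - cnj (z * q' / q)"
      unfolding zD using q S0 z0 by (simp add: S field_simps)
    finally have e: "z * deriv B z = B z * (of_nat n - cnj (h z) - h z)"
      by (simp add: B_def S_def q_def h_def q'_def)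
    have "norm (B z) = 1" using S q z by (simp add: B_def S_def[symmetric] q_def[symmetric] norm_mult norm_divide norm_power)
    then have "B z * cnj (B z) = 1" by (simp add: complex_norm_square[symmetric])
    then show "B z * cnj (z * deriv B z) = of_nat n - h z - cnj (h z)"
      unfolding e complex_cnj_mult mult.assoc[symmetric] by simp
  qed auto
  also have "\<dots> = of_nat n - circle_mean 1 h - circle_mean 1 (\<lambda>z. cnj (h z))"
    by (subst circle_mean_diff, intro continuous_intros hc, intro continuous_intros hc, simp,
        subst circle_mean_diff) (auto intro!: hc)
  also have "circle_mean 1 (\<lambda>z. cnj (h z)) = cnj (circle_mean 1 h)"
    by (rule circle_mean_cnj) (auto intro: hc)
  finally show ?thesis by (simp add: h0)
qed

text \<open>With \<open>B = conj_reverse n Q / Q\<close>, the boundary function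
  \<open>cnj R * B\<close> equals \<open>z ^ n * cnj P / Q\<close>. Because
  \<open>degree P \<le> n\<close>, this is \<open>conj_reverse n P / Q\<close>, analytic in the
  closed disc. The nonnegativity serves the later treatment of \<open>ln\<close>.\<close>

lemma boundary_length_le_sqrt:
  assumes R: "R \<in> univalent_rational_funs n" "sup_norm (sphere 0 1) R \<le> 1" and n: "1 \<le> n"
  shows "boundary_length R \<le> 9 * sqrt (real n)" and "0 \<le> boundary_length R"
proof -
  obtain P Q where PQ: "R = (\<lambda>z. poly P z / poly Q z)" "Q \<noteq> 0" "coprime P Q" "degree P \<le> n" "degree Q \<le> n"
    using R(1) by (auto simp: univalent_rational_funs_def rational_funs_def)
  have Q0: "poly Q z \<noteq> 0" if "norm z \<le> 1" for z
    using R(1) that is_pole_poly_divide[OF PQ(3,2), of z] by (auto simp: univalent_rational_funs_def PQ(1))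
  have inj: "inj_on R (ball 0 1)"
    using R(1) by (auto simp: univalent_rational_funs_def univalent_on_def)
  have pa: "poly p analytic_on S" for p :: "complex poly" and S
    unfolding poly_altdef[abs_def] by (intro analytic_intros)
  have ana: "f analytic_on UNIV \<Longrightarrow> (\<lambda>z. f z / poly Q z) analytic_on cball 0 1" for f
    using Q0 analytic_on_subset[of f UNIV] pa by (auto intro!: analytic_intros)
  have cr: "conj_reverse n p analytic_on UNIV" for p
    unfolding conj_reverse_def[abs_def] by (intro analytic_intros)
  have Ra: "R analytic_on cball 0 1"
    unfolding PQ(1) by (rule ana[OF pa])
  define B where "B = (\<lambda>z. conj_reverse n Q z / poly Q z)"
  define G where "G = (\<lambda>z. conj_reverse n P z / poly Q z)"
  have Rs: "norm (R z) \<le> 1" if "norm z = 1" for z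
  proof -
    have "ereal (norm (R z)) \<le> sup_norm (sphere 0 1) R"
      unfolding sup_norm_def by (rule SUP_upper) (use that in auto)
    also have "\<dots> \<le> ereal 1" using R(2) by (simp add: one_ereal_def)
    finally show ?thesis by simp
  qed
  have Rle: "norm (R z) \<le> 1" if "norm z \<le> 1" for z
    using norm_le_1_in_disc[OF Ra Rs that] by auto
  obtain U where U: "open U" "cball 0 1 \<subseteq> U" "R holomorphic_on U"
    using Ra analytic_on_holomorphic by auto
  have area: "integral {0..1} (\<lambda>s. circle_mean (sqrt s) (\<lambda>z. (norm (deriv R z))\<^sup>2)) \<le> 1\<^sup>2"
  proof (rule area_annulus_le[where U = U and c = 0])
    show "inj_on R {z. 0 < (norm z)\<^sup>2 \<and> (norm z)\<^sup>2 < 1}"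
      by (rule inj_on_subset[OF inj]) (auto simp: abs_square_less_1)
    show "R ` {z. 0 < (norm z)\<^sup>2 \<and> (norm z)\<^sup>2 < 1} \<subseteq> cball 0 1"
      using Rle by (auto simp: abs_square_less_1 less_imp_le)
    show "{z. 0 \<le> (norm z)\<^sup>2 \<and> (norm z)\<^sup>2 \<le> 1} \<subseteq> U"
      using U(2) by (auto simp: abs_square_le_1)
  qed (use U in auto)
  have c: "continuous_on (sphere 0 1) (deriv R)"
    by (intro analytic_imp_continuous_on_sphere analytic_deriv Ra)
  have "circle_mean 1 (\<lambda>z. norm (deriv R z)) \<le> 9 * sqrt (real n)"
  proof (rule circle_mean_deriv_le_sqrt[OF Ra])
    show "B analytic_on cball 0 1" "G analytic_on cball 0 1"
      unfolding B_def G_def by (intro ana cr)+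
    show "norm (B z) = 1" if "norm z = 1" for z
      using Q0[of z] that by (simp add: B_def conj_reverse_on_circle[OF PQ(5) that] norm_mult norm_divide norm_power)
    show "G z = cnj (R z) * B z" if "norm z = 1" for z
      using Q0[of z] that
      by (simp add: B_def G_def PQ(1) conj_reverse_on_circle[OF PQ(5) that] conj_reverse_on_circle[OF PQ(4) that])
    show "circle_mean 1 (\<lambda>z. B z * cnj (z * deriv B z)) = of_real (real n)"
      unfolding B_def by (rule circle_mean_rational_inner[OF Q0 PQ(5)])
  qed (use n area in auto)
  then show "boundary_length R \<le> 9 * sqrt (real n)"
    by (simp add: boundary_length_eq_circle_mean[OF c])
  show "0 \<le> boundary_length R"
    unfolding boundary_length_def by simp
qed

lemma gamma0_le_half: "gamma0 \<le> ereal (1 / 2)"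
proof -
  have "(\<lambda>n. ereal (ln 9 / ln (real n) + 1 / 2)) \<longlonglongrightarrow> ereal (0 + 1 / 2)"
    by (intro tendsto_intros tendsto_divide_0[OF tendsto_const] filterlim_at_top_imp_at_infinity
         filterlim_compose[OF ln_at_top] filterlim_real_sequentially)
  then have "limsup (\<lambda>n. ereal (ln 9 / ln (real n) + 1 / 2)) = ereal (1 / 2)"
    by (simp add: lim_imp_Limsup)
  moreover have "gamma0 \<le> limsup (\<lambda>n. ereal (ln 9 / ln (real n) + 1 / 2))"
    unfolding gamma0_def
  proof (rule Limsup_mono)
    show "\<forall>\<^sub>F n in sequentially. (SUP R\<in>{R \<in> univalent_rational_funs n. sup_norm (sphere 0 1) R \<le> 1}.
       ereal (ln (boundary_length R) / ln (real n))) \<le> ereal (ln 9 / ln (real n) + 1 / 2)"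
      using eventually_ge_at_top[of 2]
    proof eventually_elim
      case (elim n)
      show ?case
      proof (rule SUP_least)
        fix R assume "R \<in> {R \<in> univalent_rational_funs n. sup_norm (sphere 0 1) R \<le> 1}"
        then have R: "boundary_length R \<le> 9 * sqrt (real n)" "0 \<le> boundary_length R"
          using boundary_length_le_sqrt[of R n] elim by auto
        have ln: "0 < ln (real n)" using elim by simp
        have "ln (boundary_length R) \<le> ln (9 * sqrt (real n))"
        \<comment> \<open>Length 0 is harmless: then \<open>ln\<close> has its default value 0, and
          the right-hand side is at least \<open>ln 1\<close>.\<close>
        proof (cases "boundary_length R = 0")
          case True
          have "1 \<le> 9 * sqrt (real n)" using elim real_sqrt_ge_1_iff[of "real n"] by linarith
          then show ?thesis using True by simp
        next
          case False
          then show ?thesis using R elim by simp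
        qed
        also have "\<dots> = ln 9 + ln (real n) / 2" using elim by (simp add: ln_mult ln_sqrt)
        finally show "ereal (ln (boundary_length R) / ln (real n)) \<le> ereal (ln 9 / ln (real n) + 1 / 2)"
          using ln by (simp add: field_simps)
      qed
    qed
  qed
  ultimately show ?thesis by simp
qed

section \<open>Weak distortion theorems\<close>

text \<open>A crude form of Gronwall's area theorem for the odd function \<open>u (z\<^sup>2) / z\<close>: the area of
  its image of an annulus \<open>a < |z|\<^sup>2 < 1 / 2\<close> is compared with the area of the disc that
  contains this image.\<close>

lemma norm_deriv_le_of_inj_odd:
  assumes u: "u holomorphic_on ball 0 1" "norm (u 0) = 1" "\<And>w. norm w < 1 \<Longrightarrow> u w \<noteq> 0"
    and inj: "inj_on (\<lambda>z. z / u (z\<^sup>2)) (ball 0 1)"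
  shows "norm (deriv u 0) \<le> 6"
proof -
  define h where "h = norm (deriv u 0)"
  define k where "k z = z / u (z\<^sup>2)" for z
  define G where "G z = u (z\<^sup>2) / z" for z
  \<comment> \<open>Chosen so that \<open>deriv G z = - v z / z^2\<close>. The Taylor series of
    \<open>v\<close> starts with \<open>u 0\<close> and has \<open>- deriv u 0\<close> at
    \<open>z^2\<close>; these two Parseval terms give the lower bound for the area.\<close>
  define y where "y w = u w - 2 * w * deriv u w" for w
  define v where "v z = y (z\<^sup>2)" for z
  have h0: "0 \<le> h" by (simp add: h_def)
  have sq: "norm (z\<^sup>2) < 1" if "norm z < 1" for z :: complex
    using that by (simp add: norm_power abs_square_less_1)
  have u': "deriv u holomorphic_on ball 0 1" using u(1) by (rule holomorphic_deriv) simp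
  have du: "(u has_field_derivative deriv u w) (at w)" if "norm w < 1" for w
    using u(1) that by (auto intro: holomorphic_derivI)
  have yh: "y holomorphic_on ball 0 1" unfolding y_def by (intro holomorphic_intros u u')
  have sqh: "(\<lambda>z. F (z\<^sup>2)) holomorphic_on ball 0 1" if "F holomorphic_on ball 0 1" for F :: "complex \<Rightarrow> complex"
    by (rule holomorphic_on_compose_gen[unfolded o_def, OF _ that]) (use sq in \<open>auto intro!: holomorphic_intros\<close>)
  have vh: "v holomorphic_on ball 0 1" unfolding v_def by (rule sqh[OF yh])
  have kh: "k holomorphic_on ball 0 1"
    unfolding k_def by (intro holomorphic_intros sqh u(1)) (use u(3) sq in auto)
  have Gh: "G holomorphic_on (ball 0 1 - {0})"
    unfolding G_def by (intro holomorphic_intros holomorphic_on_subset[OF sqh[OF u(1)]]) auto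
  have dG: "deriv G z = - v z / z\<^sup>2" if z: "norm z < 1" "z \<noteq> 0" for z
  proof -
    have "((\<lambda>z. u (z\<^sup>2)) has_field_derivative deriv u (z\<^sup>2) * (2 * z)) (at z)"
      by (rule DERIV_chain2[where g = "\<lambda>z. z\<^sup>2"]) (use du[OF sq[OF z(1)]] in \<open>auto intro!: derivative_eq_intros\<close>)
    then have "(G has_field_derivative (deriv u (z\<^sup>2) * (2 * z) * z - u (z\<^sup>2) * 1) / (z * z)) (at z)"
      unfolding G_def by (rule DERIV_divide) (use z in \<open>auto intro!: derivative_eq_intros\<close>)
    then show ?thesis
      by (auto dest!: DERIV_imp_deriv simp: v_def y_def power2_eq_square algebra_simps)
  qed
  have v2: "norm ((deriv ^^ 2) v 0 / fact 2) = h"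
  proof -
    have "(y has_field_derivative deriv u 0 - (2 * deriv u 0 + deriv (deriv u) 0 * (2 * 0))) (at 0)"
      unfolding y_def
      by (intro DERIV_diff du DERIV_mult[THEN DERIV_cong])
         (use u' in \<open>auto intro!: derivative_eq_intros holomorphic_derivI\<close>)
    then have y0: "deriv y 0 = - deriv u 0" by (auto dest!: DERIV_imp_deriv)
    have dv: "deriv v z = deriv y (z\<^sup>2) * (2 * z)" if "norm z < 1" for z
      unfolding v_def
      by (rule DERIV_imp_deriv, rule DERIV_chain2[where g = "\<lambda>z. z\<^sup>2"])
         (use sq[OF that] in \<open>auto intro!: derivative_eq_intros holomorphic_derivI[OF yh]\<close>)
    have "(deriv ^^ 2) v 0 = deriv (deriv v) 0" by (simp add: numeral_2_eq_2)
    also have "\<dots> = deriv (\<lambda>z. deriv y (z\<^sup>2) * (2 * z)) 0"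
      by (rule deriv_cong_ev) (use dv in \<open>auto simp: eventually_nhds intro!: exI[of _ "ball 0 1"]\<close>)
    also have "\<dots> = 2 * deriv y 0"
    proof (rule DERIV_imp_deriv)
      have "(\<lambda>z. deriv y (z\<^sup>2)) holomorphic_on ball 0 1" by (intro sqh holomorphic_deriv yh) simp
      then have "((\<lambda>z. deriv y (z\<^sup>2)) has_field_derivative deriv (\<lambda>z. deriv y (z\<^sup>2)) 0) (at 0)"
        by (rule holomorphic_derivI) auto
      then show "((\<lambda>z. deriv y (z\<^sup>2) * (2 * z)) has_field_derivative 2 * deriv y 0) (at 0)"
        by (auto intro!: derivative_eq_intros)
    qed
    finally show ?thesis by (simp add: y0 h_def norm_mult numeral_2_eq_2)
  qed
  have mean_v: "1 + h\<^sup>2 * s\<^sup>2 \<le> circle_mean (sqrt s) (\<lambda>z. (norm (v z))\<^sup>2)" if s: "0 < s" "s < 1" for s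
  proof -
    have va: "v analytic_on cball 0 (sqrt s)"
    proof -
      have "v analytic_on ball 0 1" using vh by (simp add: analytic_on_open)
      then show ?thesis by (rule analytic_on_subset) (use s in \<open>auto simp: le_less_trans\<close>)
    qed
    note P = Parseval_circle_mean_norm[OF va real_sqrt_gt_zero[OF s(1)]]
    define t where "t k = (norm ((deriv ^^ k) v 0 / fact k))\<^sup>2 * sqrt s ^ (2 * k)" for k
    have "sum t {0, 2} \<le> circle_mean (sqrt s) (\<lambda>z. (norm (v z))\<^sup>2)"
      unfolding t_def
      by (rule sum_le_suminf[OF sums_summable[OF P], of "{0, 2}", unfolded sums_unique[OF P, symmetric]])
         (use s in auto)
    moreover have "sqrt s ^ (2 * 2) = s\<^sup>2" using s by (simp only: power_mult real_sqrt_pow2)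
    moreover have "norm ((deriv ^^ 0) v 0 / fact 0) = 1" using u(2) by (simp add: v_def y_def)
    ultimately have "t 0 = 1" "t 2 = h\<^sup>2 * s\<^sup>2" unfolding t_def by (simp_all only: v2) simp
    then show ?thesis using \<open>sum t {0, 2} \<le> _\<close> by simp
  qed
  obtain d where d: "0 < d" "\<And>w. norm w < d \<Longrightarrow> norm (u w - u 0 - deriv u 0 * w) \<le> 1 * norm w"
    using du[of 0] unfolding has_field_derivative_def has_derivative_at_alt by (auto dest: spec[of _ 1])
  \<comment> \<open>\<open>C\<close> keeps the final error \<open>a * (h^2 + (h + 1)^2)\<close>
    below 1. The other restrictions on \<open>a\<close> are for the linear approximation of
    \<open>u\<close> at 0 and for \<open>a < 1/2\<close>.\<close>
  define C where "C = h\<^sup>2 + (h + 1)\<^sup>2 + 1"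
  have C: "1 \<le> C" by (simp add: C_def)
  define a where "a = min (d / 2) (min (1 / 4) (1 / C))"
  have a: "0 < a" "a < d" "a \<le> 1 / 4" "a * C \<le> 1"
  proof -
    show "0 < a" "a < d" "a \<le> 1 / 4" using d(1) C by (auto simp: a_def)
    have "a * C \<le> 1 / C * C" by (rule mult_right_mono) (use C in \<open>auto simp: a_def\<close>)
    then show "a * C \<le> 1" using C by simp
  qed
  \<comment> \<open>A bound for \<open>|G|\<close> on the circle \<open>|z|^2 = a\<close>. Its
    square is \<open>1 / a\<close> plus bounded terms, and this \<open>1 / a\<close> cancels against
    the one coming from the integral of \<open>1 / s^2\<close>.\<close>
  define M where "M = (1 + (h + 1) * a) / sqrt a"
  have M: "0 < M" unfolding M_def using a h0 by (auto intro!: divide_pos_pos add_pos_nonneg)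
  have k_ge: "1 / M \<le> norm (k z)" if z: "norm z = sqrt a" for z
  proof -
    have w: "norm (z\<^sup>2) = a" using z a by (simp add: norm_power)
    have "norm (u (z\<^sup>2)) \<le> norm (u (z\<^sup>2) - u 0 - deriv u 0 * z\<^sup>2) + norm (u 0) + norm (deriv u 0 * z\<^sup>2)"
      by (smt (verit) norm_triangle_ineq norm_triangle_ineq2 diff_add_cancel)
    also have "\<dots> \<le> a + 1 + h * a"
      using d(2)[of "z\<^sup>2"] w a u(2) by (simp add: h_def norm_mult)
    finally have "norm (u (z\<^sup>2)) \<le> 1 + (h + 1) * a" by (simp add: algebra_simps)
    moreover have "0 < norm (u (z\<^sup>2))" using u(3)[of "z\<^sup>2"] w a by simp
    moreover have "0 < 1 + (h + 1) * a" using a h0 by (auto intro!: add_pos_nonneg)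
    ultimately have "sqrt a / (1 + (h + 1) * a) \<le> sqrt a / norm (u (z\<^sup>2))"
      using a by (intro divide_left_mono mult_pos_pos) auto
    then show ?thesis using z by (simp add: k_def M_def norm_divide)
  qed
  have sa: "0 < sqrt a" "sqrt a < 1" using a by auto
  have "norm z < 1" if "norm z \<le> sqrt a" for z :: complex
    using that sa by linarith
  then have cb: "cball 0 (sqrt a) \<subseteq> (ball 0 1 :: complex set)" by auto
  then have b: "ball 0 (sqrt a) \<subseteq> (ball 0 1 :: complex set)" using ball_subset_cball by blast
  \<comment> \<open>The image of the small disc already covers the disc of radius
    \<open>1 / M\<close>. By injectivity \<open>k\<close> cannot return there from outside, so
    \<open>G = 1 / k\<close> stays below \<open>M\<close> on the whole annulus.\<close>
  have cover: "ball (k 0) (1 / M) \<subseteq> k ` ball 0 (sqrt a)"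
  proof (rule ball_subset_open_map_image)
    show "continuous_on (closure (ball 0 (sqrt a))) k"
      using sa cb by (simp add: holomorphic_on_imp_continuous_on holomorphic_on_subset[OF kh])
    show "open (k ` interior (ball 0 (sqrt a)))"
      using holomorphic_on_subset[OF kh b] inj_on_subset[OF inj b]
      by (auto intro!: open_mapping_thm3 simp: k_def[abs_def])
    show "1 / M \<le> norm (k z - k 0)" if "z \<in> frontier (ball 0 (sqrt a))" for z
      using that k_ge[of z] sa by (simp add: frontier_ball k_def)
  qed (use sa M in auto)
  have G_le: "norm (G z) \<le> M" if z: "sqrt a \<le> norm z" "norm z < 1" for z
  proof (rule ccontr)
    assume "\<not> norm (G z) \<le> M"
    moreover have "G z = 1 / k z" by (simp add: G_def k_def)
    ultimately have kz: "M < 1 / norm (k z)" by (simp add: norm_divide)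
    then have "0 < norm (k z)" using M by (cases "norm (k z) = 0") auto
    with kz M have "norm (k z) < 1 / M" by (simp add: field_simps)
    then have "k z \<in> ball (k 0) (1 / M)" by (simp add: k_def)
    with cover obtain z' where z': "z' \<in> ball 0 (sqrt a)" "k z = k z'" by auto
    then have "z = z'" using inj z sa by (auto simp: inj_on_def k_def)
    with z' z show False by simp
  qed
  have area: "integral {a..1/2} (\<lambda>s. circle_mean (sqrt s) (\<lambda>z. (norm (deriv G z))\<^sup>2)) \<le> M\<^sup>2"
  proof (rule area_annulus_le[where U = "ball 0 1 - {0}" and c = 0])
    have *: "norm z < 1 \<and> z \<noteq> 0" if "a \<le> (norm z)\<^sup>2" "(norm z)\<^sup>2 \<le> 1/2" for z :: complex
      using that a by (auto simp: abs_square_less_1[of "norm z", simplified, symmetric])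
    then show "{z::complex. a \<le> (norm z)\<^sup>2 \<and> (norm z)\<^sup>2 \<le> 1/2} \<subseteq> ball 0 1 - {0}" by auto
    have "G z = 1 / k z" for z by (simp add: G_def k_def)
    then show "inj_on G {z. a < (norm z)\<^sup>2 \<and> (norm z)\<^sup>2 < 1/2}"
      using inj * by (auto simp: inj_on_def k_def[symmetric])
    show "G ` {z. a < (norm z)\<^sup>2 \<and> (norm z)\<^sup>2 < 1/2} \<subseteq> cball 0 M"
      using * a by (auto intro!: G_le real_le_lsqrt)
  qed (use a M Gh in auto)
  have "((\<lambda>s. 1 / s\<^sup>2 + h\<^sup>2) has_integral (- 1 / (1/2) + h\<^sup>2 * (1/2)) - (- 1 / a + h\<^sup>2 * a)) {a..1/2}"
    by (rule fundamental_theorem_of_calculus)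
       (use a in \<open>auto intro!: derivative_eq_intros simp: has_real_derivative_iff_has_vector_derivative[symmetric] power2_eq_square\<close>)
  moreover have "integral {a..1/2} (\<lambda>s. 1 / s\<^sup>2 + h\<^sup>2) \<le> integral {a..1/2} (\<lambda>s. circle_mean (sqrt s) (\<lambda>z. (norm (deriv G z))\<^sup>2))"
  proof (rule integral_le)
    show "(\<lambda>s. circle_mean (sqrt s) (\<lambda>z. (norm (deriv G z))\<^sup>2)) integrable_on {a..1/2}"
    proof (rule integrable_continuous_interval, rule continuous_on_circle_mean)
      have "deriv G holomorphic_on ball 0 1 - {0}" by (intro holomorphic_deriv Gh) auto
      then have "continuous_on (ball 0 1 - {0}) (deriv G)" by (rule holomorphic_on_imp_continuous_on)
      moreover have "norm w < 1 \<and> w \<noteq> 0" if "a \<le> s" "s \<le> 1/2" "norm w = sqrt s" for s and w :: complex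
        using that a by (auto intro: le_less_trans)
      ultimately show "continuous_on {(s, w). s \<in> {a..1/2} \<and> norm w = sqrt s} (\<lambda>(s, w). (norm (deriv G w))\<^sup>2)"
        unfolding case_prod_beta by (intro continuous_intros, elim continuous_on_compose2) (auto intro!: continuous_intros)
    qed (use a in \<open>auto intro!: continuous_intros\<close>)
    fix s assume s: "s \<in> {a..1/2}"
    then have s1: "0 < s" "s < 1" using a by auto
    have "circle_mean (sqrt s) (\<lambda>z. (norm (deriv G z))\<^sup>2) = circle_mean (sqrt s) (\<lambda>z. 1 / s\<^sup>2 * (norm (v z))\<^sup>2)"
    proof (rule circle_mean_cong)
      fix z :: complex assume z: "norm z = sqrt s"
      then have "norm z < 1" "z \<noteq> 0" using s1 by auto
      then have "norm (deriv G z) = norm (v z) / (norm z)\<^sup>2" by (simp add: dG norm_divide norm_power)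
      also have "(norm z)\<^sup>2 = s" using z s1 by simp
      finally show "(norm (deriv G z))\<^sup>2 = 1 / s\<^sup>2 * (norm (v z))\<^sup>2" by (simp add: power_divide)
    qed (use s1 in auto)
    also have "\<dots> = 1 / s\<^sup>2 * circle_mean (sqrt s) (\<lambda>z. (norm (v z))\<^sup>2)" by (rule circle_mean_cmult)
    also have "\<dots> \<ge> 1 / s\<^sup>2 * (1 + h\<^sup>2 * s\<^sup>2)" using mean_v[OF s1] by (intro mult_left_mono) auto
    finally show "1 / s\<^sup>2 + h\<^sup>2 \<le> circle_mean (sqrt s) (\<lambda>z. (norm (deriv G z))\<^sup>2)"
      using s1 by (simp add: field_simps)
  qed (use calculation in \<open>auto intro: has_integral_integrable\<close>)
  ultimately have "(- 1 / (1/2) + h\<^sup>2 * (1/2)) - (- 1 / a + h\<^sup>2 * a) \<le> M\<^sup>2"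
    using area by (simp add: integral_unique)
  also have "M\<^sup>2 = 1 / a + 2 * (h + 1) + (h + 1)\<^sup>2 * a"
    using a by (simp add: M_def power_divide) (simp add: power2_eq_square field_simps)
  finally have "h\<^sup>2 / 2 \<le> 4 + 2 * h + a * (h\<^sup>2 + (h + 1)\<^sup>2)" by (simp add: algebra_simps)
  also have "a * (h\<^sup>2 + (h + 1)\<^sup>2) \<le> 1" using a by (simp add: C_def algebra_simps)
  finally have "h\<^sup>2 \<le> 10 + 4 * h" by simp
  \<comment> \<open>The left-hand side is at most 14, rounded up to 16; this is where the 6 comes
    from.\<close>
  then have "(h - 2)\<^sup>2 \<le> 4\<^sup>2" by (simp add: power2_eq_square algebra_simps)
  then have "h - 2 \<le> 4" by (rule power2_le_imp_le) simp
  then show ?thesis by (simp add: h_def)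
qed

text \<open>Bieberbach's square-root transform reduces the second coefficient to the area bound.\<close>

lemma norm_deriv2_le_of_inj_unit:
  assumes g: "g holomorphic_on ball 0 1" "inj_on g (ball 0 1)"
  shows "norm (deriv (deriv g) 0) \<le> 24 * norm (deriv g 0)"
proof -
  define c where "c = deriv g 0"
  define \<phi> where "\<phi> = (\<lambda>w. if w = 0 then deriv g 0 else (g w - g 0) / (w - 0))"
  have c: "c \<noteq> 0" unfolding c_def using g by (intro holomorphic_injective_imp_regular[of g "ball 0 1"]) auto
  have \<phi>: "\<phi> holomorphic_on ball 0 1" unfolding \<phi>_def by (intro pole_lemma_open g) simp
  have \<phi>g: "w * \<phi> w = g w - g 0" for w by (simp add: \<phi>_def)
  have \<phi>0: "\<phi> w / c \<noteq> 0" if "w \<in> ball 0 1" for w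
    using c g(2) that by (auto simp: \<phi>_def c_def inj_on_def)
  \<comment> \<open>\<open>\<phi>\<close> is the difference quotient of \<open>g\<close> at 0,
    without zeros by injectivity. Thus \<open>z * q (z^2)\<close> is an odd square root of
    \<open>(g (z^2) - g 0) / c\<close>, and \<open>u = 1 / q\<close> brings it to the form
    \<open>z / u (z^2)\<close>.\<close>
  obtain q where q: "q holomorphic_on ball 0 1" "\<And>w. w \<in> ball 0 1 \<Longrightarrow> \<phi> w / c = q w ^ 2"
  proof (rule contractible_imp_holomorphic_sqrt[of "\<lambda>w. \<phi> w / c" "ball 0 1"])
    show "(\<lambda>w. \<phi> w / c) holomorphic_on ball 0 1" using c by (intro holomorphic_intros \<phi>) auto
  qed (use \<phi>0 in \<open>auto intro: convex_imp_contractible\<close>)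
  have q0: "q w \<noteq> 0" if "norm w < 1" for w using q(2)[of w] \<phi>0[of w] that by auto
  have "(q 0)\<^sup>2 = 1" using q(2)[of 0] c by (simp add: \<phi>_def c_def)
  then have nq: "norm (q 0) = 1" by (auto simp: power2_eq_1_iff)
  define u where "u w = 1 / q w" for w
  have dq: "(q has_field_derivative deriv q 0) (at 0)"
    using q(1) by (auto intro: holomorphic_derivI)
  have "norm (deriv u 0) \<le> 6"
  proof (rule norm_deriv_le_of_inj_odd)
    show "u holomorphic_on ball 0 1" unfolding u_def using q0 by (intro holomorphic_intros q(1)) auto
    show "norm (u 0) = 1" using nq by (simp add: u_def norm_divide)
    show "u w \<noteq> 0" if "norm w < 1" for w using q0[OF that] by (simp add: u_def)
    show "inj_on (\<lambda>z. z / u (z\<^sup>2)) (ball 0 1)"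
    proof (rule inj_onI)
      fix x y :: complex assume xy: "x \<in> ball 0 1" "y \<in> ball 0 1" "x / u (x\<^sup>2) = y / u (y\<^sup>2)"
      have sq: "z\<^sup>2 \<in> ball 0 1" if "z \<in> ball 0 1" for z :: complex
        using that by (simp add: norm_power abs_square_less_1)
      have e: "x * q (x\<^sup>2) = y * q (y\<^sup>2)" using xy(3) by (simp add: u_def)
      have G: "(z * q (z\<^sup>2))\<^sup>2 = (g (z\<^sup>2) - g 0) / c" if "z \<in> ball 0 1" for z
        using q(2)[OF sq[OF that]] \<phi>g[of "z\<^sup>2"] by (simp add: power_mult_distrib)
           (metis times_divide_eq_right)
      have "g (x\<^sup>2) = g (y\<^sup>2)" using G[OF xy(1)] G[OF xy(2)] e c by simp
      then have "x\<^sup>2 = y\<^sup>2" using g(2) sq xy by (auto dest: inj_onD)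
      then have "x = y \<or> x = - y" by (simp add: power2_eq_iff)
      then show "x = y"
      proof
        \<comment> \<open>An odd function takes opposite values at \<open>x\<close> and
          \<open>- x\<close>; equal values must be 0, which forces \<open>y = 0\<close>.\<close>
        assume "x = - y"
        with e have "y * q (y\<^sup>2) = 0" by (simp add: minus_equation_iff eq_neg_iff_add_eq_0)
        moreover have "q (y\<^sup>2) \<noteq> 0" using q0 sq[OF xy(2)] by auto
        ultimately show "x = y" using \<open>x = - y\<close> by simp
      qed
    qed
  qed
  moreover have "deriv u 0 = - (deriv q 0 / (q 0)\<^sup>2)"
  proof (rule DERIV_imp_deriv)
    show "(u has_field_derivative - (deriv q 0 / (q 0)\<^sup>2)) (at 0)"
      unfolding u_def using dq q0[of 0] by (auto intro!: derivative_eq_intros simp: power2_eq_square)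
  qed
  ultimately have q6: "norm (deriv q 0) \<le> 6" using nq by (simp add: norm_divide norm_power)
  have d\<phi>: "(\<phi> has_field_derivative deriv \<phi> w) (at w)" if "norm w < 1" for w
    using \<phi> that by (auto intro: holomorphic_derivI)
  have "deriv \<phi> 0 = c * (2 * q 0 * deriv q 0)"
  proof -
    have "deriv \<phi> 0 = deriv (\<lambda>w. c * (q w)\<^sup>2) 0"
      by (rule deriv_cong_ev) (use q(2) c in \<open>auto simp: eventually_nhds field_simps intro!: exI[of _ "ball 0 1"]\<close>)
    also have "\<dots> = c * (2 * q 0 * deriv q 0)"
      by (rule DERIV_imp_deriv) (use dq in \<open>auto intro!: derivative_eq_intros\<close>)
    finally show ?thesis .
  qed
  then have "norm (deriv \<phi> 0) = 2 * norm c * norm (deriv q 0)" using nq by (simp add: norm_mult)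
  moreover have "deriv (deriv g) 0 = 2 * deriv \<phi> 0"
  proof -
    have dg: "deriv g w = \<phi> w + w * deriv \<phi> w" if "norm w < 1" for w
    proof (rule DERIV_imp_deriv)
      have "g = (\<lambda>w. g 0 + w * \<phi> w)" using \<phi>g by auto
      moreover have "((\<lambda>w. g 0 + w * \<phi> w) has_field_derivative \<phi> w + w * deriv \<phi> w) (at w)"
        using d\<phi>[OF that] by (auto intro!: derivative_eq_intros)
      ultimately show "(g has_field_derivative \<phi> w + w * deriv \<phi> w) (at w)" by simp
    qed
    have "deriv (deriv g) 0 = deriv (\<lambda>w. \<phi> w + w * deriv \<phi> w) 0"
      by (rule deriv_cong_ev) (use dg in \<open>auto simp: eventually_nhds intro!: exI[of _ "ball 0 1"]\<close>)
    also have "\<dots> = 2 * deriv \<phi> 0"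
    proof (rule DERIV_imp_deriv)
      have "deriv \<phi> holomorphic_on ball 0 1" using \<phi> by (intro holomorphic_deriv) auto
      then have "(deriv \<phi> has_field_derivative deriv (deriv \<phi>) 0) (at 0)" by (auto intro: holomorphic_derivI)
      then show "((\<lambda>w. \<phi> w + w * deriv \<phi> w) has_field_derivative 2 * deriv \<phi> 0) (at 0)"
        using d\<phi>[of 0] by (auto intro!: derivative_eq_intros)
    qed
    finally show ?thesis .
  qed
  \<comment> \<open>\<open>g'' 0 = 2 \<phi>' 0\<close> and \<open>\<phi>' 0 = 2 c q(0) q'(0)\<close>
    with \<open>|q 0| = 1\<close> give the factor 4, and the bound 6 for \<open>q'\<close> makes it
    24.\<close>
  ultimately have "norm (deriv (deriv g) 0) = 4 * norm c * norm (deriv q 0)" by (simp add: norm_mult)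
  also have "\<dots> \<le> 4 * norm c * 6" using q6 by (intro mult_left_mono) auto
  finally show ?thesis by (simp add: c_def)
qed

section \<open>The coefficient bound at any centre and estimates of Koebe type\<close>

lemma norm_deriv2_le_of_inj:
  assumes f: "f holomorphic_on ball z r" "inj_on f (ball z r)" and r: "0 < r"
  shows "r * norm (deriv (deriv f) z) \<le> 24 * norm (deriv f z)"
proof -
  define g where "g w = f (of_real r * w + z)" for w
  have mem: "of_real r * w + z \<in> ball z r" if "w \<in> ball 0 1" for w
    using that r by (auto simp: dist_norm norm_mult)
  have "(deriv ^^ n) g 0 = of_real r ^ n * (deriv ^^ n) f z" for n
    unfolding g_def using higher_deriv_compose_linear'[OF f(1) open_ball[of 0 1] open_ball _ mem, of 0 n] by simp
  from this[of 1] this[of 2]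
  have d: "deriv g 0 = of_real r * deriv f z" "deriv (deriv g) 0 = of_real r ^ 2 * deriv (deriv f) z"
    by (simp_all add: numeral_2_eq_2)
  have "g holomorphic_on ball 0 1"
    unfolding g_def using mem
    by (intro holomorphic_on_compose_gen[unfolded o_def, OF _ f(1)] holomorphic_intros) auto
  moreover have "inj_on g (ball 0 1)"
    using f(2) mem r unfolding g_def inj_on_def by (metis add_right_cancel mult_cancel_left of_real_eq_0_iff less_irrefl)
  ultimately have "norm (deriv (deriv g) 0) \<le> 24 * norm (deriv g 0)"
    by (rule norm_deriv2_le_of_inj_unit)
  then have "r * (r * norm (deriv (deriv f) z)) \<le> r * (24 * norm (deriv f z))"
    using r by (simp add: d norm_mult norm_power power2_eq_square mult_ac)
  then show ?thesis using r by (simp only: mult_le_cancel_left_pos)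
qed

text \<open>The coefficient bound is applied to \<open>f\<close> and to
  \<open>F = 1 / (\<omega> - f)\<close>, which is univalent too. With
  \<open>d = \<omega> - f z\<close>, the second derivative of \<open>F\<close> contains
  \<open>2 f'^2 / d^3\<close>; solving for this term leaves
  \<open>2 r |f'| \<le> 48 |d|\<close>.\<close>

lemma weak_Koebe_quarter:
  assumes f: "f holomorphic_on ball z r" "inj_on f (ball z r)" and r: "0 < r" and \<omega>: "\<omega> \<notin> f ` ball z r"
  shows "r * norm (deriv f z) \<le> 24 * norm (\<omega> - f z)"
proof -
  define F where "F w = 1 / (\<omega> - f w)" for w
  have nz: "\<omega> - f w \<noteq> 0" if "w \<in> ball z r" for w using \<omega> that by auto
  have df: "(f has_field_derivative deriv f w) (at w)" if "w \<in> ball z r" for w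
    using f(1) that by (auto intro: holomorphic_derivI)
  have z: "z \<in> ball z r" using r by simp
  define d where "d = \<omega> - f z"
  have d: "d \<noteq> 0" using nz[OF z] by (simp add: d_def)
  have f0: "deriv f z \<noteq> 0" using f z by (intro holomorphic_injective_imp_regular[of f "ball z r"]) auto
  have dF: "deriv F w = deriv f w / (\<omega> - f w)\<^sup>2" if "w \<in> ball z r" for w
    unfolding F_def using df[OF that] nz[OF that]
    by (intro DERIV_imp_deriv) (auto intro!: derivative_eq_intros simp: power2_eq_square)
  have "deriv (deriv F) z = deriv (\<lambda>w. deriv f w / (\<omega> - f w)\<^sup>2) z"
    by (rule deriv_cong_ev) (use dF z in \<open>auto simp: eventually_nhds intro!: exI[of _ "ball z r"]\<close>)
  also have "\<dots> = deriv (deriv f) z / d\<^sup>2 + 2 * (deriv f z)\<^sup>2 / d ^ 3"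
  proof (rule DERIV_imp_deriv)
    have "deriv f holomorphic_on ball z r" using f(1) by (intro holomorphic_deriv) auto
    then have d2: "(deriv f has_field_derivative deriv (deriv f) z) (at z)"
      using z by (auto intro: holomorphic_derivI)
    have sq: "((\<lambda>w. (\<omega> - f w)\<^sup>2) has_field_derivative - (2 * (\<omega> - f z) * deriv f z)) (at z)"
      using df[OF z] by (auto intro!: derivative_eq_intros)
    have "((\<lambda>w. deriv f w / (\<omega> - f w)\<^sup>2) has_field_derivative
       (deriv (deriv f) z * d\<^sup>2 - deriv f z * (- (2 * d * deriv f z))) / (d\<^sup>2 * d\<^sup>2)) (at z)"
      unfolding d_def by (rule DERIV_divide[OF d2 sq]) (use nz[OF z] in simp)
    moreover have "(deriv (deriv f) z * d\<^sup>2 - deriv f z * (- (2 * d * deriv f z))) / (d\<^sup>2 * d\<^sup>2)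
      = deriv (deriv f) z / d\<^sup>2 + 2 * (deriv f z)\<^sup>2 / d ^ 3"
      using d by (simp add: add_divide_distrib power2_eq_square power3_eq_cube mult_ac)
    ultimately show "((\<lambda>w. deriv f w / (\<omega> - f w)\<^sup>2) has_field_derivative deriv (deriv f) z / d\<^sup>2 + 2 * (deriv f z)\<^sup>2 / d ^ 3) (at z)"
      by simp
  qed
  finally have d2F: "deriv (deriv F) z = deriv (deriv f) z / d\<^sup>2 + 2 * (deriv f z)\<^sup>2 / d ^ 3" .
  have "r * norm (deriv (deriv F) z) \<le> 24 * norm (deriv F z)"
  proof (rule norm_deriv2_le_of_inj[OF _ _ r])
    show "F holomorphic_on ball z r" unfolding F_def using nz by (intro holomorphic_intros f(1)) auto
    show "inj_on F (ball z r)" using f(2) by (auto simp: F_def inj_on_def)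
  qed
  then have F: "r * norm (deriv (deriv f) z / d\<^sup>2 + 2 * (deriv f z)\<^sup>2 / d ^ 3) \<le> 24 * (norm (deriv f z) / norm d ^ 2)"
    unfolding d2F dF[OF z] d_def[symmetric] by (simp add: norm_divide norm_power)
  have "2 * (r * norm (deriv f z)) * (norm (deriv f z) / norm d ^ 3) = r * norm (2 * (deriv f z)\<^sup>2 / d ^ 3)"
    by (simp add: norm_divide norm_mult norm_power power2_eq_square)
  also have "\<dots> \<le> r * (norm (deriv (deriv f) z / d\<^sup>2 + 2 * (deriv f z)\<^sup>2 / d ^ 3) + norm (deriv (deriv f) z / d\<^sup>2))"
    using r norm_triangle_ineq4[of "deriv (deriv f) z / d\<^sup>2 + 2 * (deriv f z)\<^sup>2 / d ^ 3" "deriv (deriv f) z / d\<^sup>2"]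
    by (intro mult_left_mono) auto
  also have "\<dots> \<le> 24 * (norm (deriv f z) / norm d ^ 2) + (r * norm (deriv (deriv f) z)) / norm d ^ 2"
    using F by (simp add: distrib_left norm_divide norm_power)
  also have "\<dots> \<le> 24 * (norm (deriv f z) / norm d ^ 2) + (24 * norm (deriv f z)) / norm d ^ 2"
    by (intro add_left_mono divide_right_mono norm_deriv2_le_of_inj[OF f r]) simp
  also have "\<dots> = (48 * norm d) * (norm (deriv f z) / norm d ^ 3)"
    using d by (simp add: power2_eq_square power3_eq_cube)
  finally have "2 * (r * norm (deriv f z)) \<le> 48 * norm d"
    by (rule mult_right_le_imp_le) (use f0 d in simp)
  then show ?thesis by (simp add: d_def)
qed

text \<open>The coefficient bound at \<open>w\<close> says that the derivative of log f' is at most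
  \<open>24 / (1 - |w|)\<close>. Integrating this along the radius gives the power 24.\<close>

lemma weak_Koebe_distortion:
  assumes f: "f holomorphic_on ball 0 1" "inj_on f (ball 0 1)" and z: "norm z < 1"
  shows "norm (deriv f 0) * (1 - norm z) ^ 24 \<le> norm (deriv f z)"
proof -
  have f': "deriv f holomorphic_on ball 0 1" using f(1) by (intro holomorphic_deriv) auto
  have nz: "deriv f w \<noteq> 0" if "w \<in> ball 0 1" for w
    using f that by (intro holomorphic_injective_imp_regular[of f "ball 0 1"]) auto
  obtain L where L: "L holomorphic_on ball 0 1" "\<And>w. w \<in> ball 0 1 \<Longrightarrow> deriv f w = exp (L w)"
    using contractible_imp_holomorphic_log[OF f' convex_imp_contractible nz] by auto
  have dL: "(L has_field_derivative deriv L w) (at w)" if "norm w < 1" for w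
    using L(1) that by (auto intro: holomorphic_derivI)
  have L': "norm (deriv L w) \<le> 24 / (1 - norm w)" if w: "norm w < 1" for w
  proof -
    have sub: "ball w (1 - norm w) \<subseteq> ball 0 1"
    proof
      fix x assume "x \<in> ball w (1 - norm w)"
      then have "norm (x - w) < 1 - norm w" by (simp add: dist_norm norm_minus_commute)
      then show "x \<in> ball 0 1" using norm_triangle_ineq[of "x - w" w] by simp
    qed
    have "deriv (deriv f) w = deriv (\<lambda>w. exp (L w)) w"
      by (rule deriv_cong_ev) (use L(2) w in \<open>auto simp: eventually_nhds intro!: exI[of _ "ball 0 1"]\<close>)
    also have "\<dots> = deriv f w * deriv L w"
      by (rule DERIV_imp_deriv) (use dL[OF w] L(2)[of w] w in \<open>auto intro!: derivative_eq_intros\<close>)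
    finally have e: "deriv (deriv f) w = deriv f w * deriv L w" .
    have "(1 - norm w) * norm (deriv (deriv f) w) \<le> 24 * norm (deriv f w)"
      by (rule norm_deriv2_le_of_inj) (use sub f w in \<open>auto intro: holomorphic_on_subset inj_on_subset\<close>)
    then have "norm (deriv f w) * ((1 - norm w) * norm (deriv L w)) \<le> norm (deriv f w) * 24"
      by (simp add: e norm_mult mult_ac)
    then have "(1 - norm w) * norm (deriv L w) \<le> 24"
      using nz[of w] w by simp
    then show ?thesis using w by (simp add: field_simps)
  qed
  \<comment> \<open>Monotonicity of \<open>\<psi>\<close> replaces the radial integration: its
    derivative is nonnegative exactly by the bound on \<open>deriv L\<close>.\<close>
  define \<psi> where "\<psi> t = Re (L (of_real t * z)) - 24 * ln (1 - t * norm z)" for t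
  have tz: "t * norm z < 1" "norm (of_real t * z) = t * norm z" if "0 \<le> t" "t \<le> 1" for t
    using that z mult_left_le_one_le[of "norm z" t] by (auto simp: norm_mult)
  have "\<psi> 0 \<le> \<psi> 1"
  proof (rule DERIV_nonneg_imp_nondecreasing[OF zero_le_one])
    fix t :: real assume t: "0 \<le> t" "t \<le> 1"
    have "((\<lambda>t. L (of_real t * z)) has_vector_derivative (z * deriv L (of_real t * z))) (at t)"
      by (rule field_vector_diff_chain_at[unfolded o_def, OF _ dL])
         (use tz[OF t] in \<open>auto intro!: derivative_eq_intros has_vector_derivative_real_field\<close>)
    then have "((\<lambda>t. Re (L (of_real t * z))) has_real_derivative Re (z * deriv L (of_real t * z))) (at t)"
      using bounded_linear.has_vector_derivative[OF bounded_linear_Re]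
      by (auto simp: has_real_derivative_iff_has_vector_derivative simp del: times_complex.sel)
    moreover have "((\<lambda>t. 24 * ln (1 - t * norm z)) has_real_derivative - (24 * norm z / (1 - t * norm z))) (at t)"
      using tz(1)[OF t] by (auto intro!: derivative_eq_intros)
    ultimately have "(\<psi> has_real_derivative Re (z * deriv L (of_real t * z)) - - (24 * norm z / (1 - t * norm z))) (at t)"
      unfolding \<psi>_def by (rule DERIV_diff)
    then have "(\<psi> has_real_derivative Re (z * deriv L (of_real t * z)) + 24 * norm z / (1 - t * norm z)) (at t)"
      by (simp only: diff_minus_eq_add)
    moreover have "0 \<le> Re (z * deriv L (of_real t * z)) + 24 * norm z / (1 - t * norm z)"
    proof -
      have "\<bar>Re (z * deriv L (of_real t * z))\<bar> \<le> norm z * norm (deriv L (of_real t * z))"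
        using abs_Re_le_cmod[of "z * deriv L (of_real t * z)"] by (simp add: norm_mult del: times_complex.sel)
      also have "\<dots> \<le> norm z * (24 / (1 - t * norm z))"
        using L'[of "of_real t * z"] tz[OF t] by (intro mult_left_mono) auto
      finally show ?thesis by (simp add: mult.commute del: times_complex.sel)
    qed
    ultimately show "\<exists>y. (\<psi> has_real_derivative y) (at t) \<and> 0 \<le> y" by blast
  qed
  then have "Re (L 0) + 24 * ln (1 - norm z) \<le> Re (L z)" by (simp add: \<psi>_def)
  then have "exp (Re (L 0)) * exp (24 * ln (1 - norm z)) \<le> exp (Re (L z))"
    by (simp add: exp_add[symmetric])
  moreover have "exp (24 * ln (1 - norm z)) = (1 - norm z) ^ 24"
    using z exp_of_nat_mult[of 24 "ln (1 - norm z)"] by simp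
  ultimately show ?thesis using L(2)[of 0] L(2)[of z] z by simp
qed

text \<open>A disc around \<open>z\<close> that avoids \<open>w\<close> has an image omitting
  \<open>f w\<close>, so the weak Koebe theorem bounds \<open>|f w - f z|\<close> below. The
  distortion bound gives \<open>(1 - r) ^ 24\<close>, the radius \<open>\<rho>\<close> one more
  factor \<open>1 - r\<close>, and 48 is 24 times the 2 in \<open>\<rho>\<close>.\<close>

lemma inj_quantitative:
  assumes f: "f holomorphic_on ball 0 1" "inj_on f (ball 0 1)" and r: "r < 1" and zw: "norm z \<le> r" "norm w \<le> r"
  shows "norm (deriv f 0) * (1 - r) ^ 25 / 48 * norm (w - z) \<le> norm (f w - f z)"
proof (cases "w = z")
  case False
  \<comment> \<open>Since \<open>1 - r \<le> 1\<close> and \<open>|w - z| \<le> 2\<close>, this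
    radius is at most \<open>|w - z|\<close>, which excludes \<open>w\<close>, and at most
    \<open>1 - r\<close>, which keeps the disc inside the unit disc.\<close>
  define \<rho> where "\<rho> = (1 - r) * norm (w - z) / 2"
  have r0: "0 \<le> r" using zw(1) norm_ge_zero[of z] by linarith
  have "norm (w - z) \<le> 2 * r" using norm_triangle_ineq4[of w z] zw by linarith
  then have n2: "norm (w - z) \<le> 2" using r by linarith
  have \<rho>: "0 < \<rho>" "\<rho> \<le> norm (w - z)" "\<rho> \<le> 1 - r"
  proof -
    show "0 < \<rho>" using r False by (simp add: \<rho>_def)
    have "(1 - r) * norm (w - z) \<le> 1 * norm (w - z)" using r0 by (intro mult_right_mono) auto
    then show "\<rho> \<le> norm (w - z)" using norm_ge_zero[of "w - z"] unfolding \<rho>_def by linarith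
    have "(1 - r) * norm (w - z) \<le> (1 - r) * 2" using r n2 by (intro mult_left_mono) auto
    then show "\<rho> \<le> 1 - r" by (simp add: \<rho>_def)
  qed
  have sub: "ball z \<rho> \<subseteq> ball 0 1"
  proof
    fix x assume "x \<in> ball z \<rho>"
    then have "norm (x - z) < 1 - r" using \<rho> by (simp add: dist_norm norm_minus_commute)
    then show "x \<in> ball 0 1" using norm_triangle_ineq[of "x - z" z] zw by simp
  qed
  have "f w \<notin> f ` ball z \<rho>"
  proof
    assume "f w \<in> f ` ball z \<rho>"
    then obtain x where x: "x \<in> ball z \<rho>" "f w = f x" by auto
    then have "w = x" using f(2) sub zw r by (auto dest!: inj_onD)
    with x \<rho> show False by (simp add: dist_norm norm_minus_commute)
  qed
  then have "\<rho> * norm (deriv f z) \<le> 24 * norm (f w - f z)"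
    by (intro weak_Koebe_quarter) (use f sub \<rho> in \<open>auto intro: holomorphic_on_subset inj_on_subset\<close>)
  moreover have "norm (deriv f 0) * (1 - r) ^ 24 \<le> norm (deriv f z)"
  proof -
    have "norm (deriv f 0) * (1 - r) ^ 24 \<le> norm (deriv f 0) * (1 - norm z) ^ 24"
      using zw r by (intro mult_left_mono power_mono) auto
    also have "\<dots> \<le> norm (deriv f z)" by (rule weak_Koebe_distortion[OF f]) (use zw r in auto)
    finally show ?thesis .
  qed
  then have "\<rho> * (norm (deriv f 0) * (1 - r) ^ 24) \<le> \<rho> * norm (deriv f z)"
    using \<rho> by (intro mult_left_mono) auto
  ultimately have "\<rho> * (norm (deriv f 0) * (1 - r) ^ 24) \<le> 24 * norm (f w - f z)" by linarith
  moreover have "\<rho> * (norm (deriv f 0) * (1 - r) ^ 24) = 24 * (norm (deriv f 0) * (1 - r) ^ 25 / 48 * norm (w - z))"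
    by (simp add: \<rho>_def power_Suc[of "1 - r" 24, simplified])
  ultimately show ?thesis by linarith
qed simp

section \<open>Univalent Taylor sections\<close>

text \<open>Each of the \<open>k\<close> copies of \<open>t ^ k\<close> is at most the term
  \<open>t ^ j\<close> of a geometric sum.\<close>

lemma of_nat_mult_power_le:
  fixes t :: real
  assumes "0 \<le> t" "t < 1"
  shows "real k * t ^ k \<le> 1 / (1 - t)"
proof -
  have "real k * t ^ k = (\<Sum>j<k. t ^ k)" by simp
  also have "\<dots> \<le> (\<Sum>j<k. t ^ j)" by (rule sum_mono) (use assms in \<open>auto intro: power_decreasing\<close>)
  also have "\<dots> = (1 - t ^ k) / (1 - t)" using assms by (subst sum_gp_strict) auto
  also have "\<dots> \<le> 1 / (1 - t)" using assms by (intro divide_right_mono) auto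
  finally show ?thesis .
qed

text \<open>Cauchy's estimate on the circle of radius \<open>sqrt r\<close> makes the Taylor coefficients of
  \<open>f (r z)\<close> decay like \<open>(sqrt r) ^ k\<close>; half of this decay absorbs the factor \<open>k\<close> of the derivative.\<close>

lemma deriv_Taylor_section_error:
  fixes f :: "complex \<Rightarrow> complex" and n :: nat
  assumes f: "f holomorphic_on ball 0 1" "\<And>z. norm z < 1 \<Longrightarrow> norm (f z) \<le> M" and r: "0 < r" "r < 1"
  defines "t \<equiv> sqrt (sqrt r)"
  defines "p \<equiv> \<Sum>k\<le>n. monom ((deriv ^^ k) f 0 / fact k * of_real r ^ k) k"
  assumes z: "norm z \<le> 1"
  shows "norm (of_real r * deriv f (of_real r * z) - poly (pderiv p) z) \<le> M * t ^ (n + 1) / (1 - t)\<^sup>2"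
proof -
  have t: "0 < t" "t < 1" using r by (auto simp: t_def)
  have t2: "t\<^sup>2 = sqrt r" using r by (simp add: t_def)
  have M: "0 \<le> M" using order_trans[OF norm_ge_zero f(2)[of 0]] by simp
  define c where "c k = (deriv ^^ k) f 0 / fact k * of_real r ^ k" for k
  have c_le: "norm (c k) \<le> M * t ^ k * t ^ k" for k
  proof -
    have s1: "0 < sqrt r" "sqrt r < 1" using r by auto
    have cb: "cball 0 (sqrt r) \<subseteq> ball (0::complex) 1" using r by (simp add: cball_subset_ball_iff)
    have "norm ((deriv ^^ k) f 0) \<le> fact k * M / sqrt r ^ k"
    proof (rule Cauchy_inequality[where r = "sqrt r"])
      show "continuous_on (cball 0 (sqrt r)) f"
        using cb f(1) holomorphic_on_imp_continuous_on continuous_on_subset by blast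
      show "f holomorphic_on ball 0 (sqrt r)"
        using cb f(1) ball_subset_cball holomorphic_on_subset by (metis subset_trans)
      show "norm (f x) \<le> M" if "norm (0 - x) = sqrt r" for x
        using f(2)[of x] that s1 by simp
    qed (use s1 in auto)
    then have "norm (c k) \<le> M / sqrt r ^ k * r ^ k"
      unfolding c_def using r
      by (simp add: norm_mult norm_divide norm_power) (simp add: field_simps)
    also have "r ^ k = sqrt r ^ k * sqrt r ^ k" using r by (simp add: power_mult_distrib[symmetric])
    also have "M / sqrt r ^ k * (sqrt r ^ k * sqrt r ^ k) = M * sqrt r ^ k" using s1 by simp
    also have "sqrt r ^ k = t ^ k * t ^ k" by (simp add: t2[symmetric] power2_eq_square power_mult_distrib)
    finally show ?thesis by (simp add: mult.assoc)
  qed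
  define g where "g k = of_nat (Suc k) * c (Suc k) * z ^ k" for k
  \<comment> \<open>One of the two factors \<open>t ^ Suc k\<close> is spent on
    \<open>Suc k\<close>, at the price \<open>1 / (1 - t)\<close>; the other stays for the geometric
    tail, which costs a second \<open>1 / (1 - t)\<close>.\<close>
  have g_le: "norm (g k) \<le> M / (1 - t) * t ^ Suc k" for k
  proof -
    have "norm (g k) \<le> real (Suc k) * norm (c (Suc k)) * 1"
      unfolding g_def norm_mult norm_power norm_of_nat
      by (intro mult_left_mono power_le_one) (use z in auto)
    also have "\<dots> \<le> real (Suc k) * (M * t ^ Suc k * t ^ Suc k)"
      using c_le[of "Suc k"] by simp
    also have "\<dots> = (real (Suc k) * t ^ Suc k) * (M * t ^ Suc k)" by simp
    also have "\<dots> \<le> 1 / (1 - t) * (M * t ^ Suc k)"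
      by (intro mult_right_mono of_nat_mult_power_le) (use t M in auto)
    finally show ?thesis by simp
  qed
  have "(\<lambda>k. (deriv ^^ k) (deriv f) 0 / fact k * (of_real r * z - 0) ^ k) sums deriv f (of_real r * z)"
  proof (rule holomorphic_power_series)
    show "deriv f holomorphic_on ball 0 1" using f(1) by (intro holomorphic_deriv) auto
    have "r * norm z < 1" using mult_left_mono[OF z, of r] r by linarith
    then show "of_real r * z \<in> ball 0 1" using r by (simp add: norm_mult)
  qed
  then have "(\<lambda>k. of_real r * ((deriv ^^ k) (deriv f) 0 / fact k * (of_real r * z - 0) ^ k)) sums (of_real r * deriv f (of_real r * z))"
    by (rule sums_mult)
  moreover have "of_real r * ((deriv ^^ k) (deriv f) 0 / fact k * (of_real r * z - 0) ^ k) = g k" for k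
    unfolding g_def c_def
    by (simp add: power_mult_distrib fact_Suc field_simps del: of_nat_Suc) (simp add: funpow_swap1)
  ultimately have gs: "g sums (of_real r * deriv f (of_real r * z))" by simp
  have pp: "poly (pderiv p) z = (\<Sum>k<n. g k)"
  proof -
    have "pderiv p = (\<Sum>k\<le>n. monom (of_nat k * c k) (k - 1))"
    proof -
      have "pderiv (sum q A) = (\<Sum>k\<in>A. pderiv (q k))" for q :: "nat \<Rightarrow> complex poly" and A
        by (induction A rule: infinite_finite_induct) (auto simp: pderiv_add)
      then show ?thesis by (simp add: p_def c_def pderiv_monom)
    qed
    then have "poly (pderiv p) z = (\<Sum>k\<le>n. of_nat k * c k * z ^ (k - 1))"
      by (simp add: poly_sum poly_monom)
    also have "\<dots> = (\<Sum>k<n. g k)"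
      unfolding lessThan_Suc_atMost[symmetric] sum.lessThan_Suc_shift by (simp add: g_def)
    finally show ?thesis .
  qed
  have "(\<lambda>k. g (k + n)) sums (of_real r * deriv f (of_real r * z) - poly (pderiv p) z)"
    unfolding pp by (rule sums_split_initial_segment[OF gs])
  then have "of_real r * deriv f (of_real r * z) - poly (pderiv p) z = (\<Sum>k. g (k + n))"
    by (simp add: sums_iff)
  also have "norm \<dots> \<le> (\<Sum>k. M / (1 - t) * t ^ Suc n * t ^ k)"
  proof (rule norm_suminf_le)
    show "norm (g (k + n)) \<le> M / (1 - t) * t ^ Suc n * t ^ k" for k
      using g_le[of "k + n"] by (simp add: power_add mult_ac)
    show "summable (\<lambda>k. M / (1 - t) * t ^ Suc n * t ^ k)"
      by (intro summable_mult summable_geometric) (use t in auto)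
  qed
  also have "\<dots> = M / (1 - t) * t ^ Suc n * (1 / (1 - t))"
    using t by (subst suminf_mult) (auto intro!: summable_geometric simp: suminf_geometric)
  finally show ?thesis by (simp add: power2_eq_square)
qed

text \<open>The second condition puts \<open>E\<close> below the lower Lipschitz constant of
  \<open>f (r z)\<close> from \<open>inj_quantitative\<close>, so two points with equal values of
  \<open>p\<close> would contradict the Lipschitz bound of the error. The first condition keeps
  \<open>|p|\<close> below \<open>M + 1\<close> on the circle and costs at most 1 in the mean of the
  derivative.\<close>

lemma univalent_polynomial_approximation:
  fixes n :: nat
  assumes f: "univalent_on f (ball 0 1)" "\<And>z. norm z < 1 \<Longrightarrow> norm (f z) \<le> M" and r: "0 < r" "r < 1"
  defines "t \<equiv> sqrt (sqrt r)"
  defines "E \<equiv> M * t ^ (n + 1) / (1 - t)\<^sup>2"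
  assumes E: "E \<le> 1" "E < r * (norm (deriv f 0) * (1 - r) ^ 25 / 48)"
  obtains R where "R \<in> univalent_rational_funs n" "sup_norm (sphere 0 1) R \<le> 1"
    "(r * circle_mean r (\<lambda>z. norm (deriv f z)) - 1) / (M + 1) \<le> boundary_length R"
proof -
  have fh: "f holomorphic_on ball 0 1" and inj: "inj_on f (ball 0 1)"
    using f(1) by (auto simp: univalent_on_def)
  define p where "p = (\<Sum>k\<le>n. monom ((deriv ^^ k) f 0 / fact k * of_real r ^ k) k)"
  define e where "e z = f (of_real r * z) - poly p z" for z
  define e' where "e' z = of_real r * deriv f (of_real r * z) - poly (pderiv p) z" for z
  have e'_le: "norm (e' z) \<le> E" if "norm z \<le> 1" for z
    unfolding e'_def E_def t_def p_def by (rule deriv_Taylor_section_error[OF fh f(2) r that])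
  have M: "0 \<le> M" using order_trans[OF norm_ge_zero f(2)[of 0]] by simp
  have rz: "norm (of_real r * z) \<le> r" if "norm z \<le> 1" for z :: complex
    using that r mult_left_mono[of "norm z" 1 r] by (simp add: norm_mult)
  have rz1: "norm (of_real r * z) < 1" if "norm z \<le> 1" for z :: complex
    using rz[OF that] r by simp
  have de: "(e has_field_derivative e' z) (at z within cball 0 1)" if "norm z \<le> 1" for z
  proof -
    have "(f has_field_derivative deriv f (of_real r * z)) (at (of_real r * z))"
      using fh rz1[OF that] by (auto intro: holomorphic_derivI)
    then have "((\<lambda>z. f (of_real r * z)) has_field_derivative deriv f (of_real r * z) * of_real r) (at z within cball 0 1)"
      by (rule DERIV_chain2[where g = "\<lambda>z. of_real r * z"]) (auto intro!: derivative_eq_intros)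
    moreover have "(poly p has_field_derivative poly (pderiv p) z) (at z within cball 0 1)"
      by (rule DERIV_subset[OF poly_DERIV]) simp
    ultimately show ?thesis
      unfolding e_def[abs_def] e'_def by (auto intro!: derivative_eq_intros)
  qed
  \<comment> \<open>The disc is convex, so the bound on the derivative of the error is a Lipschitz
    constant; with \<open>e 0 = 0\<close> it also bounds the error itself.\<close>
  have e_lip: "norm (e z - e w) \<le> E * norm (z - w)" if "norm z \<le> 1" "norm w \<le> 1" for z w
    by (rule field_differentiable_bound[of "cball 0 1" e e']) (use de e'_le that in auto)
  have "poly p 0 = f 0"
  proof -
    have "poly p 0 = (\<Sum>k\<le>n. (deriv ^^ k) f 0 / fact k * of_real r ^ k * 0 ^ k)"
      by (simp add: p_def poly_sum poly_monom)
    also have "\<dots> = (\<Sum>k\<in>{0}. (deriv ^^ k) f 0 / fact k * of_real r ^ k * 0 ^ k)"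
      by (rule sum.mono_neutral_right) (auto simp: zero_power)
    finally show ?thesis by simp
  qed
  then have e0: "e 0 = 0" by (simp add: e_def)
  have p_le: "norm (poly p z) \<le> M + 1" if "norm z = 1" for z
  proof -
    have "norm (e z) \<le> 1" using e_lip[of z 0] that e0 E(1) by simp
    moreover have "poly p z = f (of_real r * z) - e z" by (simp add: e_def)
    moreover have "norm (f (of_real r * z)) \<le> M" using f(2) rz1[of z] that by simp
    ultimately show ?thesis using norm_triangle_ineq4[of "f (of_real r * z)" "e z"] by simp
  qed
  have p_inj: "inj_on (poly p) (ball 0 1)"
  proof (rule inj_onI, rule ccontr)
    fix z w assume zw: "z \<in> ball 0 1" "w \<in> ball 0 1" "poly p z = poly p w" "z \<noteq> w"
    have "norm (deriv f 0) * (1 - r) ^ 25 / 48 * norm (of_real r * z - of_real r * w) \<le> norm (f (of_real r * z) - f (of_real r * w))"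
      by (rule inj_quantitative[OF fh inj r(2)]) (use rz zw in auto)
    also have "f (of_real r * z) - f (of_real r * w) = e z - e w" using zw by (simp add: e_def)
    also have "norm \<dots> \<le> E * norm (z - w)" by (rule e_lip) (use zw in auto)
    also have "norm (of_real r * z - of_real r * w) = r * norm (z - w)"
      using r by (simp add: right_diff_distrib[symmetric] norm_mult)
    finally have "(r * (norm (deriv f 0) * (1 - r) ^ 25 / 48)) * norm (z - w) \<le> E * norm (z - w)" by (simp add: mult_ac)
    then show False using E(2) zw by simp
  qed
  have M1: "0 < M + 1" using M by simp
  define q where "q = 1 / (M + 1)"
  have q: "0 < q" "q * (M + 1) = 1" using M1 by (auto simp: q_def)
  define R where "R z = poly (smult (of_real q) p) z / poly 1 z" for z
  have R: "R z = of_real q * poly p z" for z by (simp add: R_def)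
  have Rh: "R holomorphic_on UNIV" unfolding R by (intro holomorphic_intros)
  have deg: "degree p \<le> n"
    unfolding p_def by (rule degree_sum_le) (auto intro: order.trans[OF degree_monom_le])
  have "R \<in> rational_funs n"
    unfolding rational_funs_def R_def[abs_def] using deg
    by (intro CollectI exI[of _ "smult (of_real q) p"] exI[of _ 1])
       (auto intro: order.trans[OF degree_smult_le])
  moreover have "\<not> is_pole R z" for z
    by (rule not_is_pole_holomorphic[of UNIV]) (use Rh in auto)
  moreover have "univalent_on R (ball 0 1)"
  proof -
    have "inj_on R (ball 0 1)" using p_inj q by (simp add: inj_on_def R)
    then show ?thesis using Rh by (auto simp: univalent_on_def intro: holomorphic_on_subset)
  qed
  ultimately have 1: "R \<in> univalent_rational_funs n" by (simp add: univalent_rational_funs_def)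
  have 2: "sup_norm (sphere 0 1) R \<le> 1"
    unfolding sup_norm_def
  proof (rule SUP_least)
    fix z :: complex assume "z \<in> sphere 0 1"
    then have "norm (R z) \<le> 1" using mult_left_mono[OF p_le[of z], of q] q by (simp add: R norm_mult)
    then show "ereal (norm (R z)) \<le> 1" by (simp add: one_ereal_def)
  qed
  have dR: "deriv R z = of_real q * poly (pderiv p) z" for z
    unfolding R[abs_def] by (rule DERIV_imp_deriv) (auto intro!: derivative_eq_intros poly_DERIV)
  have f'c: "continuous_on (ball 0 1) (deriv f)"
    using fh by (intro holomorphic_on_imp_continuous_on holomorphic_deriv) auto
  have c1: "continuous_on (sphere 0 1) (\<lambda>z. r * norm (deriv f (of_real r * z)))"
    by (intro continuous_intros continuous_on_compose2[OF f'c]) (use rz1 in auto)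
  have c2: "continuous_on (sphere 0 1) (\<lambda>z. norm (poly (pderiv p) z))" by (intro continuous_intros)
  have "r * circle_mean r (\<lambda>z. norm (deriv f z)) = circle_mean 1 (\<lambda>z. r * norm (deriv f (of_real r * z)))"
    by (subst circle_mean_eq_unit) (simp add: circle_mean_cmult)
  also have "\<dots> \<le> circle_mean 1 (\<lambda>z. norm (poly (pderiv p) z) + 1)"
  proof (rule circle_mean_mono[OF c1])
    fix z :: complex assume z: "norm z = 1"
    have "r * norm (deriv f (of_real r * z)) = norm (e' z + poly (pderiv p) z)"
      using r by (simp add: e'_def norm_mult)
    then show "r * norm (deriv f (of_real r * z)) \<le> norm (poly (pderiv p) z) + 1"
      using norm_triangle_ineq[of "e' z" "poly (pderiv p) z"] e'_le[of z] z E(1) by simp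
  qed (auto intro!: continuous_intros)
  also have "\<dots> = circle_mean 1 (\<lambda>z. norm (poly (pderiv p) z)) + 1"
    by (subst circle_mean_add[OF c2]) auto
  finally have "r * circle_mean r (\<lambda>z. norm (deriv f z)) - 1 \<le> circle_mean 1 (\<lambda>z. norm (poly (pderiv p) z))" by simp
  moreover have "boundary_length R = q * circle_mean 1 (\<lambda>z. norm (poly (pderiv p) z))"
    unfolding circle_mean_cmult[symmetric]
    by (subst boundary_length_eq_circle_mean)
       (use q in \<open>auto simp: dR norm_mult intro!: continuous_intros\<close>)
  ultimately have 3: "(r * circle_mean r (\<lambda>z. norm (deriv f z)) - 1) / (M + 1) \<le> boundary_length R"
    using M1 by (simp add: q_def divide_right_mono)
  show ?thesis by (rule that[OF 1 2 3])
qed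

text \<open>The identity has length 1. The sign matters later: any \<open>c1 > gamma0\<close> is
  positive and may multiply an inequality for \<open>ln n\<close>.\<close>

lemma gamma0_nonneg: "0 \<le> gamma0"
proof -
  have "ereal 0 \<le> (SUP R\<in>{R \<in> univalent_rational_funs n. sup_norm (sphere 0 1) R \<le> 1}.
       ereal (ln (boundary_length R) / ln (real n)))" if n: "1 \<le> n" for n
  proof (rule SUP_upper2)
    define R :: "complex \<Rightarrow> complex" where "R z = poly [:0, 1:] z / poly 1 z" for z
    have R: "R = (\<lambda>z. z)" by (auto simp: R_def)
    have "R \<in> rational_funs n"
      unfolding rational_funs_def R_def[abs_def] using n
      by (intro CollectI exI[of _ "[:0, 1:]"] exI[of _ 1]) auto
    moreover have "\<not> is_pole R z" for z
      by (rule not_is_pole_holomorphic[of UNIV]) (auto simp: R)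
    moreover have "univalent_on R (ball 0 1)" by (auto simp: univalent_on_def R)
    moreover have "sup_norm (sphere 0 1) R \<le> 1"
      unfolding sup_norm_def by (rule SUP_least) (auto simp: R one_ereal_def)
    ultimately show "R \<in> {R \<in> univalent_rational_funs n. sup_norm (sphere 0 1) R \<le> 1}"
      by (simp add: univalent_rational_funs_def)
    have "boundary_length R = 1"
      by (subst boundary_length_eq_circle_mean) (auto simp: R)
    then show "ereal 0 \<le> ereal (ln (boundary_length R) / ln (real n))" by simp
  qed
  then have "\<forall>\<^sub>F n in sequentially. ereal 0 \<le> (SUP R\<in>{R \<in> univalent_rational_funs n. sup_norm (sphere 0 1) R \<le> 1}.
       ereal (ln (boundary_length R) / ln (real n)))"
    using eventually_ge_at_top[of 1] by (rule eventually_mono[rotated])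
  from le_Limsup[OF _ this] show ?thesis by (simp add: gamma0_def zero_ereal_def)
qed


text \<open>Between the two exponents choose \<open>c1 < c2\<close>. At some \<open>r\<close> near
  1, with \<open>x = 1 / (1 - r)\<close>, the mean of \<open>|f'|\<close> exceeds
  \<open>x powr c2\<close>; a univalent section of degree \<open>n \<le> x powr (1 + 2 * e)\<close>
  then has length at least \<open>x powr (c2 - e) \<ge> n powr c1\<close>, against the choice of
  \<open>c1\<close>.\<close>

lemma beta_spectrum_le_gamma0:
  assumes f: "univalent_on f (ball 0 1)" "bounded (f ` ball 0 1)"
  shows "beta_spectrum f 1 \<le> gamma0"
proof (rule ccontr)
  assume "\<not> beta_spectrum f 1 \<le> gamma0"
  then obtain c1 where c1: "gamma0 < ereal c1" "ereal c1 < beta_spectrum f 1"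
    by (meson ereal_dense2 not_le)
  obtain c2 where c2: "ereal c1 < ereal c2" "ereal c2 < beta_spectrum f 1"
    using ereal_dense2[OF c1(2)] by auto
  have c1_pos: "0 < c1" using gamma0_nonneg c1(1) by (metis ereal_less(2) order_le_less_trans)
  \<comment> \<open>The solution of \<open>c2 - e = c1 * (1 + 2 * e)\<close>: the gap between
    \<open>c1\<close> and \<open>c2\<close> pays for a degree above \<open>x\<close> and for the
    constants in the length.\<close>
  define e where "e = (c2 - c1) / (1 + 2 * c1)"
  have e: "0 < e" "c2 - e = c1 * (1 + 2 * e)"
  proof -
    show "0 < e" using c2(1) c1_pos by (simp add: e_def)
    have "e * (1 + 2 * c1) = c2 - c1" using c1_pos by (simp add: e_def)
    then show "c2 - e = c1 * (1 + 2 * e)" by (simp add: algebra_simps)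
  qed
  have fh: "f holomorphic_on ball 0 1" and inj: "inj_on f (ball 0 1)"
    using f(1) by (auto simp: univalent_on_def)
  obtain M where M: "0 < M" "\<And>z. norm z < 1 \<Longrightarrow> norm (f z) \<le> M"
    using f(2) unfolding bounded_pos by auto
  define \<kappa> where "\<kappa> = norm (deriv f 0) / 48"
  have \<kappa>: "0 < \<kappa>"
    using holomorphic_injective_imp_regular[OF fh _ inj, of 0] by (simp add: \<kappa>_def)
  define L where "L n = (SUP R\<in>{R \<in> univalent_rational_funs n. sup_norm (sphere 0 1) R \<le> 1}.
       ereal (ln (boundary_length R) / ln (real n)))" for n
  have "limsup L < ereal c1" using c1(1) by (simp add: gamma0_def L_def[abs_def])
  then have "\<forall>\<^sub>F n in sequentially. L n < ereal c1" by (rule Limsup_lessD)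
  then obtain N where N: "\<And>n. N \<le> n \<Longrightarrow> L n < ereal c1"
    unfolding eventually_sequentially by auto
  \<comment> \<open>All requirements on large \<open>x\<close>. In \<open>x ^ 27\<close>, 25 powers
    come from the injectivity constant and 2 from \<open>1 / (1 - t)^2\<close>;
    \<open>\<kappa> / 2\<close> reflects \<open>r \<ge> 1/2\<close>. The added 1 is room for
    rounding up to the degree \<open>n\<close>.\<close>
  define P where "P x \<longleftrightarrow> 2 \<le> x \<and> 16 * M * x ^ 27 * exp (- (x powr e) / 4) / (\<kappa> / 2) < 1 \<and>
      16 * M * x ^ 2 * exp (- (x powr e) / 4) < 1 \<and> x powr (1 + e) + 1 \<le> x powr (1 + 2 * e) \<and>
      ln (4 * (M + 1)) \<le> e * ln x \<and> real (max N 2) \<le> x powr (1 + e) \<and> ln 4 \<le> c2 * ln x" for x :: real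
  have c2_pos: "0 < c2" using c1_pos c2(1) by simp
  have "\<forall>\<^sub>F x in at_top. P x"
    unfolding P_def
  proof (intro eventually_conj)
    have "((\<lambda>x. 16 * M * x ^ 27 * exp (- (x powr e) / 4) / (\<kappa> / 2)) \<longlongrightarrow> 0) at_top"
      using e(1) \<kappa> by real_asymp
    then show "\<forall>\<^sub>F x in at_top. 16 * M * x ^ 27 * exp (- (x powr e) / 4) / (\<kappa> / 2) < 1"
      by (rule order_tendstoD) simp
    have "((\<lambda>x. 16 * M * x ^ 2 * exp (- (x powr e) / 4)) \<longlongrightarrow> 0) at_top"
      using e(1) by real_asymp
    then show "\<forall>\<^sub>F x in at_top. 16 * M * x ^ 2 * exp (- (x powr e) / 4) < 1"
      by (rule order_tendstoD) simp
    show "\<forall>\<^sub>F x in at_top. x powr (1 + e) + 1 \<le> x powr (1 + 2 * e)" using e(1) by real_asymp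
    show "\<forall>\<^sub>F x in at_top. ln (4 * (M + 1)) \<le> e * ln x" using e(1) by real_asymp
    show "\<forall>\<^sub>F x in at_top. real (max N 2) \<le> x powr (1 + e)" using e(1) by real_asymp
    show "\<forall>\<^sub>F x in at_top. ln 4 \<le> c2 * ln x" using c2_pos by real_asymp
  qed (rule eventually_ge_at_top)
  moreover have "filterlim (\<lambda>r::real. 1 / (1 - r)) at_top (at_left 1)" by real_asymp
  ultimately have ev: "\<forall>\<^sub>F r in at_left 1. P (1 / (1 - r)) \<and> r < 1"
    by (intro eventually_conj) (auto simp: filterlim_iff eventually_at_left_field intro: exI[of _ 0])
  define g where "g r = ereal (ln (integral_mean 1 (deriv f) r) / \<bar>ln (1 - r)\<bar>)" for r
  have "\<exists>r. P (1 / (1 - r)) \<and> r < 1 \<and> ereal c2 < g r"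
  proof (rule ccontr)
    assume "\<not> ?thesis"
    with ev have "\<forall>\<^sub>F r in at_left 1. g r \<le> ereal c2"
      by (auto elim!: eventually_mono simp: not_less)
    then have "Limsup (at_left 1) g \<le> ereal c2" by (rule Limsup_bounded)
    with c2(2) show False by (simp add: beta_spectrum_def g_def[abs_def])
  qed
  then obtain r where r: "P (1 / (1 - r))" "r < 1" "ereal c2 < g r" by blast
  define x where "x = 1 / (1 - r)"
  have Px: "2 \<le> x" "16 * M * x ^ 27 * exp (- (x powr e) / 4) / (\<kappa> / 2) < 1"
      "16 * M * x ^ 2 * exp (- (x powr e) / 4) < 1" "x powr (1 + e) + 1 \<le> x powr (1 + 2 * e)"
      "ln (4 * (M + 1)) \<le> e * ln x" "real (max N 2) \<le> x powr (1 + e)" "ln 4 \<le> c2 * ln x"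
    using r(1) by (auto simp: P_def x_def)
  have rx: "1 - r = 1 / x" using r(2) by (simp add: x_def)
  have r2: "1 / 2 \<le> r"
  proof -
    have "1 / x \<le> 1 / 2" using Px(1) by (intro divide_left_mono) auto
    then show ?thesis using rx by simp
  qed
  have lnx: "\<bar>ln (1 - r)\<bar> = ln x" "0 < ln x" using Px(1) by (simp_all add: rx ln_div)
  define I where "I = circle_mean r (\<lambda>z. norm (deriv f z))"
  have f'c: "continuous_on (ball 0 1) (deriv f)"
    using fh by (intro holomorphic_on_imp_continuous_on holomorphic_deriv) auto
  have I0: "0 \<le> I"
    unfolding I_def by (rule circle_mean_nonneg)
      (use r r2 in \<open>auto intro!: continuous_intros continuous_on_subset[OF f'c]\<close>)
  have "integral_mean 1 (deriv f) r = I" by (simp add: I_def integral_mean_def circle_mean_def)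
  then have lnI: "c2 * ln x < ln I" using r(3) lnx by (simp add: g_def field_simps)
  \<comment> \<open>The convention \<open>ln 0 = 0\<close> has to be excluded; it contradicts
    \<open>ln I > c2 * ln x \<ge> ln 4 > 0\<close>.\<close>
  have I_pos: "0 < I"
  proof (rule ccontr)
    assume "\<not> 0 < I"
    then have "ln I = 0" using I0 by simp
    moreover have "0 < ln (4 :: real)" by simp
    ultimately show False using lnI Px(7) by linarith
  qed
  have I4: "4 \<le> I"
  proof -
    have "ln 4 \<le> ln I" using lnI Px(7) by linarith
    then show ?thesis using I_pos by (subst (asm) ln_le_cancel_iff) auto
  qed
  define n where "n = nat \<lceil>x powr (1 + e)\<rceil>"
  have n: "x powr (1 + e) \<le> real n" "real n \<le> x powr (1 + 2 * e)"
  proof -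
    have "real n = of_int \<lceil>x powr (1 + e)\<rceil>" unfolding n_def
      by (simp add: order_trans[OF _ powr_ge_zero])
    then show "x powr (1 + e) \<le> real n" "real n \<le> x powr (1 + 2 * e)"
      using le_of_int_ceiling[of "x powr (1 + e)"] of_int_ceiling_le_add_one[of "x powr (1 + e)"] Px(4) by linarith+
  qed
  have nN: "N \<le> n" "2 \<le> n" using n(1) Px(6) by linarith+
  define t where "t = sqrt (sqrt r)"
  define E where "E = M * t ^ (n + 1) / (1 - t)\<^sup>2"
  have t: "0 < t" "t < 1" using r r2 by (auto simp: t_def)
  have E_le: "E \<le> 16 * M * x ^ 2 * exp (- (x powr e) / 4)"
  proof -
    have "ln t = ln r / 4" using r2 by (simp add: t_def ln_sqrt)
    moreover have "ln r \<le> r - 1" using r2 by (intro ln_le_minus_one) simp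
    ultimately have lt: "ln t \<le> - (1 / (4 * x))" using rx by (simp add: field_simps)
    have "t ^ (n + 1) \<le> t ^ n" using t by (intro power_decreasing) auto
    also have "t ^ n = exp (real n * ln t)" using t by (simp add: exp_of_nat_mult)
    also have "\<dots> \<le> exp (- (x powr e) / 4)"
    proof -
      have "real n * ln t \<le> real n * (- (1 / (4 * x)))" using lt by (intro mult_left_mono) auto
      also have "\<dots> \<le> x powr (1 + e) * (- (1 / (4 * x)))" using n(1) Px(1) by (intro mult_right_mono_neg) auto
      also have "\<dots> = - (x powr e) / 4" using Px(1) by (simp add: powr_add)
      finally show ?thesis by simp
    qed
    finally have A: "t ^ (n + 1) \<le> exp (- (x powr e) / 4)" .
    \<comment> \<open>As \<open>t ^ 4 = r\<close>, the factorization of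
      \<open>1 - t ^ 4 = 1 / x\<close> has a cofactor of at most 4. Squared, this is the source of
      \<open>16 * x ^ 2\<close>.\<close>
    have "1 / (4 * x) \<le> 1 - t"
    proof -
      have "t ^ 4 = (t\<^sup>2)\<^sup>2" by (simp add: power_mult[symmetric])
      also have "\<dots> = r" using r2 by (simp add: t_def)
      finally have "t ^ 4 = r" .
      then have "1 / x = (1 - t) * (1 + t + t\<^sup>2 + t ^ 3)"
        unfolding rx[symmetric] by (simp add: algebra_simps power2_eq_square power3_eq_cube power4_eq_xxxx)
      also have "\<dots> \<le> (1 - t) * 4"
        using t power_le_one[of t 2] power_le_one[of t 3] by (intro mult_left_mono) auto
      finally show ?thesis by simp
    qed
    then have B: "(1 / (4 * x))\<^sup>2 \<le> (1 - t)\<^sup>2" using Px(1) by (intro power_mono) auto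
    have "E \<le> M * exp (- (x powr e) / 4) / (1 / (4 * x))\<^sup>2"
      unfolding E_def using A B M Px(1) t by (intro frac_le mult_left_mono) auto
    also have "\<dots> = 16 * M * x ^ 2 * exp (- (x powr e) / 4)"
      using Px(1) by (simp add: power_divide power_mult_distrib)
    finally show ?thesis .
  qed
  have "E \<le> 1" using E_le Px(3) by linarith
  moreover have "E < r * (norm (deriv f 0) * (1 - r) ^ 25 / 48)"
  proof -
    have "x ^ 27 = x ^ 2 * x ^ 25" by (simp add: power_add[symmetric])
    then have "(16 * M * x ^ 2 * exp (- (x powr e) / 4)) * x ^ 25 < \<kappa> / 2"
      using Px(2) \<kappa> by (simp add: field_simps)
    then have "16 * M * x ^ 2 * exp (- (x powr e) / 4) < \<kappa> / 2 / x ^ 25"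
      using Px(1) by (simp add: pos_less_divide_eq)
    also have "\<kappa> / 2 / x ^ 25 = 1 / 2 * (\<kappa> * (1 - r) ^ 25)" by (simp add: rx power_divide)
    also have "\<dots> \<le> r * (\<kappa> * (1 - r) ^ 25)" using r2 r(2) \<kappa> by (intro mult_right_mono) auto
    finally show ?thesis using E_le by (simp add: \<kappa>_def)
  qed
  ultimately obtain R where R: "R \<in> univalent_rational_funs n" "sup_norm (sphere 0 1) R \<le> 1"
    "(r * I - 1) / (M + 1) \<le> boundary_length R"
    using univalent_polynomial_approximation[OF f(1) M(2), of r n] r r2
    unfolding I_def E_def t_def by auto
  \<comment> \<open>\<open>r \<ge> 1/2\<close> and \<open>I \<ge> 4\<close> absorb the loss:
    \<open>r * I - 1 \<ge> I / 2 - I / 4\<close>.\<close>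
  have "I / (4 * (M + 1)) \<le> (r * I - 1) / (M + 1)"
  proof -
    have "1 / 2 * I \<le> r * I" using r2 I0 by (intro mult_right_mono) auto
    then have "I / 4 \<le> r * I - 1" using I4 by linarith
    then have "I / 4 / (M + 1) \<le> (r * I - 1) / (M + 1)" using M(1) by (intro divide_right_mono) auto
    then show ?thesis by simp
  qed
  with R(3) have "I / (4 * (M + 1)) \<le> boundary_length R" by linarith
  moreover have "0 < I / (4 * (M + 1))" using I_pos M(1) by simp
  ultimately have "ln (I / (4 * (M + 1))) \<le> ln (boundary_length R)" by simp
  moreover have "ln (I / (4 * (M + 1))) = ln I - ln (4 * (M + 1))" using I_pos M(1) by (subst ln_div) auto
  ultimately have "c2 * ln x - e * ln x \<le> ln (boundary_length R)" using lnI Px(5) by linarith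
  moreover have "c2 * ln x - e * ln x = c1 * ((1 + 2 * e) * ln x)" using e(2) by (simp add: left_diff_distrib[symmetric])
  moreover have "ln (real n) \<le> (1 + 2 * e) * ln x"
  proof -
    have "ln (real n) \<le> ln (x powr (1 + 2 * e))" using n(2) nN Px(1) by (subst ln_le_cancel_iff) auto
    then show ?thesis using Px(1) by (simp add: ln_powr)
  qed
  then have "c1 * ln (real n) \<le> c1 * ((1 + 2 * e) * ln x)" using c1_pos by (intro mult_left_mono) auto
  ultimately have "c1 * ln (real n) \<le> ln (boundary_length R)" by linarith
  moreover have "0 < ln (real n)" using nN by simp
  ultimately have "ereal c1 \<le> ereal (ln (boundary_length R) / ln (real n))" by (simp add: pos_le_divide_eq)
  also have "\<dots> \<le> L n" unfolding L_def by (rule SUP_upper) (use R in auto)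
  also have "\<dots> < ereal c1" by (rule N[OF nN(1)])
  finally show False by simp
qed

theorem theorem1p2:
  shows "B_b 1 \<le> gamma0 \<and> gamma0 \<le> ereal (1/2)"
proof
  show "B_b 1 \<le> gamma0"
    unfolding B_b_def using beta_spectrum_le_gamma0 by (intro SUP_least) auto
  show "gamma0 \<le> ereal (1/2)"
    by (rule gamma0_le_half)
qed

end
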